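(* Let $\mathfrak{o}$ be the ring of integers of a non-archimedean local field whose (finite) residue field has odd characteristic, let $\mathfrak{p}$ be its maximal ideal, and for $\ell\ge 1$ put $\mathfrak{o}_\ell=\mathfrak{o}/\mathfrak{p}^\ell$. Let $\mathbf{B}(\mathfrak{o}_\ell)$ be the subgroup of upper triangular matrices in $\mathrm{GL}_2(\mathfrak{o}_\ell)$. Then for every $\ell\ge 1$ the pair $(\mathrm{GL}_2(\mathfrak{o}_\ell),\mathbf{B}(\mathfrak{o}_\ell))$ is a strong Gelfand pair.
   Context: All representations are complex and finite-dimensional. A pair $(G,H)$ consisting of a finite group $G$ and a subgroup $H$ is a strong Gelfand pair if $\mathrm{Ind}_H^G(\theta)$ is multiplicity-free for every irreducible representation $\theta$ of $H$. *)

theory Defs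
  imports
    "HOL-Algebra.Ideal_Product"
    "HOL-Algebra.QuotRing"
    "HOL-Algebra.Multiplicative_Group"
    "HOL-Algebra.Left_Coset"
    "Jordan_Normal_Form.VS_Connect"
begin

section \<open>Non-archimedean local fields\<close>

text \<open>The value of \<open>v\<close> at \<open>\<zero>\<close> is irrelevant throughout; \<open>val_ge K v m\<close> treats it as \<open>+\<infinity>\<close>.\<close>

definition val_ge :: "('a, 'b) ring_scheme \<Rightarrow> ('a \<Rightarrow> int) \<Rightarrow> int \<Rightarrow> 'a set" where
  "val_ge K v m = {x \<in> carrier K. x = \<zero>\<^bsub>K\<^esub> \<or> m \<le> v x}"

definition integer_ring :: "('a, 'b) ring_scheme \<Rightarrow> ('a \<Rightarrow> int) \<Rightarrow> ('a, 'b) ring_scheme" where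
  "integer_ring K v = K\<lparr>carrier := val_ge K v 0\<rparr>"

definition max_ideal :: "('a, 'b) ring_scheme \<Rightarrow> ('a \<Rightarrow> int) \<Rightarrow> 'a set" where
  "max_ideal K v = val_ge K v 1"

definition residue_field :: "('a, 'b) ring_scheme \<Rightarrow> ('a \<Rightarrow> int) \<Rightarrow> 'a set ring" where
  "residue_field K v = integer_ring K v Quot max_ideal K v"

text \<open>A non-archimedean local field is a field that is complete with respect to a (normalized)
  discrete valuation and has finite residue field.\<close>

locale nonarch_local_field = field K
  for K :: "('a, 'b) ring_scheme" (structure) and v :: "'a \<Rightarrow> int" +
  assumes val_mult: "\<lbrakk>x \<in> carrier K - {\<zero>}; y \<in> carrier K - {\<zero>}\<rbrakk> \<Longrightarrow> v (x \<otimes> y) = v x + v y"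
    and val_add: "\<lbrakk>x \<in> carrier K - {\<zero>}; y \<in> carrier K - {\<zero>}; x \<oplus> y \<noteq> \<zero>\<rbrakk>
      \<Longrightarrow> min (v x) (v y) \<le> v (x \<oplus> y)"
    and val_surj: "v ` (carrier K - {\<zero>}) = UNIV"
    and complete: "\<lbrakk>range (s :: nat \<Rightarrow> 'a) \<subseteq> carrier K;
        \<forall>m. \<exists>N. \<forall>i\<ge>N. \<forall>j\<ge>N. s i \<ominus> s j \<in> val_ge K v m\<rbrakk>
      \<Longrightarrow> \<exists>x\<in>carrier K. \<forall>m. \<exists>N. \<forall>i\<ge>N. s i \<ominus> x \<in> val_ge K v m"
    and finite_residue_field: "finite (carrier (residue_field K v))"

text \<open>The additive order of \<open>1\<close>; \<open>group.ord\<close> is \<open>0\<close> on elements of infinite order, so this is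
  the usual characteristic.\<close>

definition ring_char :: "('a, 'b) ring_scheme \<Rightarrow> nat" where
  "ring_char R = group.ord (add_monoid R) \<one>\<^bsub>R\<^esub>"

definition trunc_ring :: "('a, 'b) ring_scheme \<Rightarrow> ('a \<Rightarrow> int) \<Rightarrow> nat \<Rightarrow> 'a set ring" where
  "trunc_ring K v l =
     integer_ring K v Quot (max_ideal K v [^]\<^bsub>ideals_set (integer_ring K v)\<^esub> l)"


section \<open>The group \<open>GL\<^sub>2\<close> over a commutative ring\<close>

datatype 'a mat2 = Mat2 (e11: 'a) (e12: 'a) (e21: 'a) (e22: 'a)

definition mat2_monoid :: "('a, 'b) ring_scheme \<Rightarrow> 'a mat2 monoid" where
  "mat2_monoid R =
    \<lparr>carrier = {A. set_mat2 A \<subseteq> carrier R},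
     mult = (\<lambda>A B. Mat2
       (e11 A \<otimes>\<^bsub>R\<^esub> e11 B \<oplus>\<^bsub>R\<^esub> e12 A \<otimes>\<^bsub>R\<^esub> e21 B) (e11 A \<otimes>\<^bsub>R\<^esub> e12 B \<oplus>\<^bsub>R\<^esub> e12 A \<otimes>\<^bsub>R\<^esub> e22 B)
       (e21 A \<otimes>\<^bsub>R\<^esub> e11 B \<oplus>\<^bsub>R\<^esub> e22 A \<otimes>\<^bsub>R\<^esub> e21 B) (e21 A \<otimes>\<^bsub>R\<^esub> e12 B \<oplus>\<^bsub>R\<^esub> e22 A \<otimes>\<^bsub>R\<^esub> e22 B)),
     one = Mat2 \<one>\<^bsub>R\<^esub> \<zero>\<^bsub>R\<^esub> \<zero>\<^bsub>R\<^esub> \<one>\<^bsub>R\<^esub>\<rparr>"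

definition GL2 :: "('a, 'b) ring_scheme \<Rightarrow> 'a mat2 monoid" where
  "GL2 R = units_of (mat2_monoid R)"

definition upper_triangular_GL2 :: "('a, 'b) ring_scheme \<Rightarrow> 'a mat2 set" where
  "upper_triangular_GL2 R = {A \<in> carrier (GL2 R). e21 A = \<zero>\<^bsub>R\<^esub>}"


section \<open>Complex matrix representations\<close>

text \<open>A complex representation of degree \<open>n\<close> is a homomorphism from \<open>G\<close> to \<open>GL\<^sub>n(\<complex>)\<close>; up to
  isomorphism this covers every finite-dimensional complex representation. Degree \<open>0\<close> is
  allowed for representations, but not for irreducible ones.\<close>

definition matrix_rep ::
  "('g, 'm) monoid_scheme \<Rightarrow> nat \<Rightarrow> ('g \<Rightarrow> complex mat) \<Rightarrow> bool" where
  "matrix_rep G n \<rho> \<longleftrightarrow> \<rho> \<in> hom G (units_of (ring_mat TYPE(complex) n ()))"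

definition irreducible_rep ::
  "('g, 'm) monoid_scheme \<Rightarrow> nat \<Rightarrow> ('g \<Rightarrow> complex mat) \<Rightarrow> bool" where
  "irreducible_rep G n \<rho> \<longleftrightarrow> matrix_rep G n \<rho> \<and> 0 < n \<and>
     (\<forall>W. VectorSpace.subspace class_ring W (module_vec TYPE(complex) n) \<and>
          (\<forall>g\<in>carrier G. \<forall>w\<in>W. \<rho> g *\<^sub>v w \<in> W) \<longrightarrow>
          W = {0\<^sub>v n} \<or> W = carrier_vec n)"

text \<open>\<open>similar_mat_wit A B P Q\<close> says that \<open>P\<close> and \<open>Q\<close> are mutually inverse and \<open>A = P * B * Q\<close>,
  with all four matrices square of the same size. In particular, representations of different
  degrees are never equivalent.\<close>

definition equivalent_rep ::
  "('g, 'm) monoid_scheme \<Rightarrow> ('g \<Rightarrow> complex mat) \<Rightarrow> ('g \<Rightarrow> complex mat) \<Rightarrow> bool" where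
  "equivalent_rep G \<rho> \<sigma> \<longleftrightarrow> (\<exists>P Q. \<forall>g\<in>carrier G. similar_mat_wit (\<rho> g) (\<sigma> g) P Q)"

definition multiplicity_free ::
  "('g, 'm) monoid_scheme \<Rightarrow> ('g \<Rightarrow> complex mat) \<Rightarrow> bool" where
  "multiplicity_free G \<rho> \<longleftrightarrow>
     (\<exists>\<sigma>s. (\<forall>\<sigma>\<in>set \<sigma>s. \<exists>k. irreducible_rep G k \<sigma>) \<and>
           (\<forall>i j. i < j \<and> j < length \<sigma>s \<longrightarrow> \<not> equivalent_rep G (\<sigma>s ! i) (\<sigma>s ! j)) \<and>
           equivalent_rep G \<rho> (\<lambda>g. diag_block_mat (map (\<lambda>\<sigma>. \<sigma> g) \<sigma>s)))"


section \<open>Induced representations and strong Gelfand pairs\<close>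

definition left_transversal :: "('g, 'm) monoid_scheme \<Rightarrow> 'g set \<Rightarrow> 'g list \<Rightarrow> bool" where
  "left_transversal G H ts \<longleftrightarrow> set ts \<subseteq> carrier G \<and> distinct ts \<and>
     bij_betw (\<lambda>t. t <#\<^bsub>G\<^esub> H) (set ts) (lcosets\<^bsub>G\<^esub> H)"

text \<open>The classical matrix form of the induced representation: for coset representatives
  \<open>t\<^sub>0, t\<^sub>1, \<dots>\<close> of \<open>G/H\<close> and \<open>\<theta>\<close> of degree \<open>n\<close>, the \<open>(i, j)\<close> block of size \<open>n \<times> n\<close> of the matrix
  at \<open>g\<close> is \<open>\<theta> (t\<^sub>i\<^sup>-\<^sup>1 g t\<^sub>j)\<close> if this element lies in \<open>H\<close>, and zero otherwise. It is the matrix of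
  \<open>g\<close> on \<open>\<complex>[G] \<otimes>\<^sub>\<complex>\<^sub>[\<^sub>H\<^sub>] \<complex>\<^sup>n\<close> in the basis of the \<open>t\<^sub>i \<otimes> e\<^sub>r\<close>; another choice of
  representatives gives an equivalent representation.\<close>

definition induced_rep ::
  "('g, 'm) monoid_scheme \<Rightarrow> 'g set \<Rightarrow> nat \<Rightarrow> ('g \<Rightarrow> complex mat) \<Rightarrow> 'g \<Rightarrow> complex mat" where
  "induced_rep G H n \<theta> g =
     (let ts = SOME ts. left_transversal G H ts
      in mat (length ts * n) (length ts * n) (\<lambda>(i, j).
           let h = inv\<^bsub>G\<^esub> (ts ! (i div n)) \<otimes>\<^bsub>G\<^esub> g \<otimes>\<^bsub>G\<^esub> (ts ! (j div n))
           in if h \<in> H then \<theta> h $$ (i mod n, j mod n) else 0))"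

definition strong_gelfand_pair :: "('g, 'm) monoid_scheme \<Rightarrow> 'g set \<Rightarrow> bool" where
  "strong_gelfand_pair G H \<longleftrightarrow> group G \<and> finite (carrier G) \<and> subgroup H G \<and>
     (\<forall>n \<theta>. irreducible_rep (G\<lparr>carrier := H\<rparr>) n \<theta> \<longrightarrow> multiplicity_free G (induced_rep G H n \<theta>))"

end

theory Submission
  imports Defs
    "HOL-Algebra.Subrings"
    "HOL-Computational_Algebra.Fundamental_Theorem_Algebra"
    "HOL-Library.Function_Algebras"
begin

text \<open>
  Let \<open>R\<close> be the truncated ring of integers, with maximal ideal \<open>\<pp>\<close>, and let \<open>B = T U\<close> be the group of
  upper triangular matrices. By Maschke's theorem and Frobenius reciprocity it suffices that two
  \<open>B\<close>-homomorphisms \<open>f, g\<close> from an irreducible representation \<open>W\<close> of \<open>B\<close> to an irreducible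
  representation \<open>V\<close> of \<open>GL\<^sub>2(R)\<close> are always linearly dependent, and for this it suffices to find one
  nonzero \<open>w \<in> W\<close> for which \<open>f w\<close> and \<open>g w\<close> lie on a line.

  Twisting by characters of the determinant does not change the problem, so let \<open>j\<close> be the least
  positive level such that a twist of \<open>V\<close> is trivial on the congruence subgroup \<open>K\<^sub>j\<close>.
  If \<open>U(\<pp>\<^sup>j\<^sup>-\<^sup>1)\<close> acts nontrivially on \<open>W\<close>, take for \<open>w\<close> an eigenvector of \<open>U\<close>: its character is generic
  of level \<open>j\<close>, and generic characters occur at most once in \<open>V\<close> by Gelfand's trick for the
  anti-automorphism exchanging the two diagonal entries. Otherwise \<open>f\<close> and \<open>g\<close> map into the eigenspace
  \<open>X\<close> of \<open>B \<inter> K\<^sub>j\<^sub>-\<^sub>1\<close> for a character \<open>\<chi>(d)\<close> of the lower right entry. If \<open>\<chi>\<close> is nontrivial on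
  \<open>1 + \<pp>\<^sup>j\<^sup>-\<^sup>1\<close>, then \<open>X\<close> is a cyclic module over \<open>U\<close>, so eigenvectors of \<open>U\<close> will do. If it is trivial and
  \<open>j > 1\<close>, then by minimality of \<open>j\<close> only generic characters of the lower unipotent group with entries
  in \<open>\<pp>\<close> occur in \<open>X\<close>; each occurs once, again by Gelfand's trick, and \<open>T\<close> permutes them transitively,
  so eigenvectors of \<open>T\<close> will do. For \<open>j = 1\<close> the space \<open>X\<close> of \<open>B\<close>-fixed vectors is a line, because it
  is generated by an eigenvector of the Hecke operator of the nontrivial Bruhat cell.
\<close>

section \<open>Eigenvectors\<close>

text \<open>Outside the generic case the argument rests on each nonzero vector of \<open>X\<close>
  generating \<open>X\<close> over \<open>congr_lower 1\<close>, the matrices that are upper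
  triangular modulo the maximal ideal. Irreducibility of \<open>V\<close> only gives generation over
  the whole group, so the other Bruhat cell must be controlled; projected back to \<open>X\<close>,
  it contributes the operator sending \<open>x\<close> to \<open>e\<^sub>X (act swp x)\<close>. If
  \<chi> is nontrivial on the last layer, this operator vanishes, because the swap moves the trivial
  character of the first diagonal entry to the second, where \<open>X\<close> requires \<chi>. If
  \<chi> is trivial there and j > 1, the operator factors through the average over the last layer of
  lower unipotent matrices; so it vanishes unless \<open>X\<close> has a vector fixed by that layer,
  and such a vector forces all of \<open>V\<close> down to level j - 1. Minimality of j is realised
  as strong induction on j. Each stage chooses a new twist, read off from a torus eigenvector of
  \<open>W\<close>, that makes the first diagonal entry act trivially on it; only after this
  normalisation does a single character \<chi>(d) describe \<open>X\<close>.\<close>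

definition poly_act :: "(complex \<Rightarrow> 'v::ab_group_add \<Rightarrow> 'v) \<Rightarrow> complex poly \<Rightarrow> ('v \<Rightarrow> 'v) \<Rightarrow> 'v \<Rightarrow> 'v" where
  "poly_act scale p L y = (\<Sum>i\<le>degree p. scale (coeff p i) ((L ^^ i) y))"

locale complex_vs = vector_space scale for scale :: "complex \<Rightarrow> 'v::ab_group_add \<Rightarrow> 'v" (infixr \<open>*s\<close> 75)
begin

text \<open>Linearity only on a subspace: the operators are total functions on the ambient type, and
  a representation prescribes nothing outside its own space.\<close>

definition lin_on :: "'v set \<Rightarrow> ('v \<Rightarrow> 'v) \<Rightarrow> bool" where
  "lin_on V L \<longleftrightarrow> (\<forall>x\<in>V. \<forall>y\<in>V. L (x + y) = L x + L y) \<and> (\<forall>c. \<forall>x\<in>V. L (c *s x) = c *s L x)"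

lemma lin_onD:
  assumes "lin_on V L"
  shows "x \<in> V \<Longrightarrow> y \<in> V \<Longrightarrow> L (x + y) = L x + L y" "x \<in> V \<Longrightarrow> L (c *s x) = c *s L x"
  using assms by (auto simp: lin_on_def)

lemma lin_on_zero:
  assumes "lin_on V L" "subspace V"
  shows "L 0 = 0"
  using lin_onD(2)[OF assms(1) subspace_0[OF assms(2)], of 0] by simp

lemma lin_on_sum:
  assumes L: "lin_on V L" and V: "subspace V" and "\<And>i. i \<in> A \<Longrightarrow> f i \<in> V"
  shows "L (\<Sum>i\<in>A. f i) = (\<Sum>i\<in>A. L (f i))"
  using assms(3)
proof (induction A rule: infinite_finite_induct)
  case (insert x F)
  then have "(\<Sum>i\<in>F. f i) \<in> V" by (intro subspace_sum[OF V]) auto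
  with insert show ?case by (simp add: lin_onD(1)[OF L])
qed (auto simp: lin_on_zero[OF L V])

lemma lin_on_span:
  assumes L: "lin_on V L" and V: "subspace V" and A: "A \<subseteq> V" and T: "subspace T"
    and "\<And>a. a \<in> A \<Longrightarrow> L a \<in> T" and x: "x \<in> span A"
  shows "L x \<in> T"
proof -
  have "x \<in> V \<and> L x \<in> T"
  proof (rule span_induct[OF x, of "\<lambda>x. x \<in> V \<and> L x \<in> T", simplified mem_Collect_eq])
    show "subspace {x. x \<in> V \<and> L x \<in> T}"
      using V T by (auto simp: subspace_def lin_onD[OF L] lin_on_zero[OF L V])
  qed (use assms in auto)
  then show ?thesis by blast
qed


lemma poly_act_bound:
  assumes "degree p \<le> n"
  shows "poly_act scale p L y = (\<Sum>i\<le>n. coeff p i *s ((L ^^ i) y))"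
  unfolding poly_act_def
  by (rule sum.mono_neutral_left) (use assms in \<open>auto simp: coeff_eq_0\<close>)

lemma funpow_in: "y \<in> Y \<Longrightarrow> L ` Y \<subseteq> Y \<Longrightarrow> (L ^^ i) y \<in> Y"
  by (induction i) auto

lemma poly_act_in:
  assumes "subspace Y" "y \<in> Y" "L ` Y \<subseteq> Y"
  shows "poly_act scale p L y \<in> Y"
  unfolding poly_act_def using assms by (intro subspace_sum subspace_scale funpow_in) auto

lemma poly_act_linear_factor:
  assumes L: "lin_on Y L" and Y: "subspace Y" "y \<in> Y" "L ` Y \<subseteq> Y"
  shows "poly_act scale ([:- r, 1:] * q) L y = L (poly_act scale q L y) - r *s poly_act scale q L y"
proof -
  define n where "n = degree q"
  have iter: "(L ^^ i) y \<in> Y" for i using Y by (intro funpow_in)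
  have d: "degree ([:- r, 1:] * q) \<le> Suc n" using degree_mult_le[of "[:- r, 1:]" q] by (simp add: n_def)
  have c: "coeff ([:- r, 1:] * q) i = (case i of 0 \<Rightarrow> 0 | Suc k \<Rightarrow> coeff q k) - r * coeff q i" for i
    by (simp add: mult_pCons_left coeff_pCons algebra_simps split: nat.splits)
  have "poly_act scale ([:- r, 1:] * q) L y = (\<Sum>i\<le>Suc n. coeff ([:- r, 1:] * q) i *s ((L ^^ i) y))"
    by (rule poly_act_bound[OF d])
  also have "\<dots> = (\<Sum>i\<le>Suc n. (case i of 0 \<Rightarrow> 0 | Suc k \<Rightarrow> coeff q k) *s ((L ^^ i) y))
      - (\<Sum>i\<le>Suc n. (r * coeff q i) *s ((L ^^ i) y))"
    unfolding c by (simp only: scale_left_diff_distrib sum_subtractf)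
  also have "(\<Sum>i\<le>Suc n. (case i of 0 \<Rightarrow> 0 | Suc k \<Rightarrow> coeff q k) *s ((L ^^ i) y))
      = (\<Sum>i\<le>n. coeff q i *s L ((L ^^ i) y))"
    by (subst sum.atMost_Suc_shift) simp
  also have "\<dots> = L (\<Sum>i\<le>n. coeff q i *s ((L ^^ i) y))"
    by (subst lin_on_sum[OF L Y(1)]) (use iter Y in \<open>auto simp: lin_onD[OF L] intro: subspace_scale\<close>)
  also have "(\<Sum>i\<le>n. coeff q i *s ((L ^^ i) y)) = poly_act scale q L y"
    by (simp add: poly_act_def n_def)
  also have "(\<Sum>i\<le>Suc n. (r * coeff q i) *s ((L ^^ i) y)) = r *s poly_act scale q L y"
    by (subst poly_act_bound[of q "Suc n"]) (auto simp: n_def scale_sum_right scale_right_distrib)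
  finally show ?thesis .
qed

text \<open>Split off one root \<open>r\<close> of \<open>p\<close> at a time. If \<open>q\<close>
  is the cofactor and q(L) y is nonzero, that vector is an eigenvector for \<open>r\<close>;
  otherwise \<open>q\<close> annihilates \<open>y\<close> as well and has smaller degree.\<close>

lemma eigenvector_of_annihilating_poly:
  assumes L: "lin_on Y L" and Y: "subspace Y" "L ` Y \<subseteq> Y"
    and "y \<in> Y" "y \<noteq> 0" "p \<noteq> 0" "poly_act scale p L y = 0"
  shows "\<exists>z\<in>Y. z \<noteq> 0 \<and> (\<exists>c. L z = c *s z)"
  using assms(4-)
proof (induction "degree p" arbitrary: p)
  case 0
  then obtain c where "p = [:c:]" using degree_eq_zeroE by metis
  with 0 show ?case by (simp add: poly_act_def)
next
  case (Suc n)
  then obtain r where "poly p r = 0"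
    using fundamental_theorem_of_algebra[of p] by (metis Suc_neq_Zero constant_degree)
  then obtain q where q: "p = [:- r, 1:] * q" using poly_eq_0_iff_dvd by blast
  with Suc have q0: "q \<noteq> 0" by auto
  have deg: "n = degree q" using Suc(2) q0 degree_mult_eq[of "[:- r, 1:]" q] unfolding q by (simp del: mult_pCons_left)
  let ?z = "poly_act scale q L y"
  have z: "?z \<in> Y" by (rule poly_act_in) (use Y Suc in auto)
  have "L ?z = r *s ?z"
    using poly_act_linear_factor[OF L Y(1) \<open>y \<in> Y\<close> Y(2), of r q] Suc.prems(4) q by simp
  then show ?case using Suc.hyps(1)[OF deg _ _ q0] Suc.prems z by (cases "?z = 0") auto
qed

text \<open>The \<open>card B + 1\<close> iterates of \<open>y\<close> lie in the span of
  \<open>card B\<close> vectors, which yields a polynomial annihilating \<open>y\<close> and hence,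
  over the complex numbers, an eigenvector.\<close>

lemma eigenvector_exists:
  assumes L: "lin_on Y L" and Y: "subspace Y" "L ` Y \<subseteq> Y" and B: "finite B" "Y \<subseteq> span B"
    and y: "y \<in> Y" "y \<noteq> 0"
  shows "\<exists>z\<in>Y. z \<noteq> 0 \<and> (\<exists>c. L z = c *s z)"
proof -
  define f where "f i = (L ^^ i) y" for i :: nat
  have iter: "f i \<in> Y" for i unfolding f_def using Y y by (intro funpow_in)
  show ?thesis
  proof (cases "inj_on f {..card B}")
    case True
    then have c: "card (f ` {..card B}) = Suc (card B)" by (simp add: card_image)
    have "dependent (f ` {..card B})"
    proof (rule ccontr)
      assume "\<not> dependent (f ` {..card B})"
      from independent_span_bound[OF B(1) this] iter B(2) c show False by auto
    qed
    then obtain u where u: "\<exists>v\<in>f ` {..card B}. u v \<noteq> 0" "(\<Sum>v\<in>f ` {..card B}. u v *s v) = 0"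
      by (auto simp: dependent_finite)
    define p where "p = (\<Sum>i\<le>card B. monom (u (f i)) i)"
    have cp: "coeff p i = (if i \<le> card B then u (f i) else 0)" for i
      by (simp add: p_def coeff_sum)
    have "degree p \<le> card B" by (rule degree_le) (simp add: cp)
    then have "poly_act scale p L y = (\<Sum>i\<le>card B. u (f i) *s f i)"
      by (subst poly_act_bound) (auto simp: cp f_def)
    also have "\<dots> = 0" using u(2) True by (simp add: sum.reindex)
    finally have "poly_act scale p L y = 0" .
    moreover have "p \<noteq> 0" using u(1) cp by (metis atMost_iff coeff_0 imageE)
    ultimately show ?thesis using eigenvector_of_annihilating_poly[OF L Y y] by blast
  next
    case False
    then obtain i j where ij: "i \<noteq> j" "f i = f j" by (auto simp: inj_on_def)
    \<comment> \<open>Linear dependence is a property of sets, so it says nothing about repeated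
      iterates; a repetition gives the polynomial x^i - x^j instead.\<close>
    define p where "p = monom (1::complex) i - monom 1 j"
    have cp: "coeff p k = (if k = i then 1 else 0) - (if k = j then 1 else 0)" for k
      by (auto simp: p_def)
    then have "coeff p i \<noteq> 0" using ij by simp
    then have "p \<noteq> 0" by auto
    have "degree p \<le> i + j" by (rule degree_le) (simp add: cp)
    then have "poly_act scale p L y = (\<Sum>k\<le>i+j. coeff p k *s f k)"
      by (subst poly_act_bound) (auto simp: f_def)
    also have "\<dots> = (\<Sum>k\<le>i+j. if k = i then f i else 0) - (\<Sum>k\<le>i+j. if k = j then f j else 0)"
      unfolding sum_subtractf[symmetric] by (rule sum.cong) (use ij in \<open>auto simp: cp\<close>)
    also have "\<dots> = 0" using ij by simp
    finally show ?thesis using eigenvector_of_annihilating_poly[OF L Y y \<open>p \<noteq> 0\<close>] by blast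
  qed
qed

lemma dependent_pair:
  assumes "x \<in> span {z}" "y \<in> span {z}"
  shows "\<exists>a b. (a \<noteq> 0 \<or> b \<noteq> 0) \<and> a *s x + b *s y = 0"
proof -
  obtain c d where cd: "x = c *s z" "y = d *s z" using assms by (auto simp: span_singleton)
  show ?thesis
  proof (cases "c = 0")
    case True
    then show ?thesis using cd by (intro exI[of _ 1] exI[of _ 0]) auto
  next
    case False
    then show ?thesis using cd by (intro exI[of _ d] exI[of _ "-c"]) (auto simp: mult.commute)
  qed
qed

end

section \<open>Representations of finite groups\<close>

locale lin_rep = complex_vs scale + group G
  for scale :: "complex \<Rightarrow> 'v::ab_group_add \<Rightarrow> 'v" (infixr \<open>*s\<close> 75) and G :: "'g monoid" (structure) +
  fixes V :: "'v set" and act :: "'g \<Rightarrow> 'v \<Rightarrow> 'v"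
  assumes sub: "subspace V"
    and fin_dim: "\<exists>B. finite B \<and> V \<subseteq> span B"
    and act_add: "\<lbrakk>g \<in> carrier G; x \<in> V; y \<in> V\<rbrakk> \<Longrightarrow> act g (x + y) = act g x + act g y"
    and act_scale: "\<lbrakk>g \<in> carrier G; x \<in> V\<rbrakk> \<Longrightarrow> act g (c *s x) = c *s act g x"
    and act_closed: "\<lbrakk>g \<in> carrier G; x \<in> V\<rbrakk> \<Longrightarrow> act g x \<in> V"
    and act_mult: "\<lbrakk>g \<in> carrier G; h \<in> carrier G; x \<in> V\<rbrakk> \<Longrightarrow> act (g \<otimes> h) x = act g (act h x)"
    and act_one: "x \<in> V \<Longrightarrow> act \<one> x = x"
begin

definition invariant :: "'g set \<Rightarrow> 'v set \<Rightarrow> bool" where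
  "invariant A S \<longleftrightarrow> subspace S \<and> S \<subseteq> V \<and> (\<forall>a\<in>A. \<forall>x\<in>S. act a x \<in> S)"

definition irreducible :: bool where
  "irreducible \<longleftrightarrow> V \<noteq> {0} \<and> (\<forall>S. invariant (carrier G) S \<longrightarrow> S = {0} \<or> S = V)"

definition orbit :: "'g set \<Rightarrow> 'v \<Rightarrow> 'v set" where
  "orbit A v = (\<lambda>a. act a v) ` A"

definition eigenspace :: "'g set \<Rightarrow> ('g \<Rightarrow> complex) \<Rightarrow> 'v set" where
  "eigenspace A \<chi> = {v \<in> V. \<forall>a\<in>A. act a v = \<chi> a *s v}"

text \<open>The averaging idempotent of a character: on a finite subgroup it projects onto the
  \<open>\<chi>\<close>-eigenspace. The inverse of \<open>\<chi> a\<close> takes the place of the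
  complex conjugate, so unitarity never has to be discussed.\<close>

definition proj :: "'g set \<Rightarrow> ('g \<Rightarrow> complex) \<Rightarrow> 'v \<Rightarrow> 'v" where
  "proj A \<chi> v = (1 / of_nat (card A)) *s (\<Sum>a\<in>A. inverse (\<chi> a) *s act a v)"

definition character :: "'g set \<Rightarrow> ('g \<Rightarrow> complex) \<Rightarrow> bool" where
  "character A \<chi> \<longleftrightarrow> subgroup A G \<and> finite A \<and> (\<forall>a\<in>A. \<chi> a \<noteq> 0) \<and> (\<forall>a\<in>A. \<forall>b\<in>A. \<chi> (a \<otimes> b) = \<chi> a * \<chi> b)"

lemma lin_act: "g \<in> carrier G \<Longrightarrow> lin_on V (act g)"
  by (simp add: lin_on_def act_add act_scale)

lemma lin_on_mono: "lin_on V L \<Longrightarrow> S \<subseteq> V \<Longrightarrow> lin_on S L"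
  unfolding lin_on_def by blast

lemma invariantD:
  assumes "invariant A S"
  shows "subspace S" "S \<subseteq> V" "a \<in> A \<Longrightarrow> x \<in> S \<Longrightarrow> act a x \<in> S"
  using assms by (auto simp: invariant_def)

lemma act_inv_cancel: "g \<in> carrier G \<Longrightarrow> x \<in> V \<Longrightarrow> act (inv g) (act g x) = x"
  "g \<in> carrier G \<Longrightarrow> x \<in> V \<Longrightarrow> act g (act (inv g) x) = x"
  by (simp_all add: act_mult[symmetric] act_one)

lemma act_zero: "g \<in> carrier G \<Longrightarrow> act g 0 = 0"
  using lin_on_zero[OF lin_act sub] .

lemma act_eq_zero: "g \<in> carrier G \<Longrightarrow> x \<in> V \<Longrightarrow> act g x = 0 \<Longrightarrow> x = 0"
  using act_inv_cancel(1)[of g x] act_zero[of "inv g"] by simp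

lemma eigenspace_subspace: "A \<subseteq> carrier G \<Longrightarrow> subspace (eigenspace A \<chi>)"
  unfolding subspace_def eigenspace_def
  using subspace_0[OF sub] subspace_add[OF sub] subspace_scale[OF sub]
  by (auto simp: subset_iff act_zero act_add act_scale scale_right_distrib mult.commute)

lemma span_orbit_invariant:
  assumes A: "subgroup A G" and v: "v \<in> V"
  shows "invariant A (span (orbit A v))"
proof -
  have AG: "A \<subseteq> carrier G" by (rule subgroup.subset[OF A])
  have o: "orbit A v \<subseteq> V" using AG v by (auto simp: orbit_def act_closed)
  have "act a x \<in> span (orbit A v)" if "a \<in> A" "x \<in> span (orbit A v)" for a x
  proof (rule lin_on_span[OF lin_act sub o subspace_span _ that(2)])
    fix y assume "y \<in> orbit A v"
    then obtain b where "b \<in> A" "y = act b v" by (auto simp: orbit_def)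
    then have "act a y = act (a \<otimes> b) v" "a \<otimes> b \<in> A"
      using AG v that A by (auto simp: act_mult subset_iff subgroup.m_closed)
    then show "act a y \<in> span (orbit A v)" by (auto simp: orbit_def intro: span_base)
  qed (use that AG in auto)
  then show ?thesis
    using span_minimal[OF o sub] by (auto simp: invariant_def)
qed

lemma mem_span_orbit: "subgroup A G \<Longrightarrow> v \<in> V \<Longrightarrow> v \<in> span (orbit A v)"
  using act_one subgroup.one_closed[of A G] by (auto simp: orbit_def intro!: span_base image_eqI[where x = \<one>])

lemma irreducible_span_orbit:
  assumes irreducible "v \<in> V" "v \<noteq> 0"
  shows "V = span (orbit (carrier G) v)"
  using assms span_orbit_invariant[OF subgroup_self \<open>v \<in> V\<close>] mem_span_orbit[OF subgroup_self \<open>v \<in> V\<close>]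
  unfolding irreducible_def by blast

lemma lin_proj: assumes "A \<subseteq> carrier G" shows "lin_on V (proj A \<chi>)"
  unfolding lin_on_def proj_def using assms
  by (auto simp: act_add act_scale subset_iff scale_right_distrib sum.distrib scale_sum_right mult_ac
      intro!: sum.cong)

lemma proj_in_invariant:
  assumes "invariant A S" "x \<in> S"
  shows "proj A \<chi> x \<in> S"
  unfolding proj_def
  using invariantD[OF assms(1)] assms(2) by (intro subspace_scale subspace_sum) auto

lemma proj_closed: "A \<subseteq> carrier G \<Longrightarrow> x \<in> V \<Longrightarrow> proj A \<chi> x \<in> V"
  by (rule proj_in_invariant) (auto simp: invariant_def sub act_closed)

lemma characterD:
  assumes "character A \<chi>"
  shows "subgroup A G" "A \<subseteq> carrier G" "finite A" "a \<in> A \<Longrightarrow> \<chi> a \<noteq> 0"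
    "a \<in> A \<Longrightarrow> b \<in> A \<Longrightarrow> \<chi> (a \<otimes> b) = \<chi> a * \<chi> b" "card A \<noteq> 0"
  using assms subgroup.subset[of A G] subgroup.one_closed[of A G] by (auto simp: character_def)

lemma proj_eigen:
  assumes c: "character A \<chi>" and x: "x \<in> eigenspace A \<chi>"
  shows "proj A \<chi> x = x"
proof -
  have "proj A \<chi> x = (1 / of_nat (card A)) *s (\<Sum>a\<in>A. x)"
    unfolding proj_def using x characterD(4)[OF c]
    by (intro arg_cong[where f = "scale _"] sum.cong) (auto simp: eigenspace_def)
  also have "(\<Sum>a\<in>A. x) = of_nat (card A) *s x" 
    by (induction A rule: infinite_finite_induct) (auto simp: scale_left_distrib)
  finally show ?thesis using characterD(6)[OF c] by simp
qed

lemma act_proj: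
  assumes c: "character A \<chi>" and a: "a \<in> A" and x: "x \<in> V"
  shows "act a (proj A \<chi> x) = \<chi> a *s proj A \<chi> x"
proof -
  note A = characterD[OF c]
  have aG: "a \<in> carrier G" using A a by auto
  have "act a (\<Sum>b\<in>A. inverse (\<chi> b) *s act b x) = (\<Sum>b\<in>A. act a (inverse (\<chi> b) *s act b x))"
    by (rule lin_on_sum[OF lin_act[OF aG] sub]) (use A x in \<open>auto intro!: subspace_scale[OF sub] act_closed\<close>)
  also have "\<dots> = (\<Sum>b\<in>A. \<chi> a *s inverse (\<chi> (a \<otimes> b)) *s act (a \<otimes> b) x)"
    using A x aG a by (intro sum.cong) (auto simp: act_scale act_closed act_mult subset_iff)
  also have "\<dots> = (\<Sum>b\<in>A. \<chi> a *s inverse (\<chi> b) *s act b x)"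
  proof (rule sum.reindex_bij_witness[of _ "\<lambda>b. inv a \<otimes> b" "\<lambda>b. a \<otimes> b"])
    fix b assume "b \<in> A"
    moreover from this have "b \<in> carrier G" using A by auto
    ultimately show "a \<otimes> (inv a \<otimes> b) = b" "inv a \<otimes> b \<in> A" "inv a \<otimes> (a \<otimes> b) = b" "a \<otimes> b \<in> A"
      using a aG A(1) by (auto simp: m_assoc[symmetric] subgroup.m_closed subgroup.m_inv_closed)
  qed simp
  finally show ?thesis
    unfolding proj_def using A aG x 
    by (subst act_scale) (auto simp: scale_sum_right[symmetric] scale_left_commute intro!: subspace_sum[OF sub] subspace_scale[OF sub] act_closed simp del: scale_scale)
qed

lemma proj_in_eigenspace: "character A \<chi> \<Longrightarrow> x \<in> V \<Longrightarrow> proj A \<chi> x \<in> eigenspace A \<chi>"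
  using act_proj characterD(2) by (auto simp: eigenspace_def proj_closed)

text \<open>Here \<open>\<sigma>\<close> stands for conjugation by \<open>g\<close>: reindexing the
  average along it moves \<open>act g\<close> to the outside and replaces \<open>\<chi>\<close> by
  the transported character \<open>\<chi>'\<close>.\<close>

lemma proj_normalized:
  assumes c: "character A \<chi>" and g: "g \<in> carrier G" and x: "x \<in> V"
    and n: "\<And>a. a \<in> A \<Longrightarrow> \<sigma> a \<in> A \<and> act a (act g x) = act g (act (\<sigma> a) x) \<and> \<chi>' (\<sigma> a) = \<chi> a"
    and b: "inj_on \<sigma> A"
  shows "proj A \<chi> (act g x) = act g (proj A \<chi>' x)"
proof -
  note A = characterD[OF c]
  have \<sigma>A: "\<sigma> ` A = A" using endo_inj_surj[OF A(3) _ b] n by blast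
  have mem: "a \<in> A \<Longrightarrow> act a x \<in> V" for a using A(2) x by (auto intro: act_closed)
  have "(\<Sum>a\<in>A. inverse (\<chi> a) *s act a (act g x)) = (\<Sum>a\<in>A. inverse (\<chi>' (\<sigma> a)) *s act g (act (\<sigma> a) x))"
    using n by (intro sum.cong) auto
  also have "\<dots> = (\<Sum>a\<in>\<sigma> ` A. inverse (\<chi>' a) *s act g (act a x))"
    using b by (simp add: sum.reindex)
  also have "\<dots> = (\<Sum>a\<in>A. act g (inverse (\<chi>' a) *s act a x))"
    unfolding \<sigma>A using g mem by (simp add: act_scale)
  also have "\<dots> = act g (\<Sum>a\<in>A. inverse (\<chi>' a) *s act a x)"
    by (rule lin_on_sum[OF lin_act[OF g] sub, symmetric]) (auto intro!: subspace_scale[OF sub] mem)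
  finally show ?thesis
    unfolding proj_def using g mem
    by (subst act_scale) (auto intro!: subspace_sum[OF sub] subspace_scale[OF sub])
qed

lemma proj_act:
  assumes c: "character A \<chi>" and a: "a \<in> A" and x: "x \<in> V"
  shows "proj A \<chi> (act a x) = \<chi> a *s proj A \<chi> x"
proof -
  note A = characterD[OF c]
  have aG: "a \<in> carrier G" using A a by auto
  have "(\<Sum>b\<in>A. inverse (\<chi> b) *s act b (act a x)) = (\<Sum>b\<in>A. \<chi> a *s inverse (\<chi> (b \<otimes> a)) *s act (b \<otimes> a) x)"
    using A x aG a by (intro sum.cong) (auto simp: act_scale act_closed act_mult subset_iff)
  also have "\<dots> = (\<Sum>b\<in>A. \<chi> a *s inverse (\<chi> b) *s act b x)"
  proof (rule sum.reindex_bij_witness[of _ "\<lambda>b. b \<otimes> inv a" "\<lambda>b. b \<otimes> a"])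
    fix b assume "b \<in> A"
    moreover from this have "b \<in> carrier G" using A by auto
    ultimately show "b \<otimes> inv a \<otimes> a = b" "b \<otimes> inv a \<in> A" "b \<otimes> a \<otimes> inv a = b" "b \<otimes> a \<in> A"
      using a aG A(1) by (auto simp: m_assoc subgroup.m_closed subgroup.m_inv_closed)
  qed simp
  finally show ?thesis
    unfolding proj_def by (simp add: scale_sum_right[symmetric] scale_left_commute del: scale_scale)
qed

text \<open>Since the average absorbs \<open>a\<close> as the scalar \<open>\<chi> a\<close>, an
  eigenvector of \<open>a\<close> for another eigenvalue is projected to a vector on which two
  different scalars agree.\<close>

lemma proj_eq_zero:
  assumes c: "character A \<chi>" and a: "a \<in> A" and x: "x \<in> V" and "act a x = \<kappa> *s x" "\<kappa> \<noteq> \<chi> a"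
  shows "proj A \<chi> x = 0"
proof -
  have "\<chi> a *s proj A \<chi> x = proj A \<chi> (\<kappa> *s x)" using proj_act[OF c a x] assms by simp
  also have "\<dots> = \<kappa> *s proj A \<chi> x" using lin_onD(2)[OF lin_proj[OF characterD(2)[OF c]] x] .
  finally show ?thesis using assms(5) by simp
qed

text \<open>The elements are added one at a time: the joint eigenspace already reached inside
  \<open>S\<close> is stable under the next element, which commutes with the earlier ones, and so
  contains an eigenvector of it.\<close>

lemma common_eigenvector:
  assumes A: "finite A" "A \<subseteq> carrier G" and comm: "\<And>a b. a \<in> A \<Longrightarrow> b \<in> A \<Longrightarrow> a \<otimes> b = b \<otimes> a"
    and S: "invariant A S" "S \<noteq> {0}"
  obtains y \<chi> where "y \<in> S" "y \<noteq> 0" "\<And>a. a \<in> A \<Longrightarrow> act a y = \<chi> a *s y"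
proof -
  note SD = invariantD[OF S(1)]
  obtain B where B: "finite B" "V \<subseteq> span B" using fin_dim by blast
  have "\<exists>y\<in>S. y \<noteq> 0 \<and> (\<exists>\<chi>. \<forall>a\<in>A'. act a y = \<chi> a *s y)" if "finite A'" "A' \<subseteq> A" for A'
    using that
  proof (induction A' rule: finite_induct)
    case empty
    then show ?case using S(2) subspace_0[OF SD(1)] by auto
  next
    case (insert b A')
    then obtain y \<chi> where y: "y \<in> S" "y \<noteq> 0" "\<forall>a\<in>A'. act a y = \<chi> a *s y" by auto
    define Y where "Y = S \<inter> eigenspace A' \<chi>"
    have bG: "b \<in> carrier G" and A'G: "A' \<subseteq> carrier G" using insert A by auto
    have Ysub: "subspace Y" unfolding Y_def by (intro subspace_inter SD(1) eigenspace_subspace A'G)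
    have "act b x \<in> Y" if x: "x \<in> Y" for x
    proof -
      have xV: "x \<in> V" "x \<in> S" using x SD(2) by (auto simp: Y_def)
      have "act a (act b x) = \<chi> a *s act b x" if a: "a \<in> A'" for a
      proof -
        have "act a (act b x) = act b (act a x)"
          using a bG A'G xV insert.prems comm[of a b] by (auto simp: act_mult[symmetric] subset_iff)
        also have "\<dots> = \<chi> a *s act b x" using x a bG xV by (auto simp: Y_def eigenspace_def act_scale)
        finally show ?thesis .
      qed
      then show ?thesis using xV SD(3) bG insert.prems by (auto simp: Y_def eigenspace_def act_closed)
    qed
    moreover have "lin_on Y (act b)" using lin_act[OF bG] by (rule lin_on_mono) (use SD in \<open>auto simp: Y_def\<close>)
    moreover have "Y \<subseteq> span B" using B SD by (auto simp: Y_def)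
    moreover have "y \<in> Y" using y SD(2) by (auto simp: Y_def eigenspace_def)
    ultimately obtain z c where z: "z \<in> Y" "z \<noteq> 0" "act b z = c *s z"
      using eigenvector_exists[OF _ Ysub _ B(1), of "act b" y] y by auto
    have "\<forall>a\<in>insert b A'. act a z = (\<chi>(b := c)) a *s z" using z insert.hyps by (auto simp: Y_def eigenspace_def)
    then show ?case using z unfolding Y_def by blast
  qed
  from this[OF A(1) order_refl] show ?thesis using that by blast
qed

lemma eigen_character:
  assumes "subgroup A G" "finite A" "y \<in> V" "y \<noteq> 0" "\<And>a. a \<in> A \<Longrightarrow> act a y = \<chi> a *s y"
  shows "character A \<chi>"
proof -
  have AG: "A \<subseteq> carrier G" using assms subgroup.subset by blast
  have "\<chi> (a \<otimes> b) = \<chi> a * \<chi> b" if "a \<in> A" "b \<in> A" for a b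
  proof -
    have "\<chi> (a \<otimes> b) *s y = act (a \<otimes> b) y" using assms(5)[of "a \<otimes> b"] subgroup.m_closed[OF assms(1)] that by simp
    also have "\<dots> = act a (act b y)" using AG that assms(3) by (simp add: act_mult subset_iff)
    also have "\<dots> = (\<chi> a * \<chi> b) *s y" using AG that assms(3) by (simp add: assms(5) act_scale mult.commute subset_iff)
    finally show ?thesis using assms(4) by simp
  qed
  moreover have "\<chi> a \<noteq> 0" if "a \<in> A" for a
    using assms(5)[OF that] act_eq_zero[of a y] that AG assms by auto
  ultimately show ?thesis using assms by (auto simp: character_def)
qed

text \<open>The projection sends \<open>act a v\<close> to \<open>\<chi> a\<close> times the
  projection of \<open>v\<close>, so it maps the whole cyclic span to one line, while it leaves
  \<open>x\<close> unchanged.\<close>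

lemma cyclic_eigenspace:
  assumes c: "character A \<chi>" and v: "v \<in> V" and x: "x \<in> span (orbit A v)" "x \<in> eigenspace A \<chi>"
  shows "x \<in> span {proj A \<chi> v}"
proof -
  note A = characterD[OF c]
  have "orbit A v \<subseteq> V" using A(2) v by (auto simp: orbit_def act_closed)
  moreover have "proj A \<chi> y \<in> span {proj A \<chi> v}" if "y \<in> orbit A v" for y
    using proj_act[OF c _ v] that by (auto simp: orbit_def span_base span_scale)
  ultimately have "proj A \<chi> x \<in> span {proj A \<chi> v}"
    by (intro lin_on_span[OF lin_proj[OF A(2)] sub _ subspace_span _ x(1)])
  then show ?thesis using proj_eigen[OF c x(2)] by simp
qed

text \<open>Gelfand's trick: the anti-automorphism \<open>\<tau>\<close> fixes the operators \<open>e g e\<close>, where \<open>e\<close> is the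
  projection onto the \<open>\<phi>\<close>-eigenspace, so they commute; being transitive on \<open>e X\<close>, they are scalars.\<close>

lemma gelfand_trick:
  assumes c: "character N \<phi>" and \<Gamma>: "subgroup \<Gamma> G" "N \<subseteq> \<Gamma>" and X: "invariant \<Gamma> X"
    and gen: "\<And>x. x \<in> X \<Longrightarrow> x \<noteq> 0 \<Longrightarrow> X \<subseteq> span (orbit \<Gamma> x)"
    and \<tau>: "\<And>g. g \<in> \<Gamma> \<Longrightarrow> \<tau> g \<in> \<Gamma>" "\<And>g h. g \<in> \<Gamma> \<Longrightarrow> h \<in> \<Gamma> \<Longrightarrow> \<tau> (g \<otimes> h) = \<tau> h \<otimes> \<tau> g" "\<And>n. n \<in> N \<Longrightarrow> \<tau> n = n"
    and sym: "\<And>g x. g \<in> \<Gamma> \<Longrightarrow> x \<in> X \<Longrightarrow> x \<in> eigenspace N \<phi> \<Longrightarrow> proj N \<phi> (act (\<tau> g) x) = proj N \<phi> (act g x)"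
  shows "\<exists>z. X \<inter> eigenspace N \<phi> \<subseteq> span {z}"
proof -
  note N = characterD[OF c] and XD = invariantD[OF X]
  have \<Gamma>G: "\<Gamma> \<subseteq> carrier G" by (rule subgroup.subset[OF \<Gamma>(1)])
  define e where "e = proj N \<phi>"
  define Y where "Y = X \<inter> eigenspace N \<phi>"
  have XN: "invariant N X" using X \<Gamma>(2) by (auto simp: invariant_def)
  have eY: "e x \<in> Y" if "x \<in> X" for x
    using proj_in_invariant[OF XN that] proj_in_eigenspace[OF c, of x] that XD(2) by (auto simp: Y_def e_def)
  have e_id: "e y = y" if "y \<in> Y" for y using proj_eigen[OF c] that by (auto simp: Y_def e_def)
  have lin_e: "lin_on V e" unfolding e_def by (rule lin_proj[OF N(2)])
  have YX: "Y \<subseteq> X" "Y \<subseteq> V" using XD by (auto simp: Y_def)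
  have Ysub: "subspace Y" unfolding Y_def by (intro subspace_inter XD(1) eigenspace_subspace N(2))
  define L where "L g y = e (act g y)" for g y
  have L_in: "L g y \<in> Y" if "g \<in> \<Gamma>" "y \<in> Y" for g y
    unfolding L_def using that YX XD(3) by (auto intro!: eY)
  have lin_L: "lin_on V (L g)" if "g \<in> \<Gamma>" for g
    using that \<Gamma>G by (auto simp: lin_on_def L_def lin_onD[OF lin_e] act_add act_scale act_closed)
  \<comment> \<open>Writing out the inner projection as an average over \<open>N\<close> turns a
    product of two operators into a combination of single ones: this is multiplication in the Hecke
    algebra of \<open>N\<close> and \<open>\<phi>\<close>.\<close>
  have L_expand: "L g (L h y) = (1 / of_nat (card N)) *s (\<Sum>n\<in>N. inverse (\<phi> n) *s L (g \<otimes> n \<otimes> h) y)"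
    if gh: "g \<in> \<Gamma>" "h \<in> \<Gamma>" and y: "y \<in> Y" for g h y
  proof -
    have yV: "y \<in> V" and hy: "act h y \<in> V" using y YX gh \<Gamma>G by (auto intro: act_closed)
    have mem: "act n (act h y) \<in> V" if "n \<in> N" for n using that N hy by (auto intro: act_closed)
    have "L g (e (act h y)) = (1 / of_nat (card N)) *s (\<Sum>n\<in>N. inverse (\<phi> n) *s L g (act n (act h y)))"
      unfolding e_def proj_def
    proof -
      have S: "(\<Sum>n\<in>N. inverse (\<phi> n) *s act n (act h y)) \<in> V"
        by (intro subspace_sum[OF sub] subspace_scale[OF sub] mem)
      show "L g ((1 / of_nat (card N)) *s (\<Sum>n\<in>N. inverse (\<phi> n) *s act n (act h y)))
        = (1 / of_nat (card N)) *s (\<Sum>n\<in>N. inverse (\<phi> n) *s L g (act n (act h y)))"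
        unfolding lin_onD(2)[OF lin_L[OF gh(1)] S]
        by (subst lin_on_sum[OF lin_L[OF gh(1)] sub])
          (auto intro!: arg_cong[where f = "scale _"] sum.cong subspace_scale[OF sub] mem simp: lin_onD(2)[OF lin_L[OF gh(1)] mem])
    qed
    also have "(\<Sum>n\<in>N. inverse (\<phi> n) *s L g (act n (act h y))) = (\<Sum>n\<in>N. inverse (\<phi> n) *s L (g \<otimes> n \<otimes> h) y)"
      unfolding L_def using N gh \<Gamma>G yV hy by (intro sum.cong) (auto simp: act_mult subset_iff m_closed act_closed)
    finally show ?thesis by (simp add: L_def)
  qed
  \<comment> \<open>\<open>\<tau>\<close> reverses \<open>g \<otimes> n \<otimes> h\<close> and
    fixes \<open>n\<close>, so \<open>sym\<close> turns the expansion for \<open>g\<close>,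
    \<open>h\<close> into the one for \<open>\<tau> h\<close>, \<open>\<tau> g\<close>; applied once
    more to each factor it removes the two \<open>\<tau>\<close>.\<close>
  have L_comm: "L g (L h y) = L h (L g y)" if gh: "g \<in> \<Gamma>" "h \<in> \<Gamma>" and y: "y \<in> Y" for g h y
  proof -
    have S: "L (\<tau> k) z = L k z" if "k \<in> \<Gamma>" "z \<in> Y" for k z
      using sym[OF that(1), of z] that(2) unfolding L_def e_def Y_def by auto
    have "L g (L h y) = (1 / of_nat (card N)) *s (\<Sum>n\<in>N. inverse (\<phi> n) *s L (\<tau> h \<otimes> n \<otimes> \<tau> g) y)"
      unfolding L_expand[OF gh y]
    proof (intro arg_cong[where f = "scale _"] sum.cong refl)
      fix n assume n: "n \<in> N"
      have "n \<in> \<Gamma>" "g \<otimes> n \<in> \<Gamma>" "g \<otimes> n \<otimes> h \<in> \<Gamma>" using n \<Gamma> gh by (auto intro: subgroup.m_closed)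
      moreover from this have "\<tau> (g \<otimes> n \<otimes> h) = \<tau> h \<otimes> n \<otimes> \<tau> g"
        using \<tau>(2)[of "g \<otimes> n" h] \<tau>(2)[of g n] \<tau>(3)[OF n] \<tau>(1)[of g] \<tau>(1)[of h] gh \<Gamma>G
        by (simp add: m_assoc subset_iff)
      ultimately show "L (g \<otimes> n \<otimes> h) y = L (\<tau> h \<otimes> n \<otimes> \<tau> g) y" using S[OF _ y] by metis
    qed
    also have "\<dots> = L (\<tau> h) (L (\<tau> g) y)" by (rule L_expand[symmetric]) (use gh y \<tau> in auto)
    also have "\<dots> = L h (L g y)" using gh y by (simp add: S L_in)
    finally show ?thesis .
  qed
  obtain B where B: "finite B" "V \<subseteq> span B" using fin_dim by blast
  \<comment> \<open>Let \<open>z\<close> be an eigenvector of \<open>L g\<close> with eigenvalue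
    \<open>\<mu>\<close>. By commutation each \<open>L h z\<close> lies in the same eigenspace, and
    these vectors span \<open>Y\<close>, since \<open>z\<close> generates \<open>X\<close> and
    \<open>e\<close> maps \<open>X\<close> onto \<open>Y\<close>.\<close>
  have L_scalar: "\<exists>\<mu>. \<forall>y\<in>Y. L g y = \<mu> *s y" if g: "g \<in> \<Gamma>" and ne: "\<exists>y0\<in>Y. y0 \<noteq> 0" for g
  proof -
    obtain y0 where "y0 \<in> Y" "y0 \<noteq> 0" using ne by blast
    then obtain z \<mu> where z: "z \<in> Y" "z \<noteq> 0" "L g z = \<mu> *s z"
      using eigenvector_exists[OF lin_on_mono[OF lin_L[OF g] YX(2)] Ysub _ B(1), of y0] L_in[OF g] YX(2) B(2) by blast
    have "L g y = \<mu> *s y" if y: "y \<in> Y" for y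
    proof -
      have oV: "orbit \<Gamma> z \<subseteq> V" using z YX \<Gamma>G by (auto simp: orbit_def intro: act_closed)
      have T: "subspace {x\<in>Y. L g x = \<mu> *s x}"
        using Ysub YX(2) lin_on_zero[OF lin_L[OF g] sub] unfolding subspace_def
        by (auto simp: lin_onD[OF lin_L[OF g]] subset_iff scale_right_distrib mult.commute)
      have "y \<in> span (orbit \<Gamma> z)" using gen[of z] z YX y by blast
      from lin_on_span[OF lin_e sub oV T _ this]
      have "e y \<in> {x\<in>Y. L g x = \<mu> *s x}"
      proof -
        have "e x \<in> {x \<in> Y. L g x = \<mu> *s x}" if "x \<in> orbit \<Gamma> z" for x
        proof -
          from that obtain h where h: "h \<in> \<Gamma>" "x = act h z" by (auto simp: orbit_def)
          have "L g (L h z) = L h (\<mu> *s z)" using L_comm[OF g h(1) z(1)] z(3) by simp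
          also have "\<dots> = \<mu> *s L h z" by (rule lin_onD(2)[OF lin_L[OF h(1)]]) (use z YX in auto)
          finally show ?thesis using L_in[OF h(1) z(1)] h(2) by (simp add: L_def)
        qed
        then show ?thesis using \<open>(\<And>a. a \<in> orbit \<Gamma> z \<Longrightarrow> e a \<in> {x \<in> Y. L g x = \<mu> *s x}) \<Longrightarrow> e y \<in> {x \<in> Y. L g x = \<mu> *s x}\<close> by blast
      qed
      then show ?thesis using e_id[OF y] by simp
    qed
    then show ?thesis by blast
  qed
  show ?thesis
  proof (cases "\<exists>y0\<in>Y. y0 \<noteq> 0")
    case True
    then obtain z where z: "z \<in> Y" "z \<noteq> 0" by blast
    have oV: "orbit \<Gamma> z \<subseteq> V" using z YX \<Gamma>G by (auto simp: orbit_def intro: act_closed)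
    have "y \<in> span {z}" if y: "y \<in> Y" for y
    proof -
      have "y \<in> span (orbit \<Gamma> z)" using gen[of z] z YX y by blast
      from lin_on_span[OF lin_e sub oV subspace_span _ this, of "{z}"]
      have "e y \<in> span {z}"
        using L_scalar[OF _ True] z(1) unfolding orbit_def L_def by (force intro: span_scale span_base)
      then show ?thesis using e_id[OF y] by simp
    qed
    then show ?thesis unfolding Y_def by blast
  next
    case False
    then show ?thesis unfolding Y_def by (intro exI[of _ 0]) auto
  qed
qed

end

section \<open>Finite chain rings and their additive characters\<close>

text \<open>This is what is used of the truncated integers: up to units, every element is a power of
  one nilpotent \<open>p\<close>. The exponent \<open>i\<close> may reach the nilpotency index, so
  zero is included.\<close>

locale finite_chain_ring = cring R for R :: "'a ring" (structure) +
  fixes p :: 'a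
  assumes finite_carrier: "finite (carrier R)"
    and p_closed [simp]: "p \<in> carrier R"
    and one_not_zero: "\<one> \<noteq> \<zero>"
    and p_nilpotent: "\<exists>m::nat. p [^] m = \<zero>"
    and chain: "x \<in> carrier R \<Longrightarrow> \<exists>u\<in>Units R. \<exists>i::nat. x = u \<otimes> p [^] i"
begin

definition P :: "nat \<Rightarrow> 'a set" where
  "P i = (\<lambda>r. p [^] i \<otimes> r) ` carrier R"

lemma P_closed: "x \<in> P i \<Longrightarrow> x \<in> carrier R"
  by (auto simp: P_def)

lemma P_subset: "P i \<subseteq> carrier R"
  using P_closed by blast

lemma finite_P: "finite (P i)"
  using finite_subset[OF P_subset finite_carrier] .

lemma P_0: "P 0 = carrier R"
  by (auto simp: P_def image_iff)

lemma P_ideal: "ideal (P i) R"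
proof -
  have "P i = PIdl (p [^] i)" by (auto simp: P_def cgenideal_def m_comm)
  then show ?thesis by (simp add: cgenideal_ideal)
qed

lemma P_zero: "\<zero> \<in> P i"
  by (rule additive_subgroup.zero_closed[OF ideal.axioms(1)[OF P_ideal]])

lemma P_add: "x \<in> P i \<Longrightarrow> y \<in> P i \<Longrightarrow> x \<oplus> y \<in> P i"
  by (rule additive_subgroup.a_closed[OF ideal.axioms(1)[OF P_ideal]])

lemma P_neg: "x \<in> P i \<Longrightarrow> \<ominus> x \<in> P i"
  by (rule additive_subgroup.a_inv_closed[OF ideal.axioms(1)[OF P_ideal]])

lemma P_diff: "x \<in> P i \<Longrightarrow> y \<in> P i \<Longrightarrow> x \<ominus> y \<in> P i"
  by (simp add: a_minus_def P_add P_neg)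

lemma P_lmult: "r \<in> carrier R \<Longrightarrow> x \<in> P i \<Longrightarrow> r \<otimes> x \<in> P i"
  using ideal.I_l_closed[OF P_ideal] by blast

lemma P_rmult: "r \<in> carrier R \<Longrightarrow> x \<in> P i \<Longrightarrow> x \<otimes> r \<in> P i"
  using ideal.I_r_closed[OF P_ideal] by blast

lemma P_mult:
  assumes "x \<in> P i" "y \<in> P k"
  shows "x \<otimes> y \<in> P (i + k)"
proof -
  obtain r s where rs: "r \<in> carrier R" "s \<in> carrier R" "x = p [^] i \<otimes> r" "y = p [^] k \<otimes> s"
    using assms by (auto simp: P_def)
  have "x \<otimes> y = p [^] (i + k) \<otimes> (r \<otimes> s)"
    unfolding rs nat_pow_mult[OF p_closed, symmetric] using rs by (simp add: m_ac)
  then show ?thesis using rs by (auto simp: P_def)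
qed

lemma P_mono: "i \<le> k \<Longrightarrow> x \<in> P k \<Longrightarrow> x \<in> P i"
proof -
  assume "i \<le> k" and x: "x \<in> P k"
  then obtain m where k: "k = i + m" using le_Suc_ex by blast
  from x obtain r where r: "r \<in> carrier R" "x = p [^] k \<otimes> r" by (auto simp: P_def)
  then have "x = p [^] i \<otimes> (p [^] m \<otimes> r)" by (simp add: k nat_pow_mult[symmetric] m_assoc)
  then show "x \<in> P i" using r by (auto simp: P_def)
qed

lemma p_pow_in_P: "p [^] i \<in> P i"
  by (auto simp: P_def image_iff intro!: bexI[of _ \<one>])

lemma unit_or_P1: "x \<in> carrier R \<Longrightarrow> x \<in> Units R \<or> x \<in> P 1"
proof -
  assume "x \<in> carrier R"
  then obtain u i where ui: "u \<in> Units R" "x = u \<otimes> p [^] (i::nat)" using chain by blast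
  show ?thesis
  proof (cases i)
    case 0
    then show ?thesis using ui by simp
  next
    case (Suc m)
    have "x \<in> P (Suc m)" unfolding ui(2) Suc by (intro P_lmult p_pow_in_P) (use ui in auto)
    then show ?thesis using P_mono[of 1 "Suc m"] by simp
  qed
qed

text \<open>If \<open>p\<close> divided a unit it would divide one, and a high power of that
  factorisation of one would be zero.\<close>

lemma unit_not_P1: "x \<in> Units R \<Longrightarrow> x \<notin> P 1"
proof
  assume x: "x \<in> Units R" "x \<in> P 1"
  then obtain r where r: "r \<in> carrier R" "x = p \<otimes> r" by (auto simp: P_def)
  obtain m :: nat where m: "p [^] m = \<zero>" using p_nilpotent by blast
  have "p \<otimes> (r \<otimes> inv x) = \<one>" using r x Units_r_inv[of x] by (simp add: m_assoc[symmetric])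
  then have "\<one> = (p \<otimes> (r \<otimes> inv x)) [^] m" by simp
  also have "\<dots> = \<zero>" using r x m by (simp add: nat_pow_distrib)
  finally show False using one_not_zero by simp
qed

lemma unit_iff: "x \<in> carrier R \<Longrightarrow> x \<in> Units R \<longleftrightarrow> x \<notin> P 1"
  using unit_or_P1 unit_not_P1 by blast

lemma unit_add_P1: "x \<in> Units R \<Longrightarrow> y \<in> P 1 \<Longrightarrow> x \<oplus> y \<in> Units R"
proof -
  assume x: "x \<in> Units R" and y: "y \<in> P 1"
  have yc: "y \<in> carrier R" and xc: "x \<in> carrier R" using x y P_closed by auto
  have "x \<oplus> y \<notin> P 1"
  proof
    assume "x \<oplus> y \<in> P 1"
    then have "x \<oplus> y \<ominus> y \<in> P 1" using y by (rule P_diff)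
    moreover have "x \<oplus> y \<ominus> y = x" using xc yc by algebra
    ultimately show False using unit_not_P1[OF x] by simp
  qed
  then show ?thesis using unit_iff[of "x \<oplus> y"] xc yc by simp
qed

lemma one_add_P1: "y \<in> P i \<Longrightarrow> 1 \<le> i \<Longrightarrow> \<one> \<oplus> y \<in> Units R"
  using unit_add_P1[OF Units_one_closed] P_mono by blast

lemma Units_mult_iff:
  assumes "x \<in> carrier R" "y \<in> carrier R"
  shows "x \<otimes> y \<in> Units R \<longleftrightarrow> x \<in> Units R \<and> y \<in> Units R"
  using assms unit_iff[of x] unit_iff[of y] unit_not_P1[of "x \<otimes> y"] P_lmult[of x y 1] P_rmult[of y x 1]
  by blast

lemma not_P_valuation:
  assumes "x \<in> carrier R" "x \<notin> P r"
  obtains u v where "u \<in> Units R" "v < r" "x = u \<otimes> p [^] (v::nat)"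
proof -
  obtain u v where uv: "u \<in> Units R" "x = u \<otimes> p [^] (v::nat)" using chain assms by blast
  then have "x \<in> P v" by (auto intro: P_lmult p_pow_in_P)
  then have "v < r" using assms P_mono[of r v x] not_less by blast
  then show ?thesis using that uv by blast
qed

lemma P_eq_zero: "\<exists>m. P m = {\<zero>}"
proof -
  obtain m :: nat where "p [^] m = \<zero>" using p_nilpotent by blast
  then have "P m = {\<zero>}" using zero_closed by (auto simp: P_def simp del: zero_closed)
  then show ?thesis by blast
qed

end

section \<open>Additive characters of a finite commutative ring and their duality\<close>

definition additive_char :: "('a, 'b) ring_scheme \<Rightarrow> 'a set \<Rightarrow> ('a \<Rightarrow> complex) \<Rightarrow> bool" where
  "additive_char R A \<phi> \<longleftrightarrow> (\<forall>x\<in>A. \<phi> x \<noteq> 0) \<and> (\<forall>x\<in>A. \<forall>y\<in>A. \<phi> (x \<oplus>\<^bsub>R\<^esub> y) = \<phi> x * \<phi> y)"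

lemma (in ring) additive_char_zero:
  assumes "additive_char R A \<phi>" "\<zero> \<in> A"
  shows "\<phi> \<zero> = 1"
proof -
  have "\<phi> (\<zero> \<oplus> \<zero>) = \<phi> \<zero> * \<phi> \<zero>" using assms unfolding additive_char_def by blast
  then show ?thesis using assms by (simp add: additive_char_def)
qed

lemma (in ring) additive_char_neg:
  assumes "additive_char R A \<phi>" "additive_subgroup A R" "x \<in> A"
  shows "\<phi> (\<ominus> x) = inverse (\<phi> x)"
proof -
  have "\<phi> (x \<oplus> \<ominus> x) = \<phi> x * \<phi> (\<ominus> x)"
    using assms additive_subgroup.a_inv_closed[OF assms(2,3)] unfolding additive_char_def by blast
  moreover have "x \<oplus> \<ominus> x = \<zero>" using additive_subgroup.a_Hcarr[OF assms(2,3)] r_neg by simp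
  moreover have "\<phi> \<zero> = 1"
    using additive_char_zero[OF assms(1)] additive_subgroup.zero_closed[OF assms(2)] by simp
  ultimately show ?thesis by (metis inverse_unique)
qed

text \<open>Translating the summation variable by \<open>x\<close> multiplies the sum by
  \<open>\<phi> x\<close>, which is not one.\<close>

lemma (in cring) sum_additive_char:
  assumes fin: "finite (carrier R)" and \<phi>: "additive_char R (carrier R) \<phi>"
    and x: "x \<in> carrier R" "\<phi> x \<noteq> 1"
  shows "(\<Sum>a\<in>carrier R. \<phi> a) = 0"
proof -
  have "(\<Sum>a\<in>carrier R. \<phi> a) = (\<Sum>a\<in>carrier R. \<phi> (x \<oplus> a))"
    by (rule sum.reindex_bij_witness[of _ "\<lambda>a. x \<oplus> a" "\<lambda>a. \<ominus> x \<oplus> a"])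
      (use x in \<open>auto simp: a_assoc[symmetric] r_neg l_neg\<close>)
  also have "\<dots> = \<phi> x * (\<Sum>a\<in>carrier R. \<phi> a)"
    unfolding sum_distrib_left using \<phi> x by (intro sum.cong) (auto simp: additive_char_def)
  finally have "(1 - \<phi> x) * (\<Sum>a\<in>carrier R. \<phi> a) = 0" by (simp add: algebra_simps)
  then show ?thesis using x by simp
qed

text \<open>Double counting of \<open>\<Sum>\<phi>'(a) \<phi>(-ta)\<close>: if \<open>\<phi>'\<close> differed from every \<open>\<phi>(t \<cdot>)\<close>,
  orthogonality in \<open>a\<close> would make the sum vanish, while orthogonality in \<open>t\<close> leaves only
  positive terms.\<close>

lemma (in cring) additive_char_dual:
  assumes fin: "finite (carrier R)"
    and \<phi>: "additive_char R (carrier R) \<phi>" and \<psi>: "additive_char R (carrier R) \<psi>"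
    and ker: "\<And>a. a \<in> carrier R \<Longrightarrow> (\<forall>r\<in>carrier R. \<phi> (r \<otimes> a) = 1) \<Longrightarrow> \<psi> a = 1"
  shows "\<exists>t\<in>carrier R. \<forall>a\<in>carrier R. \<psi> a = \<phi> (t \<otimes> a)"
proof (rule ccontr)
  assume contra: "\<not> ?thesis"
  have asub: "additive_subgroup (carrier R) R" by (simp add: additive_subgroup_def add.subgroup_self)
  note neg = additive_char_neg[OF \<phi> asub]
  have D: "\<phi> (x \<oplus> y) = \<phi> x * \<phi> y" "\<psi> (x \<oplus> y) = \<psi> x * \<psi> y" "\<phi> x \<noteq> 0" if "x \<in> carrier R" "y \<in> carrier R" for x y
    using \<phi> \<psi> that by (auto simp: additive_char_def)
  have inner0: "(\<Sum>a\<in>carrier R. \<psi> a * \<phi> (\<ominus> (t \<otimes> a))) = 0" if t: "t \<in> carrier R" for t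
  proof -
    obtain b where b: "b \<in> carrier R" "\<psi> b \<noteq> \<phi> (t \<otimes> b)" using contra t by blast
    show ?thesis
    proof (rule sum_additive_char[OF fin _ b(1)])
      show "additive_char R (carrier R) (\<lambda>a. \<psi> a * \<phi> (\<ominus> (t \<otimes> a)))"
        unfolding additive_char_def
      proof (intro conjI ballI)
        fix x y assume xy: "x \<in> carrier R" "y \<in> carrier R"
        have "\<ominus> (t \<otimes> (x \<oplus> y)) = \<ominus> (t \<otimes> x) \<oplus> \<ominus> (t \<otimes> y)" using xy t by algebra
        then show "\<psi> (x \<oplus> y) * \<phi> (\<ominus> (t \<otimes> (x \<oplus> y))) = \<psi> x * \<phi> (\<ominus> (t \<otimes> x)) * (\<psi> y * \<phi> (\<ominus> (t \<otimes> y)))"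
          using xy t D by simp
      qed (use t \<phi> \<psi> in \<open>auto simp: additive_char_def\<close>)
      show "\<psi> b * \<phi> (\<ominus> (t \<otimes> b)) \<noteq> 1"
        using b t D(3)[of "t \<otimes> b"] by (simp add: neg field_simps)
    qed
  qed
  \<comment> \<open>For fixed \<open>a\<close> the summand is, up to the constant
    \<open>\<psi> a\<close>, a character in \<open>t\<close>, trivial exactly when all
    \<open>\<phi> (r \<otimes> a)\<close> are one; in that case \<open>ker\<close> also gives
    \<open>\<psi> a = 1\<close>, so the sum is the order of the ring.\<close>
  have outer: "(\<Sum>t\<in>carrier R. \<psi> a * \<phi> (\<ominus> (t \<otimes> a))) = (if \<forall>r\<in>carrier R. \<phi> (r \<otimes> a) = 1 then of_nat (card (carrier R)) else 0)"
    if a: "a \<in> carrier R" for a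
  proof (cases "\<forall>r\<in>carrier R. \<phi> (r \<otimes> a) = 1")
    case True
    then show ?thesis using ker[OF a] a by (simp add: neg)
  next
    case False
    then obtain r where r: "r \<in> carrier R" "\<phi> (r \<otimes> a) \<noteq> 1" by blast
    have "(\<Sum>t\<in>carrier R. \<phi> (\<ominus> (t \<otimes> a))) = 0"
    proof (rule sum_additive_char[OF fin _ r(1)])
      show "additive_char R (carrier R) (\<lambda>t. \<phi> (\<ominus> (t \<otimes> a)))"
        unfolding additive_char_def
      proof (intro conjI ballI)
        fix x y assume xy: "x \<in> carrier R" "y \<in> carrier R"
        have "\<ominus> ((x \<oplus> y) \<otimes> a) = \<ominus> (x \<otimes> a) \<oplus> \<ominus> (y \<otimes> a)" using xy a by algebra
        then show "\<phi> (\<ominus> ((x \<oplus> y) \<otimes> a)) = \<phi> (\<ominus> (x \<otimes> a)) * \<phi> (\<ominus> (y \<otimes> a))" using xy a D by simp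
      qed (use a \<phi> in \<open>auto simp: additive_char_def\<close>)
      show "\<phi> (\<ominus> (r \<otimes> a)) \<noteq> 1" using r a D(3)[of "r \<otimes> a"] by (simp add: neg field_simps)
    qed
    then show ?thesis by (simp only: sum_distrib_left[symmetric] if_not_P[OF False] mult_zero_right)
  qed
  have "(\<Sum>t\<in>carrier R. \<Sum>a\<in>carrier R. \<psi> a * \<phi> (\<ominus> (t \<otimes> a))) = 0" using inner0 by simp
  then have "(\<Sum>a\<in>carrier R. \<Sum>t\<in>carrier R. \<psi> a * \<phi> (\<ominus> (t \<otimes> a))) = 0" by (subst sum.swap)
  then have "(\<Sum>a\<in>carrier R. if \<forall>r\<in>carrier R. \<phi> (r \<otimes> a) = 1 then of_nat (card (carrier R)) else 0) = (0::complex)"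
    using outer by simp
  \<comment> \<open>Read as a sum of natural numbers, the vanishing sum has only zero terms; but the
    term at zero counts the whole ring.\<close>
  then have "of_nat (\<Sum>a\<in>carrier R. if \<forall>r\<in>carrier R. \<phi> (r \<otimes> a) = 1 then card (carrier R) else 0) = (0::complex)"
    by (simp add: of_nat_sum if_distrib cong: if_cong)
  then have "(\<Sum>a\<in>carrier R. if \<forall>r\<in>carrier R. \<phi> (r \<otimes> a) = 1 then card (carrier R) else 0) = 0"
    by (simp only: of_nat_eq_0_iff)
  then have "\<forall>a\<in>carrier R. (if \<forall>r\<in>carrier R. \<phi> (r \<otimes> a) = 1 then card (carrier R) else 0) = 0"
    using fin by simp
  moreover have "\<forall>r\<in>carrier R. \<phi> (r \<otimes> \<zero>) = 1" using additive_char_zero[OF \<phi>] by simp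
  ultimately have "card (carrier R) = 0" by force
  then show False using fin by (auto simp: card_eq_0_iff)
qed

section \<open>The group \<open>GL\<^sub>2\<close> over a finite chain ring\<close>

text \<open>A decision procedure for identities in commutative rings: written as differences \<open>a \<ominus> b\<close> of terms
  without subtraction, both sides can be compared by distributivity and permutation alone.\<close>

definition (in cring) is_diff :: "'a \<Rightarrow> 'a \<Rightarrow> 'a \<Rightarrow> bool" where
  "is_diff x a b \<longleftrightarrow> x \<in> carrier R \<and> a \<in> carrier R \<and> b \<in> carrier R \<and> x = a \<ominus> b"

context cring
begin

lemma is_diff_iff: "is_diff x a b \<longleftrightarrow> x \<in> carrier R \<and> a \<in> carrier R \<and> b \<in> carrier R \<and> x \<oplus> b = a"
  unfolding is_diff_def minus_eq by (auto simp: a_assoc l_neg r_neg)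

lemma is_diff_eqI:
  assumes "is_diff x a b" "is_diff y c d" "a \<oplus> d = c \<oplus> b"
  shows "x = y"
proof -
  have [simp]: "x \<in> carrier R" "y \<in> carrier R" "b \<in> carrier R" "d \<in> carrier R"
    and e: "x \<oplus> b = a" "y \<oplus> d = c" using assms by (auto simp: is_diff_iff)
  have "x \<oplus> (b \<oplus> d) = y \<oplus> (b \<oplus> d)" using assms(3) unfolding e[symmetric] by (simp add: a_ac)
  then show ?thesis by simp
qed

lemma is_diff_intros:
  "is_diff \<zero> \<zero> \<zero>"
  "is_diff \<one> \<one> \<zero>"
  "is_diff x a b \<Longrightarrow> is_diff y c d \<Longrightarrow> is_diff (x \<oplus> y) (a \<oplus> c) (b \<oplus> d)"
  "is_diff x a b \<Longrightarrow> is_diff y c d \<Longrightarrow> is_diff (x \<ominus> y) (a \<oplus> d) (b \<oplus> c)"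
  "is_diff x a b \<Longrightarrow> is_diff (\<ominus> x) b a"
  "is_diff x a b \<Longrightarrow> is_diff y c d \<Longrightarrow> is_diff (x \<otimes> y) (a \<otimes> c \<oplus> b \<otimes> d) (a \<otimes> d \<oplus> b \<otimes> c)"
  "x \<in> carrier R \<Longrightarrow> is_diff x x \<zero>"
  unfolding is_diff_def minus_eq
  by (auto simp: minus_add l_distr r_distr l_minus r_minus a_ac r_neg)

text \<open>Reduction modulo a relation \<open>l = r\<close>: the cofactor \<open>k\<close> is
  chosen so that adding a multiple of the relation to both sides leaves an identity valid in every
  commutative ring. The relation mostly says that one element is inverse to another.\<close>

lemma eq_modI:
  assumes "l = r" "x \<oplus> k \<otimes> r = y \<oplus> k \<otimes> l" "k \<in> carrier R" "l \<in> carrier R" "x \<in> carrier R" "y \<in> carrier R"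
  shows "x = y"
  using assms by simp

lemmas diff_simps = l_distr r_distr a_ac m_ac

lemma carrier_mat2: "Mat2 a b c d \<in> carrier (mat2_monoid R) \<longleftrightarrow> a \<in> carrier R \<and> b \<in> carrier R \<and> c \<in> carrier R \<and> d \<in> carrier R"
  by (simp add: mat2_monoid_def)

lemma mult_mat2: "Mat2 a b c d \<otimes>\<^bsub>mat2_monoid R\<^esub> Mat2 a' b' c' d' =
    Mat2 (a \<otimes> a' \<oplus> b \<otimes> c') (a \<otimes> b' \<oplus> b \<otimes> d') (c \<otimes> a' \<oplus> d \<otimes> c') (c \<otimes> b' \<oplus> d \<otimes> d')"
  by (simp add: mat2_monoid_def)

lemma one_mat2: "\<one>\<^bsub>mat2_monoid R\<^esub> = Mat2 \<one> \<zero> \<zero> \<one>"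
  by (simp add: mat2_monoid_def)

lemma monoid_mat2: "monoid (mat2_monoid R)"
proof (rule monoidI)
  fix A B C assume ABC: "A \<in> carrier (mat2_monoid R)" "B \<in> carrier (mat2_monoid R)" "C \<in> carrier (mat2_monoid R)"
  obtain a b c d a' b' c' d' a'' b'' c'' d'' where
    M: "A = Mat2 a b c d" "B = Mat2 a' b' c' d'" "C = Mat2 a'' b'' c'' d''"
    by (cases A; cases B; cases C)
 then have c [simp]: "a \<in> carrier R" "b \<in> carrier R" "c \<in> carrier R" "d \<in> carrier R"
      "a' \<in> carrier R" "b' \<in> carrier R" "c' \<in> carrier R" "d' \<in> carrier R"
      "a'' \<in> carrier R" "b'' \<in> carrier R" "c'' \<in> carrier R" "d'' \<in> carrier R"
    using ABC by (auto simp: carrier_mat2)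
  show "A \<otimes>\<^bsub>mat2_monoid R\<^esub> B \<otimes>\<^bsub>mat2_monoid R\<^esub> C = A \<otimes>\<^bsub>mat2_monoid R\<^esub> (B \<otimes>\<^bsub>mat2_monoid R\<^esub> C)"
    unfolding M mult_mat2 mat2.inject by (intro conjI; (rule is_diff_eqI, (rule is_diff_intros | simp add: diff_simps)+))
next
  fix A B assume "A \<in> carrier (mat2_monoid R)" "B \<in> carrier (mat2_monoid R)"
  then show "A \<otimes>\<^bsub>mat2_monoid R\<^esub> B \<in> carrier (mat2_monoid R)"
    by (cases A; cases B) (simp add: carrier_mat2 mult_mat2)
next
  fix A assume "A \<in> carrier (mat2_monoid R)"
  then show "\<one>\<^bsub>mat2_monoid R\<^esub> \<otimes>\<^bsub>mat2_monoid R\<^esub> A = A" "A \<otimes>\<^bsub>mat2_monoid R\<^esub> \<one>\<^bsub>mat2_monoid R\<^esub> = A"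
    by (cases A, simp add: carrier_mat2 mult_mat2 one_mat2)+
qed (simp add: one_mat2 carrier_mat2)

lemma group_GL2: "group (GL2 R)"
  unfolding GL2_def by (rule monoid.units_group[OF monoid_mat2])

lemma mult_GL2: "Mat2 a b c d \<otimes>\<^bsub>GL2 R\<^esub> Mat2 a' b' c' d' =
    Mat2 (a \<otimes> a' \<oplus> b \<otimes> c') (a \<otimes> b' \<oplus> b \<otimes> d') (c \<otimes> a' \<oplus> d \<otimes> c') (c \<otimes> b' \<oplus> d \<otimes> d')"
  by (simp add: GL2_def mult_mat2 units_of_mult)

lemma one_GL2: "\<one>\<^bsub>GL2 R\<^esub> = Mat2 \<one> \<zero> \<zero> \<one>"
  by (simp add: GL2_def one_mat2 units_of_one)

lemma adjugate_mult:
  assumes c [simp]: "a \<in> carrier R" "b \<in> carrier R" "c \<in> carrier R" "d \<in> carrier R" "e \<in> carrier R"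
    and e: "(a \<otimes> d \<ominus> b \<otimes> c) \<otimes> e = \<one>"
  shows "Mat2 a b c d \<otimes>\<^bsub>mat2_monoid R\<^esub> Mat2 (e \<otimes> d) (\<ominus> (e \<otimes> b)) (\<ominus> (e \<otimes> c)) (e \<otimes> a) = \<one>\<^bsub>mat2_monoid R\<^esub>"
    "Mat2 (e \<otimes> d) (\<ominus> (e \<otimes> b)) (\<ominus> (e \<otimes> c)) (e \<otimes> a) \<otimes>\<^bsub>mat2_monoid R\<^esub> Mat2 a b c d = \<one>\<^bsub>mat2_monoid R\<^esub>"
proof -
  have "a \<otimes> d \<otimes> e = (a \<otimes> d \<ominus> b \<otimes> c) \<otimes> e \<oplus> b \<otimes> c \<otimes> e" by (rule is_diff_eqI, (rule is_diff_intros | simp add: diff_simps)+)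
  then have e': "a \<otimes> d \<otimes> e = \<one> \<oplus> b \<otimes> c \<otimes> e" by (simp only: e)
  show "Mat2 a b c d \<otimes>\<^bsub>mat2_monoid R\<^esub> Mat2 (e \<otimes> d) (\<ominus> (e \<otimes> b)) (\<ominus> (e \<otimes> c)) (e \<otimes> a) = \<one>\<^bsub>mat2_monoid R\<^esub>"
    "Mat2 (e \<otimes> d) (\<ominus> (e \<otimes> b)) (\<ominus> (e \<otimes> c)) (e \<otimes> a) \<otimes>\<^bsub>mat2_monoid R\<^esub> Mat2 a b c d = \<one>\<^bsub>mat2_monoid R\<^esub>"
    unfolding mult_mat2 one_mat2 mat2.inject
    apply (intro conjI)
    subgoal by (rule eq_modI[OF e', where k = "\<one>"], rule is_diff_eqI, (rule is_diff_intros | simp add: diff_simps)+)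
    subgoal by (rule is_diff_eqI, (rule is_diff_intros | simp add: diff_simps)+)
    subgoal by (rule is_diff_eqI, (rule is_diff_intros | simp add: diff_simps)+)
    subgoal by (rule eq_modI[OF e', where k = "\<one>"], rule is_diff_eqI, (rule is_diff_intros | simp add: diff_simps)+)
    apply (intro conjI)
    subgoal by (rule eq_modI[OF e', where k = "\<one>"], rule is_diff_eqI, (rule is_diff_intros | simp add: diff_simps)+)
    subgoal by (rule is_diff_eqI, (rule is_diff_intros | simp add: diff_simps)+)
    subgoal by (rule is_diff_eqI, (rule is_diff_intros | simp add: diff_simps)+)
    subgoal by (rule eq_modI[OF e', where k = "\<one>"], rule is_diff_eqI, (rule is_diff_intros | simp add: diff_simps)+)
    done
qed

lemma carrier_GL2: "Mat2 a b c d \<in> carrier (GL2 R) \<longleftrightarrow>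
    a \<in> carrier R \<and> b \<in> carrier R \<and> c \<in> carrier R \<and> d \<in> carrier R \<and> a \<otimes> d \<ominus> b \<otimes> c \<in> Units R"
    (is "?L \<longleftrightarrow> ?R")
proof
  assume ?L
  then obtain B where A: "Mat2 a b c d \<in> carrier (mat2_monoid R)" and B: "B \<in> carrier (mat2_monoid R)"
      "Mat2 a b c d \<otimes>\<^bsub>mat2_monoid R\<^esub> B = \<one>\<^bsub>mat2_monoid R\<^esub>"
    by (auto simp: GL2_def units_of_carrier Units_def)
  obtain a' b' c' d' where B': "B = Mat2 a' b' c' d'" by (cases B)
  have c [simp]: "a \<in> carrier R" "b \<in> carrier R" "c \<in> carrier R" "d \<in> carrier R"
      "a' \<in> carrier R" "b' \<in> carrier R" "c' \<in> carrier R" "d' \<in> carrier R"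
    using A B unfolding B' by (auto simp: carrier_mat2)
  have "(a \<otimes> d \<ominus> b \<otimes> c) \<otimes> (a' \<otimes> d' \<ominus> b' \<otimes> c') =
      (a \<otimes> a' \<oplus> b \<otimes> c') \<otimes> (c \<otimes> b' \<oplus> d \<otimes> d') \<ominus> (a \<otimes> b' \<oplus> b \<otimes> d') \<otimes> (c \<otimes> a' \<oplus> d \<otimes> c')"
    by (rule is_diff_eqI, (rule is_diff_intros | simp add: diff_simps)+)
  also have "\<dots> = \<one>" using B(2) unfolding B' mult_mat2 one_mat2 by (simp add: a_minus_def)
  finally have e: "(a \<otimes> d \<ominus> b \<otimes> c) \<otimes> (a' \<otimes> d' \<ominus> b' \<otimes> c') = \<one>" .
  have "a \<otimes> d \<ominus> b \<otimes> c \<in> Units R"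
    unfolding Units_def using c e
    by (auto intro!: bexI[of _ "a' \<otimes> d' \<ominus> b' \<otimes> c'"] simp: m_comm[of "a' \<otimes> d' \<ominus> b' \<otimes> c'"])
  with c show ?R by simp
next
  assume R: ?R
  define e where "e = inv (a \<otimes> d \<ominus> b \<otimes> c)"
  have c: "a \<in> carrier R" "b \<in> carrier R" "c \<in> carrier R" "d \<in> carrier R" "e \<in> carrier R"
    and e: "(a \<otimes> d \<ominus> b \<otimes> c) \<otimes> e = \<one>" using R by (auto simp: e_def)
  show ?L unfolding GL2_def units_of_carrier Units_def
    using adjugate_mult[OF c e] c
    by (auto simp: carrier_mat2 intro!: bexI[of _ "Mat2 (e \<otimes> d) (\<ominus> (e \<otimes> b)) (\<ominus> (e \<otimes> c)) (e \<otimes> a)"])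
qed

lemma inv_GL2:
  assumes "Mat2 a b c d \<in> carrier (GL2 R)"
    and "(a \<otimes> d \<ominus> b \<otimes> c) \<otimes> e = \<one>" "e \<in> carrier R"
  shows "inv\<^bsub>GL2 R\<^esub> (Mat2 a b c d) = Mat2 (e \<otimes> d) (\<ominus> (e \<otimes> b)) (\<ominus> (e \<otimes> c)) (e \<otimes> a)"
proof -
  interpret G: group "GL2 R" by (rule group_GL2)
  have c: "a \<in> carrier R" "b \<in> carrier R" "c \<in> carrier R" "d \<in> carrier R"
    using assms by (auto simp: carrier_GL2)
  note adj = adjugate_mult[OF c assms(3,2)]
  have "Mat2 (e \<otimes> d) (\<ominus> (e \<otimes> b)) (\<ominus> (e \<otimes> c)) (e \<otimes> a) \<in> carrier (GL2 R)"
    using adj c assms(3) unfolding GL2_def units_of_carrier Units_def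
    by (auto simp: carrier_mat2 intro!: bexI[of _ "Mat2 a b c d"])
  moreover have "Mat2 (e \<otimes> d) (\<ominus> (e \<otimes> b)) (\<ominus> (e \<otimes> c)) (e \<otimes> a) \<otimes>\<^bsub>GL2 R\<^esub> Mat2 a b c d = \<one>\<^bsub>GL2 R\<^esub>"
    using adj(2) by (simp add: mult_mat2 mult_GL2 one_mat2 one_GL2)
  ultimately show ?thesis using G.inv_equality assms(1) by metis
qed

lemma finite_GL2:
  assumes "finite (carrier R)"
  shows "finite (carrier (GL2 R))"
proof (rule finite_subset)
  show "carrier (GL2 R) \<subseteq> (\<lambda>(a, b, c, d). Mat2 a b c d) ` (carrier R \<times> carrier R \<times> carrier R \<times> carrier R)"
  proof
    fix A assume "A \<in> carrier (GL2 R)"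
    then show "A \<in> (\<lambda>(a, b, c, d). Mat2 a b c d) ` (carrier R \<times> carrier R \<times> carrier R \<times> carrier R)"
      by (cases A) (auto simp: carrier_GL2 image_iff)
  qed
qed (use assms in auto)

end

section \<open>Generators, decompositions and congruence subgroups\<close>

context finite_chain_ring
begin

declare Units_closed [simp]

abbreviation GL where "GL \<equiv> GL2 R"

sublocale GL: group "GL2 R"
  by (rule group_GL2)

definition uni :: "'a \<Rightarrow> 'a mat2" where "uni x = Mat2 \<one> x \<zero> \<one>"
definition low :: "'a \<Rightarrow> 'a mat2" where "low x = Mat2 \<one> \<zero> x \<one>"
definition dia :: "'a \<Rightarrow> 'a \<Rightarrow> 'a mat2" where "dia a d = Mat2 a \<zero> \<zero> d"
definition swp :: "'a mat2" where "swp = Mat2 \<zero> \<one> \<one> \<zero>"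

lemmas gen_defs = uni_def low_def dia_def swp_def

lemma minus_one_unit: "\<ominus> \<one> \<in> Units R"
  unfolding Units_def by (auto intro!: bexI[of _ "\<ominus> \<one>"] simp: l_minus)

lemma gen_closed [simp]:
  "x \<in> carrier R \<Longrightarrow> uni x \<in> carrier GL" "x \<in> carrier R \<Longrightarrow> low x \<in> carrier GL"
  "a \<in> Units R \<Longrightarrow> d \<in> Units R \<Longrightarrow> dia a d \<in> carrier GL" "swp \<in> carrier GL"
  using minus_one_unit by (simp_all add: gen_defs carrier_GL2 a_minus_def Units_m_closed)

lemma uni_mult: "x \<in> carrier R \<Longrightarrow> y \<in> carrier R \<Longrightarrow> uni x \<otimes>\<^bsub>GL\<^esub> uni y = uni (x \<oplus> y)"
  by (simp add: uni_def mult_GL2 a_comm)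

lemma low_mult: "x \<in> carrier R \<Longrightarrow> y \<in> carrier R \<Longrightarrow> low x \<otimes>\<^bsub>GL\<^esub> low y = low (x \<oplus> y)"
  by (simp add: low_def mult_GL2)

lemma dia_mult: "a \<in> carrier R \<Longrightarrow> d \<in> carrier R \<Longrightarrow> a' \<in> carrier R \<Longrightarrow> d' \<in> carrier R \<Longrightarrow>
    dia a d \<otimes>\<^bsub>GL\<^esub> dia a' d' = dia (a \<otimes> a') (d \<otimes> d')"
  by (simp add: dia_def mult_GL2)

lemma swp_swp: "swp \<otimes>\<^bsub>GL\<^esub> swp = \<one>\<^bsub>GL\<^esub>"
  by (simp add: swp_def mult_GL2 one_GL2)

lemma swp_gen:
  "x \<in> carrier R \<Longrightarrow> swp \<otimes>\<^bsub>GL\<^esub> uni x = low x \<otimes>\<^bsub>GL\<^esub> swp"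
  "x \<in> carrier R \<Longrightarrow> swp \<otimes>\<^bsub>GL\<^esub> low x = uni x \<otimes>\<^bsub>GL\<^esub> swp"
  "a \<in> carrier R \<Longrightarrow> d \<in> carrier R \<Longrightarrow> swp \<otimes>\<^bsub>GL\<^esub> dia a d = dia d a \<otimes>\<^bsub>GL\<^esub> swp"
  by (simp_all add: gen_defs mult_GL2)

lemma uni_zero: "uni \<zero> = \<one>\<^bsub>GL\<^esub>" and low_zero: "low \<zero> = \<one>\<^bsub>GL\<^esub>" and dia_one: "dia \<one> \<one> = \<one>\<^bsub>GL\<^esub>"
  by (simp_all add: gen_defs one_GL2)

lemma dia_uni:
  assumes "a \<in> Units R" "d \<in> Units R" "x \<in> carrier R"
  shows "dia a d \<otimes>\<^bsub>GL\<^esub> uni x = uni (a \<otimes> x \<otimes> inv d) \<otimes>\<^bsub>GL\<^esub> dia a d"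
  using assms by (simp add: gen_defs mult_GL2 m_assoc)

lemma dia_low:
  assumes "a \<in> Units R" "d \<in> Units R" "x \<in> carrier R"
  shows "dia a d \<otimes>\<^bsub>GL\<^esub> low x = low (d \<otimes> x \<otimes> inv a) \<otimes>\<^bsub>GL\<^esub> dia a d"
  using assms by (simp add: gen_defs mult_GL2 m_assoc)

lemma det_unit_diag:
  assumes "Mat2 a b c d \<in> carrier GL" "b \<otimes> c \<in> P 1"
  shows "a \<in> Units R" "d \<in> Units R"
proof -
  have c: "a \<in> carrier R" "b \<in> carrier R" "c \<in> carrier R" "d \<in> carrier R" "a \<otimes> d \<ominus> b \<otimes> c \<in> Units R"
    using assms by (auto simp: carrier_GL2)
  have "a \<otimes> d = (a \<otimes> d \<ominus> b \<otimes> c) \<oplus> b \<otimes> c" using c(1-4) by algebra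
  also have "\<dots> \<in> Units R" using unit_add_P1[OF c(5) assms(2)] .
  finally show "a \<in> Units R" "d \<in> Units R" using Units_mult_iff c by auto
qed

text \<open>Elimination with pivot \<open>d\<close>. The remaining diagonal entry is the determinant
  divided by \<open>d\<close>, hence a unit.\<close>

lemma triangular_decomposition:
  assumes g: "Mat2 a b c d \<in> carrier GL" and d: "d \<in> Units R"
  shows "a \<ominus> b \<otimes> inv d \<otimes> c \<in> Units R"
    "Mat2 a b c d = uni (b \<otimes> inv d) \<otimes>\<^bsub>GL\<^esub> dia (a \<ominus> b \<otimes> inv d \<otimes> c) d \<otimes>\<^bsub>GL\<^esub> low (inv d \<otimes> c)"
proof -
  have c [simp]: "a \<in> carrier R" "b \<in> carrier R" "c \<in> carrier R" "d \<in> carrier R"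
    and det: "a \<otimes> d \<ominus> b \<otimes> c \<in> Units R" using g by (auto simp: carrier_GL2)
  define e where "e = inv d"
  have e [simp]: "e \<in> carrier R" and de: "d \<otimes> e = \<one>" using d by (simp_all add: e_def)
  have "a \<ominus> b \<otimes> e \<otimes> c = (a \<otimes> d \<ominus> b \<otimes> c) \<otimes> e" by (rule eq_modI[OF de, where k = "\<ominus> a"], rule is_diff_eqI, (rule is_diff_intros | simp add: diff_simps)+)
  then show "a \<ominus> b \<otimes> inv d \<otimes> c \<in> Units R" using det d by (simp add: e_def)
  show "Mat2 a b c d = uni (b \<otimes> inv d) \<otimes>\<^bsub>GL\<^esub> dia (a \<ominus> b \<otimes> inv d \<otimes> c) d \<otimes>\<^bsub>GL\<^esub> low (inv d \<otimes> c)"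
    unfolding e_def[symmetric] gen_defs mult_GL2 mat2.inject
    apply (intro conjI)
    subgoal by (rule eq_modI[OF de, where k = "\<ominus> b \<otimes> c \<otimes> e"], rule is_diff_eqI, (rule is_diff_intros | simp add: diff_simps)+)
    subgoal by (rule eq_modI[OF de, where k = "\<ominus> b"], rule is_diff_eqI, (rule is_diff_intros | simp add: diff_simps)+)
    subgoal by (rule eq_modI[OF de, where k = "\<ominus> c"], rule is_diff_eqI, (rule is_diff_intros | simp add: diff_simps)+)
    subgoal by (rule is_diff_eqI, (rule is_diff_intros | simp add: diff_simps)+)
    done
qed

text \<open>The commutation rule for opposite unipotent matrices, by elimination with pivot
  \<open>\<one> \<oplus> x \<otimes> c\<close>. How small \<open>x \<otimes> c\<close> is decides
  how close the torus factor is to the identity; the stability arguments below use the rule in this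
  way.\<close>

lemma low_uni:
  assumes x: "x \<in> carrier R" "c \<in> carrier R" and u: "\<one> \<oplus> x \<otimes> c \<in> Units R"
  defines "e \<equiv> inv (\<one> \<oplus> x \<otimes> c)"
  shows "low c \<otimes>\<^bsub>GL\<^esub> uni x = uni (x \<otimes> e) \<otimes>\<^bsub>GL\<^esub> dia e (\<one> \<oplus> x \<otimes> c) \<otimes>\<^bsub>GL\<^esub> low (c \<otimes> e)"
    "uni x \<otimes>\<^bsub>GL\<^esub> low c = low (c \<otimes> e) \<otimes>\<^bsub>GL\<^esub> dia (\<one> \<oplus> x \<otimes> c) e \<otimes>\<^bsub>GL\<^esub> uni (x \<otimes> e)"
proof -
  have [simp]: "x \<in> carrier R" "c \<in> carrier R" "e \<in> carrier R" using x u by (simp_all add: e_def)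
  have "e \<oplus> x \<otimes> c \<otimes> e = (\<one> \<oplus> x \<otimes> c) \<otimes> e" by (rule is_diff_eqI, (rule is_diff_intros | simp add: diff_simps)+)
  also have "\<dots> = \<one>" using u by (simp add: e_def)
  finally have "x \<otimes> c \<otimes> e = \<one> \<ominus> e"
    by (metis \<open>x \<in> carrier R\<close> \<open>c \<in> carrier R\<close> \<open>e \<in> carrier R\<close> a_comm add.inv_solve_right' m_closed minus_eq one_closed)
  then have e: "x \<otimes> c \<otimes> e = \<one> \<ominus> e" .
  show "low c \<otimes>\<^bsub>GL\<^esub> uni x = uni (x \<otimes> e) \<otimes>\<^bsub>GL\<^esub> dia e (\<one> \<oplus> x \<otimes> c) \<otimes>\<^bsub>GL\<^esub> low (c \<otimes> e)"
    "uni x \<otimes>\<^bsub>GL\<^esub> low c = low (c \<otimes> e) \<otimes>\<^bsub>GL\<^esub> dia (\<one> \<oplus> x \<otimes> c) e \<otimes>\<^bsub>GL\<^esub> uni (x \<otimes> e)"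
    unfolding gen_defs mult_GL2 mat2.inject
    apply (intro conjI)
    subgoal by (rule eq_modI[OF e, where k = "\<ominus> (\<one> \<oplus> x \<otimes> c \<otimes> e)"], rule is_diff_eqI, (rule is_diff_intros | simp add: diff_simps)+)
    subgoal by (rule eq_modI[OF e, where k = "\<ominus> x"], rule is_diff_eqI, (rule is_diff_intros | simp add: diff_simps)+)
    subgoal by (rule eq_modI[OF e, where k = "\<ominus> c"], rule is_diff_eqI, (rule is_diff_intros | simp add: diff_simps)+)
    subgoal by (rule is_diff_eqI, (rule is_diff_intros | simp add: diff_simps)+)
    apply (intro conjI)
    subgoal by (rule is_diff_eqI, (rule is_diff_intros | simp add: diff_simps)+)
    subgoal by (rule eq_modI[OF e, where k = "\<ominus> x"], rule is_diff_eqI, (rule is_diff_intros | simp add: diff_simps)+)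
    subgoal by (rule eq_modI[OF e, where k = "\<ominus> c"], rule is_diff_eqI, (rule is_diff_intros | simp add: diff_simps)+)
    subgoal by (rule eq_modI[OF e, where k = "\<ominus> (\<one> \<oplus> x \<otimes> c \<otimes> e)"], rule is_diff_eqI, (rule is_diff_intros | simp add: diff_simps)+)
    done
qed

text \<open>A family from GL_2 itself (\<open>s = 0\<close>) through the Iwahori subgroup
  (\<open>s = 1\<close>) to the Borel subgroup (\<open>s\<close> at the nilpotency index of
  \<open>p\<close>). Gelfand's trick is run for the first two.\<close>

definition congr_lower :: "nat \<Rightarrow> 'a mat2 set" where
  "congr_lower s = {A \<in> carrier GL. e21 A \<in> P s}"

lemma mem_congr_lower: "Mat2 a b c d \<in> congr_lower s \<longleftrightarrow> Mat2 a b c d \<in> carrier GL \<and> c \<in> P s"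
  by (simp add: congr_lower_def)

lemma congr_lower_0: "congr_lower 0 = carrier GL"
proof -
  have "e21 A \<in> carrier R" if "A \<in> carrier GL" for A using that by (cases A) (simp add: carrier_GL2)
  then show ?thesis by (auto simp: congr_lower_def P_0)
qed

lemma congr_lower_subgroup: "subgroup (congr_lower s) GL"
proof (rule subgroup.intro)
  fix A B assume AB: "A \<in> congr_lower s" "B \<in> congr_lower s"
  obtain a b c d a' b' c' d' where M: "A = Mat2 a b c d" "B = Mat2 a' b' c' d'" by (cases A; cases B)
  have "A \<otimes>\<^bsub>GL\<^esub> B \<in> carrier GL" using AB by (auto simp: congr_lower_def)
  moreover have "c \<otimes> a' \<oplus> d \<otimes> c' \<in> P s"
    using AB unfolding M by (auto simp: mem_congr_lower carrier_GL2 intro: P_add P_lmult P_rmult)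
  ultimately show "A \<otimes>\<^bsub>GL\<^esub> B \<in> congr_lower s" unfolding M by (simp add: mult_GL2 mem_congr_lower)
next
  fix A assume A: "A \<in> congr_lower s"
  obtain a b c d where M: "A = Mat2 a b c d" by (cases A)
  have "a \<otimes> d \<ominus> b \<otimes> c \<in> Units R" using A by (auto simp: M mem_congr_lower carrier_GL2)
  then have "inv\<^bsub>GL\<^esub> A = Mat2 (inv (a \<otimes> d \<ominus> b \<otimes> c) \<otimes> d) (\<ominus> (inv (a \<otimes> d \<ominus> b \<otimes> c) \<otimes> b))
      (\<ominus> (inv (a \<otimes> d \<ominus> b \<otimes> c) \<otimes> c)) (inv (a \<otimes> d \<ominus> b \<otimes> c) \<otimes> a)"
    using A unfolding M by (intro inv_GL2) (auto simp: mem_congr_lower)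
  moreover have "inv\<^bsub>GL\<^esub> A \<in> carrier GL" using A by (simp add: congr_lower_def)
  ultimately show "inv\<^bsub>GL\<^esub> A \<in> congr_lower s"
    using A \<open>a \<otimes> d \<ominus> b \<otimes> c \<in> Units R\<close> unfolding M
    by (auto simp: mem_congr_lower intro: P_neg P_lmult)
next
  show "congr_lower s \<subseteq> carrier GL" by (auto simp: congr_lower_def)
  show "\<one>\<^bsub>GL\<^esub> \<in> congr_lower s" using GL.one_closed unfolding one_GL2 by (simp add: mem_congr_lower P_zero)
qed

lemma congr_lower_decomposition:
  assumes "g \<in> congr_lower 1"
  obtains x a d c where "x \<in> carrier R" "a \<in> Units R" "d \<in> Units R" "c \<in> P 1"
    "g = uni x \<otimes>\<^bsub>GL\<^esub> dia a d \<otimes>\<^bsub>GL\<^esub> low c"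
proof -
  obtain a b c d where g: "g = Mat2 a b c d" by (cases g)
  have G: "Mat2 a b c d \<in> carrier GL" and c: "c \<in> P 1" using assms by (auto simp: g mem_congr_lower)
  have mem: "a \<in> carrier R" "b \<in> carrier R" "c \<in> carrier R" "d \<in> carrier R" using G by (auto simp: carrier_GL2)
  have d: "d \<in> Units R" using det_unit_diag(2)[OF G] P_lmult[OF mem(2) c] .
  show ?thesis
    using that[OF _ triangular_decomposition(1)[OF G d] d _ triangular_decomposition(2)[OF G d, folded g]]
      mem d P_lmult[OF _ c, of "inv d"] by simp
qed

text \<open>Outside \<open>congr_lower 1\<close> the lower left entry is a unit, and elimination
  with it as pivot puts the matrix into the cell of \<open>swp\<close>; the factor \<open>h\<close>
  constructed here is even upper triangular.\<close>

lemma bruhat_decomposition: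
  assumes "g \<in> carrier GL" "g \<notin> congr_lower 1"
  obtains x h where "x \<in> carrier R" "h \<in> congr_lower 1" "g = uni x \<otimes>\<^bsub>GL\<^esub> (swp \<otimes>\<^bsub>GL\<^esub> h)"
proof -
  obtain a b c d where g: "g = Mat2 a b c d" by (cases g)
  have m [simp]: "a \<in> carrier R" "b \<in> carrier R" "c \<in> carrier R" "d \<in> carrier R"
    and det: "a \<otimes> d \<ominus> b \<otimes> c \<in> Units R" using assms by (auto simp: g carrier_GL2)
  have c: "c \<in> Units R" using assms m unit_iff[of c] by (simp add: g mem_congr_lower)
  define e where "e = inv c"
  have e [simp]: "e \<in> carrier R" and ce: "c \<otimes> e = \<one>" using c by (simp_all add: e_def)
  define h where "h = Mat2 c d \<zero> (b \<ominus> a \<otimes> e \<otimes> d)"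
  have "c \<otimes> (b \<ominus> a \<otimes> e \<otimes> d) \<ominus> d \<otimes> \<zero> = \<ominus> \<one> \<otimes> (a \<otimes> d \<ominus> b \<otimes> c)" 
    by (rule eq_modI[OF ce, where k = "\<ominus> a \<otimes> d"], rule is_diff_eqI, (rule is_diff_intros | simp add: diff_simps)+)
  then have "h \<in> congr_lower 1"
    using det minus_one_unit by (simp add: h_def mem_congr_lower carrier_GL2 P_zero)
  moreover have "g = uni (a \<otimes> e) \<otimes>\<^bsub>GL\<^esub> (swp \<otimes>\<^bsub>GL\<^esub> h)"
    unfolding g h_def gen_defs mult_GL2 mat2.inject
    apply (intro conjI)
    subgoal by (rule eq_modI[OF ce, where k = "\<ominus> a"], rule is_diff_eqI, (rule is_diff_intros | simp add: diff_simps)+)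
    subgoal by (rule is_diff_eqI, (rule is_diff_intros | simp add: diff_simps)+)
    subgoal by (rule is_diff_eqI, (rule is_diff_intros | simp add: diff_simps)+)
    subgoal by (rule is_diff_eqI, (rule is_diff_intros | simp add: diff_simps)+)
    done
  ultimately show ?thesis using that[of "a \<otimes> e" h] by simp
qed

text \<open>Transposition followed by conjugation with \<open>swp\<close>. This anti-automorphism
  fixes upper and lower unipotent matrices, whereas plain transposition would exchange the two
  groups.\<close>

definition flip :: "'a mat2 \<Rightarrow> 'a mat2" where
  "flip A = Mat2 (e22 A) (e12 A) (e21 A) (e11 A)"

lemma flip_closed: "A \<in> congr_lower s \<Longrightarrow> flip A \<in> congr_lower s"
  by (cases A) (auto simp: flip_def mem_congr_lower carrier_GL2 m_comm)

lemma flip_mult: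
  assumes "A \<in> carrier GL" "B \<in> carrier GL"
  shows "flip (A \<otimes>\<^bsub>GL\<^esub> B) = flip B \<otimes>\<^bsub>GL\<^esub> flip A"
  using assms by (cases A; cases B) (simp add: flip_def mult_GL2 carrier_GL2 m_comm a_comm)

lemma low_subgroup: "subgroup (low ` P s) GL"
proof (rule subgroup.intro)
  show "low ` P s \<subseteq> carrier GL" using P_closed by auto
  show "\<one>\<^bsub>GL\<^esub> \<in> low ` P s" using low_zero P_zero by (metis imageI)
  fix A B assume AB: "A \<in> low ` P s" "B \<in> low ` P s"
  then show "A \<otimes>\<^bsub>GL\<^esub> B \<in> low ` P s" using P_add by (auto simp: low_mult P_closed)
  from AB obtain x where x: "x \<in> P s" "A = low x" by auto
  then have "low (\<ominus> x) \<otimes>\<^bsub>GL\<^esub> A = \<one>\<^bsub>GL\<^esub>" by (simp add: low_mult P_closed l_neg low_zero)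
  then have "inv\<^bsub>GL\<^esub> A = low (\<ominus> x)" using x P_closed by (intro GL.inv_equality) auto
  then show "inv\<^bsub>GL\<^esub> A \<in> low ` P s" using x P_neg by auto
qed

lemma e21_low: "e21 (low c) = c" and e12_uni: "e12 (uni c) = c"
  by (simp_all add: gen_defs)

end

section \<open>Generic characters of lower unipotent subgroups\<close>

locale gl2_rep = finite_chain_ring R p + lin_rep scale "GL2 R" V act
  for R :: "'a ring" (structure) and p and scale :: "complex \<Rightarrow> 'v::ab_group_add \<Rightarrow> 'v" (infixr \<open>*s\<close> 75)
    and V :: "'v set" and act :: "'a mat2 \<Rightarrow> 'v \<Rightarrow> 'v"
begin

text \<open>For \<open>i = j\<close> positive this is invariance under the principal congruence
  subgroup of level \<open>j\<close>, spelled out on triangular factors. The second index is there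
  for \<open>X\<close>, on which upper and diagonal entries may act trivially from level
  \<open>j - 1\<close> on, but lower ones only from level \<open>j\<close>.\<close>

definition fixed :: "nat \<Rightarrow> nat \<Rightarrow> 'v \<Rightarrow> bool" where
  "fixed i j v \<longleftrightarrow> (\<forall>x\<in>P i. act (uni x) v = v) \<and> (\<forall>x\<in>P j. act (low x) v = v) \<and>
     (\<forall>a\<in>Units R. \<forall>d\<in>Units R. a \<ominus> \<one> \<in> P i \<longrightarrow> d \<ominus> \<one> \<in> P i \<longrightarrow> act (dia a d) v = v)"

lemma fixed_act:
  assumes v: "fixed i j v" "v \<in> V" and k: "Mat2 a b c d \<in> carrier GL" and d: "d \<in> Units R"
    and m: "a \<ominus> \<one> \<in> P i" "b \<in> P i" "d \<ominus> \<one> \<in> P i" "c \<in> P j"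
  shows "act (Mat2 a b c d) v = v"
proof -
  have c [simp]: "a \<in> carrier R" "b \<in> carrier R" "c \<in> carrier R" "d \<in> carrier R" "inv d \<in> carrier R"
    using k d by (auto simp: carrier_GL2)
  note t = triangular_decomposition[OF k d]
  have "a \<ominus> b \<otimes> inv d \<otimes> c \<ominus> \<one> = (a \<ominus> \<one>) \<ominus> b \<otimes> (inv d \<otimes> c)" using c by algebra
  also have "\<dots> \<in> P i" by (rule P_diff[OF m(1) P_rmult[OF _ m(2)]]) simp
  finally have "act (dia (a \<ominus> b \<otimes> inv d \<otimes> c) d) v = v" using v t d m by (simp add: fixed_def)
  moreover have "act (low (inv d \<otimes> c)) v = v" "act (uni (b \<otimes> inv d)) v = v"
    using v m by (auto simp: fixed_def P_lmult P_rmult)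
  ultimately show ?thesis
    unfolding t(2) using v(2) t(1) d by (simp add: act_mult act_closed)
qed

lemma eq_scale_zero: "v = c *s v \<Longrightarrow> c \<noteq> 1 \<Longrightarrow> v = 0"
  using scale_cancel_right[of 1 v c] by simp

lemma char_low:
  assumes "additive_char R (P s) \<phi>"
  shows "character (low ` P s) (\<phi> \<circ> e21)"
  unfolding character_def using assms low_subgroup finite_P P_closed
  by (auto simp: e21_low additive_char_def low_mult)

context
  fixes s j :: nat and X and \<phi> :: "'a \<Rightarrow> complex"
  assumes sj: "s < j" and X: "invariant (congr_lower s) X" and Xfix: "\<And>x. x \<in> X \<Longrightarrow> fixed (j - s) j x"
    and \<phi>: "additive_char R (P s) \<phi>"
begin

text \<open>For suitable \<open>y\<close> and \<open>z\<close>, the matrices \<open>low y \<otimes> g \<otimes> low z\<close> and \<open>g\<close> differ by an element acting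
  trivially on \<open>X\<close>, while \<open>\<phi> y * \<phi> z \<noteq> 1\<close>.\<close>

lemma generic_proj_zero:
  assumes y0: "y0 \<in> P (j - 1)" "\<phi> y0 \<noteq> 1"
    and g: "Mat2 a b c d \<in> congr_lower s" and b: "\<beta> \<in> Units R" "b = \<beta> \<otimes> p [^] i"
    and ad: "a \<ominus> d \<notin> P (min (i + s) (j - s))"
    and x: "x \<in> X" "x \<in> eigenspace (low ` P s) (\<phi> \<circ> e21)"
  shows "proj (low ` P s) (\<phi> \<circ> e21) (act (Mat2 a b c d) x) = 0"
proof -
  \<comment> \<open>The two bounds on the valuation \<open>v\<close> of \<open>a \<ominus> d\<close>
    serve different purposes: \<open>v < i + s\<close> makes \<open>b \<otimes> y\<close> and
    \<open>b \<otimes> z\<close> small, and \<open>v < j - s\<close> puts \<open>y\<close> and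
    \<open>z\<close> into \<open>P s\<close>.\<close>
  define r where "r = min (i + s) (j - s)"
  have G: "Mat2 a b c d \<in> carrier GL" and cP: "c \<in> P s" using g by (auto simp: mem_congr_lower)
  have [simp]: "a \<in> carrier R" "b \<in> carrier R" "c \<in> carrier R" "d \<in> carrier R"
    and det: "a \<otimes> d \<ominus> b \<otimes> c \<in> Units R" using G by (auto simp: carrier_GL2)
  have bP: "b \<in> P i" unfolding b by (intro P_lmult p_pow_in_P) (use b in auto)
  obtain u v where uv: "u \<in> Units R" "v < r" "a \<ominus> d = u \<otimes> p [^] (v::nat)"
    using not_P_valuation[of "a \<ominus> d" r] ad by (auto simp: r_def)
  have is1: "1 \<le> i + s" using uv(2) by (auto simp: r_def)
  have "b \<otimes> c \<in> P 1" using P_mono[OF is1 P_mult[OF bP cP]] .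
  note adU = det_unit_diag[OF G this]
  define f where "f = inv a"
  have [simp]: "f \<in> carrier R" and af: "a \<otimes> f = \<one>" using adU by (auto simp: f_def)
  obtain r0 where r0: "r0 \<in> carrier R" "y0 = p [^] (j - 1) \<otimes> r0" using y0 by (auto simp: P_def)
  \<comment> \<open>Formally \<open>z\<close> is y0 a / (a - d), with the division carried out on
    the power of \<open>p\<close>. Together with \<open>y\<close> below this gives
    \<open>z \<oplus> y = y0\<close>, and \<open>a \<otimes> y = \<ominus> (d \<otimes> z)\<close>
    cancels the first-order change of the lower left entry.\<close>
  define z where "z = p [^] (j - 1 - v) \<otimes> (r0 \<otimes> a \<otimes> inv u)"
  have zP: "z \<in> P (j - 1 - v)" using r0 uv by (auto simp: z_def P_def)
  have [simp]: "z \<in> carrier R" using zP P_closed by blast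
  define y where "y = \<ominus> (d \<otimes> f \<otimes> z)"
  have [simp]: "y \<in> carrier R" by (simp add: y_def)
  have yP: "y \<in> P (j - 1 - v)" unfolding y_def by (intro P_neg P_lmult zP) simp
  have sle: "s \<le> j - 1 - v" using uv(2) sj by (auto simp: r_def)
  have zs: "z \<in> P s" and ys: "y \<in> P s" using P_mono[OF sle] zP yP by auto
  have ay: "a \<otimes> y = \<ominus> (d \<otimes> z)" 
    unfolding y_def by (rule eq_modI[OF af, where k = "\<ominus> d \<otimes> z"], rule is_diff_eqI, (rule is_diff_intros | simp add: diff_simps)+)
  have zy: "z \<oplus> y = y0"
  proof -
    have "z \<oplus> y = z \<otimes> (a \<ominus> d) \<otimes> f" 
      unfolding y_def by (rule eq_modI[OF af, where k = "\<ominus> z"], rule is_diff_eqI, (rule is_diff_intros | simp add: diff_simps)+)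
    also have "\<dots> = (p [^] (j - 1 - v) \<otimes> p [^] v) \<otimes> r0 \<otimes> (a \<otimes> f) \<otimes> (inv u \<otimes> u)"
      unfolding uv(3) z_def using r0 uv(1) by (simp add: m_ac del: Units_r_inv Units_l_inv)
    also have "\<dots> = y0" proof -
      have "j - 1 - v + v = j - 1" using uv(2) unfolding r_def by linarith
      then show ?thesis unfolding nat_pow_mult[OF p_closed] using af uv(1) r0 by simp
    qed
    finally show ?thesis .
  qed
  have le: "j - s \<le> i + (j - 1 - v)" using uv(2) sj by (auto simp: r_def)
  have bz: "b \<otimes> z \<in> P (j - s)" and by_mem: "b \<otimes> y \<in> P (j - s)"
    using P_mono[OF le P_mult[OF bP]] zP yP by auto
  define e where "e = inv (a \<otimes> d \<ominus> b \<otimes> c)"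
  have [simp]: "e \<in> carrier R" and e: "(a \<otimes> d \<ominus> b \<otimes> c) \<otimes> e = \<one>" using det by (auto simp: e_def)
  have "a \<otimes> d \<otimes> e = (a \<otimes> d \<ominus> b \<otimes> c) \<otimes> e \<oplus> b \<otimes> c \<otimes> e" by (rule is_diff_eqI, (rule is_diff_intros | simp add: diff_simps)+)
  then have e': "a \<otimes> d \<otimes> e = \<one> \<oplus> b \<otimes> c \<otimes> e" by (simp only: e)
  \<comment> \<open>The quotient of \<open>low y \<otimes> g \<otimes> low z\<close> by
    \<open>g\<close>. Every deviation from the identity is a multiple of
    \<open>b \<otimes> y\<close> or \<open>b \<otimes> z\<close>, hence in \<open>P (j - s)\<close>;
    the lower left one has a further factor from \<open>P s\<close> and so lies in
    \<open>P j\<close>.\<close>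
  define k where "k = Mat2 (\<one> \<oplus> e \<otimes> (d \<ominus> b \<otimes> y) \<otimes> (b \<otimes> z)) (\<ominus> e \<otimes> b \<otimes> (b \<otimes> y))
    (\<ominus> e \<otimes> (d \<otimes> z \<otimes> (b \<otimes> z) \<oplus> c \<otimes> (b \<otimes> z))) (\<one> \<oplus> e \<otimes> a \<otimes> (b \<otimes> y))"
  have k: "inv\<^bsub>GL\<^esub> (Mat2 a b c d) \<otimes>\<^bsub>GL\<^esub> (low y \<otimes>\<^bsub>GL\<^esub> (Mat2 a b c d \<otimes>\<^bsub>GL\<^esub> low z)) = k"
    unfolding inv_GL2[OF G e \<open>e \<in> carrier R\<close>] low_def mult_GL2 mat2.inject k_def
    apply (intro conjI)
    subgoal by (rule eq_modI[OF e', where k = "\<one>"], rule eq_modI[OF ay, where k = "\<ominus> b \<otimes> e"], rule is_diff_eqI, (rule is_diff_intros | simp add: diff_simps)+)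
    subgoal by (rule is_diff_eqI, (rule is_diff_intros | simp add: diff_simps)+)
    subgoal by (rule eq_modI[OF ay, where k = "a \<otimes> e \<oplus> b \<otimes> e \<otimes> z"], rule is_diff_eqI, (rule is_diff_intros | simp add: diff_simps)+)
    subgoal by (rule eq_modI[OF e', where k = "\<one>"], rule is_diff_eqI, (rule is_diff_intros | simp add: diff_simps)+)
    done
  have kG: "k \<in> carrier GL" unfolding k[symmetric] using G by simp
  have gk: "Mat2 a b c d \<otimes>\<^bsub>GL\<^esub> k = low y \<otimes>\<^bsub>GL\<^esub> (Mat2 a b c d \<otimes>\<^bsub>GL\<^esub> low z)"
    unfolding k[symmetric] using G by (simp add: GL.m_assoc[symmetric])
  have xV: "x \<in> V" using X x by (auto simp: invariant_def)
  have "act k x = x"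
    unfolding k_def
  proof (rule fixed_act[OF Xfix[OF x(1)] xV kG[unfolded k_def]])
    show "\<one> \<oplus> e \<otimes> a \<otimes> (b \<otimes> y) \<in> Units R"
      by (rule one_add_P1[of _ "j - s"], rule P_lmult[OF _ by_mem]) (use sj in auto)
    have "\<one> \<oplus> e \<otimes> (d \<ominus> b \<otimes> y) \<otimes> (b \<otimes> z) \<ominus> \<one> = e \<otimes> (d \<ominus> b \<otimes> y) \<otimes> (b \<otimes> z)"
      by (rule is_diff_eqI, (rule is_diff_intros | simp add: diff_simps)+)
    then show "\<one> \<oplus> e \<otimes> (d \<ominus> b \<otimes> y) \<otimes> (b \<otimes> z) \<ominus> \<one> \<in> P (j - s)"
      by (simp add: P_lmult[OF _ bz])
    have "\<one> \<oplus> e \<otimes> a \<otimes> (b \<otimes> y) \<ominus> \<one> = e \<otimes> a \<otimes> (b \<otimes> y)" by (rule is_diff_eqI, (rule is_diff_intros | simp add: diff_simps)+)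
    then show "\<one> \<oplus> e \<otimes> a \<otimes> (b \<otimes> y) \<ominus> \<one> \<in> P (j - s)" by (simp add: P_lmult[OF _ by_mem])
    show "\<ominus> e \<otimes> b \<otimes> (b \<otimes> y) \<in> P (j - s)" by (rule P_lmult[OF _ by_mem]) simp
    have "d \<otimes> z \<otimes> (b \<otimes> z) \<in> P j" "c \<otimes> (b \<otimes> z) \<in> P j"
      using P_mult[OF P_lmult[OF \<open>d \<in> carrier R\<close> zs] bz] P_mult[OF cP bz] sj by auto
    then show "\<ominus> e \<otimes> (d \<otimes> z \<otimes> (b \<otimes> z) \<oplus> c \<otimes> (b \<otimes> z)) \<in> P j" by (intro P_lmult[OF _ P_add]) auto
  qed
  then have "act (Mat2 a b c d) x = act (Mat2 a b c d \<otimes>\<^bsub>GL\<^esub> k) x" using G kG xV by (simp add: act_mult)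
  also have "\<dots> = act (low y) (act (Mat2 a b c d) (act (low z) x))"
    unfolding gk using G xV by (simp add: act_mult act_closed)
  also have "act (low z) x = \<phi> z *s x" using x zs by (auto simp: eigenspace_def e21_low)
  also have "act (low y) (act (Mat2 a b c d) (\<phi> z *s x)) = \<phi> z *s act (low y) (act (Mat2 a b c d) x)"
    using G xV by (simp add: act_scale act_closed)
  finally have eq: "act (Mat2 a b c d) x = \<phi> z *s act (low y) (act (Mat2 a b c d) x)" .
  let ?q = "proj (low ` P s) (\<phi> \<circ> e21)"
  note ch = char_low[OF \<phi>]
  have "?q (act (Mat2 a b c d) x) = \<phi> z *s ?q (act (low y) (act (Mat2 a b c d) x))"
    by (subst eq, rule lin_onD(2)[OF lin_proj[OF characterD(2)[OF ch]]]) (use G xV in \<open>simp add: act_closed\<close>)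
  also have "?q (act (low y) (act (Mat2 a b c d) x)) = \<phi> y *s ?q (act (Mat2 a b c d) x)"
    using proj_act[OF ch, of "low y"] ys G xV by (simp add: act_closed e21_low)
  finally have "?q (act (Mat2 a b c d) x) = (\<phi> z * \<phi> y) *s ?q (act (Mat2 a b c d) x)" by (unfold scale_scale)
  moreover have "\<phi> z * \<phi> y \<noteq> 1" using \<phi> zs ys y0(2) zy unfolding additive_char_def by metis
  ultimately show ?thesis using eq_scale_zero by blast
qed

text \<open>Either \<open>a \<ominus> d = \<ominus> (b \<otimes> z)\<close> for some \<open>z\<close> with \<open>low z\<close> in the group, and then \<open>low z\<close> conjugates \<open>g\<close>
  to \<open>flip g\<close>; or \<open>g\<close> and \<open>flip g\<close> act alike on \<open>X\<close>; or both sides vanish.\<close>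

lemma generic_flip:
  assumes y0: "y0 \<in> P (j - 1)" "\<phi> y0 \<noteq> 1" and g: "g \<in> congr_lower s"
    and x: "x \<in> X" "x \<in> eigenspace (low ` P s) (\<phi> \<circ> e21)"
  shows "proj (low ` P s) (\<phi> \<circ> e21) (act (flip g) x) = proj (low ` P s) (\<phi> \<circ> e21) (act g x)"
proof -
  obtain a b c d where M: "g = Mat2 a b c d" by (cases g)
  have G: "Mat2 a b c d \<in> carrier GL" and cP: "c \<in> P s" and g': "Mat2 a b c d \<in> congr_lower s"
    using g by (auto simp: M mem_congr_lower)
  have [simp]: "a \<in> carrier R" "b \<in> carrier R" "c \<in> carrier R" "d \<in> carrier R"
    and det: "a \<otimes> d \<ominus> b \<otimes> c \<in> Units R" using G by (auto simp: carrier_GL2)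
  have fM: "flip g = Mat2 d b c a" by (simp add: M flip_def)
  have fg: "Mat2 d b c a \<in> congr_lower s" using flip_closed[OF g] by (simp add: fM)
  obtain \<beta> i where b: "\<beta> \<in> Units R" "b = \<beta> \<otimes> p [^] (i::nat)" using chain[of b] by auto
  have xV: "x \<in> V" using X x by (auto simp: invariant_def)
  note ch = char_low[OF \<phi>]
  show ?thesis
  proof (cases "a \<ominus> d \<in> P (min (i + s) (j - s))")
    case False
    have "d \<ominus> a = \<ominus> (a \<ominus> d)" by (rule is_diff_eqI, (rule is_diff_intros | simp add: diff_simps)+)
    then have "d \<ominus> a \<notin> P (min (i + s) (j - s))"
      using False P_neg[of "d \<ominus> a"] by auto
    then show ?thesis
      using generic_proj_zero[OF y0 g' b False x] generic_proj_zero[OF y0 fg b _ x] by (simp add: M fM flip_def)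
  next
    case True
    show ?thesis
    proof (cases "i + s \<le> j - s")
      case le: True
      then obtain r1 where r1: "r1 \<in> carrier R" "a \<ominus> d = p [^] (i + s) \<otimes> r1"
        using True by (auto simp: P_def min_def split: if_splits)
      \<comment> \<open>This solves \<open>b \<otimes> z = d \<ominus> a\<close>: \<open>b\<close>
        is a unit times \<open>p [^] i\<close>, and \<open>a \<ominus> d\<close> lies in
        \<open>P (i + s)\<close>, so a solution exists in \<open>P s\<close>.\<close>
      define z where "z = \<ominus> (p [^] s \<otimes> (r1 \<otimes> inv \<beta>))"
      have zP: "z \<in> P s" unfolding z_def by (rule P_neg) (use r1 b in \<open>auto simp: P_def\<close>)
      have [simp]: "z \<in> carrier R" using zP P_closed by blast
      have "b \<otimes> z = \<ominus> ((p [^] i \<otimes> p [^] s) \<otimes> r1 \<otimes> (\<beta> \<otimes> inv \<beta>))"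
        unfolding z_def b(2) using b(1) r1(1) by (simp add: m_ac r_minus del: Units_r_inv Units_l_inv)
      also have "\<dots> = \<ominus> (a \<ominus> d)" unfolding nat_pow_mult[OF p_closed] r1(2) using b r1 by simp
      also have "\<dots> = d \<ominus> a" by (rule is_diff_eqI, (rule is_diff_intros | simp add: diff_simps)+)
      finally have bz: "b \<otimes> z = d \<ominus> a" .
      have eq: "flip g = low (\<ominus> z) \<otimes>\<^bsub>GL\<^esub> (g \<otimes>\<^bsub>GL\<^esub> low z)"
        unfolding fM unfolding M low_def mult_GL2 mat2.inject
        apply (intro conjI)
        subgoal by (rule eq_modI[OF bz, where k = "\<ominus> \<one>"], rule is_diff_eqI, (rule is_diff_intros | simp add: diff_simps)+)
        subgoal by (rule is_diff_eqI, (rule is_diff_intros | simp add: diff_simps)+)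
        subgoal by (rule eq_modI[OF bz, where k = "z"], rule is_diff_eqI, (rule is_diff_intros | simp add: diff_simps)+)
        subgoal by (rule eq_modI[OF bz, where k = "\<one>"], rule is_diff_eqI, (rule is_diff_intros | simp add: diff_simps)+)
        done
      have "act (flip g) x = act (low (\<ominus> z)) (act g (act (low z) x))"
        unfolding eq using G xV by (simp add: act_mult act_closed M)
      also have "act (low z) x = \<phi> z *s x" using x zP by (auto simp: eigenspace_def e21_low)
      also have "act (low (\<ominus> z)) (act g (\<phi> z *s x)) = \<phi> z *s act (low (\<ominus> z)) (act g x)"
        using G xV by (simp add: act_scale act_closed M)
      finally have "proj (low ` P s) (\<phi> \<circ> e21) (act (flip g) x)
          = \<phi> z *s proj (low ` P s) (\<phi> \<circ> e21) (act (low (\<ominus> z)) (act g x))"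
        using lin_onD(2)[OF lin_proj[OF characterD(2)[OF ch]]] G xV by (simp add: act_closed M)
      also have "\<dots> = \<phi> z *s \<phi> (\<ominus> z) *s proj (low ` P s) (\<phi> \<circ> e21) (act g x)"
        using proj_act[OF ch, of "low (\<ominus> z)"] P_neg[OF zP] G xV by (simp add: act_closed e21_low M)
      also have "\<phi> (\<ominus> z) = inverse (\<phi> z)"
        using additive_char_neg[OF \<phi> _ zP] P_ideal ideal.axioms(1) by blast
      finally show ?thesis using \<phi> zP by (simp add: additive_char_def comp_def)
    next
      case False
      then have ad: "a \<ominus> d \<in> P (j - s)" using True by (simp add: min_def)
      define e where "e = inv (a \<otimes> d \<ominus> b \<otimes> c)"
      have [simp]: "e \<in> carrier R" and e: "(a \<otimes> d \<ominus> b \<otimes> c) \<otimes> e = \<one>" using det by (auto simp: e_def)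
      have "a \<otimes> d \<otimes> e = (a \<otimes> d \<ominus> b \<otimes> c) \<otimes> e \<oplus> b \<otimes> c \<otimes> e" by (rule is_diff_eqI, (rule is_diff_intros | simp add: diff_simps)+)
      then have e': "a \<otimes> d \<otimes> e = \<one> \<oplus> b \<otimes> c \<otimes> e" by (simp only: e)
      \<comment> \<open>The quotient of \<open>flip g\<close> by \<open>g\<close>: its deviations
        from the identity are multiples of \<open>a \<ominus> d\<close>, and the lower left one also
        has the factor \<open>c\<close> from \<open>P s\<close>. These are the bounds under which
        \<open>X\<close> is fixed.\<close>
      define k where "k = Mat2 (\<one> \<oplus> \<ominus> e \<otimes> d \<otimes> (a \<ominus> d)) (\<ominus> e \<otimes> b \<otimes> (a \<ominus> d))
        (e \<otimes> (c \<otimes> (a \<ominus> d))) (\<one> \<oplus> e \<otimes> a \<otimes> (a \<ominus> d))"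
      have k: "inv\<^bsub>GL\<^esub> (Mat2 a b c d) \<otimes>\<^bsub>GL\<^esub> Mat2 d b c a = k"
        unfolding inv_GL2[OF G e \<open>e \<in> carrier R\<close>] mult_GL2 mat2.inject k_def
        apply (intro conjI)
        subgoal by (rule eq_modI[OF e', where k = "\<one>"], rule is_diff_eqI, (rule is_diff_intros | simp add: diff_simps)+)
        subgoal by (rule is_diff_eqI, (rule is_diff_intros | simp add: diff_simps)+)
        subgoal by (rule is_diff_eqI, (rule is_diff_intros | simp add: diff_simps)+)
        subgoal by (rule eq_modI[OF e', where k = "\<one>"], rule is_diff_eqI, (rule is_diff_intros | simp add: diff_simps)+)
        done
      have fG: "Mat2 d b c a \<in> carrier GL" using fg by (simp add: mem_congr_lower)
      then have kG: "k \<in> carrier GL" unfolding k[symmetric] using G by simp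
      have gk: "g \<otimes>\<^bsub>GL\<^esub> k = flip g"
        unfolding k[symmetric] M fM[unfolded M] using G fG by (simp add: GL.m_assoc[symmetric])
      have "act k x = x"
        unfolding k_def
      proof (rule fixed_act[OF Xfix[OF x(1)] xV kG[unfolded k_def]])
        show "\<one> \<oplus> e \<otimes> a \<otimes> (a \<ominus> d) \<in> Units R"
          by (rule one_add_P1[of _ "j - s"], rule P_lmult[OF _ ad]) (use sj in auto)
        have "\<one> \<oplus> \<ominus> e \<otimes> d \<otimes> (a \<ominus> d) \<ominus> \<one> = \<ominus> e \<otimes> d \<otimes> (a \<ominus> d)"
          by (rule is_diff_eqI, (rule is_diff_intros | simp add: diff_simps)+)
        then show "\<one> \<oplus> \<ominus> e \<otimes> d \<otimes> (a \<ominus> d) \<ominus> \<one> \<in> P (j - s)"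
          by (simp add: P_lmult[OF _ ad])
        have "\<one> \<oplus> e \<otimes> a \<otimes> (a \<ominus> d) \<ominus> \<one> = e \<otimes> a \<otimes> (a \<ominus> d)" by (rule is_diff_eqI, (rule is_diff_intros | simp add: diff_simps)+)
        then show "\<one> \<oplus> e \<otimes> a \<otimes> (a \<ominus> d) \<ominus> \<one> \<in> P (j - s)" by (simp add: P_lmult[OF _ ad])
        show "\<ominus> e \<otimes> b \<otimes> (a \<ominus> d) \<in> P (j - s)" by (rule P_lmult[OF _ ad]) simp
        show "e \<otimes> (c \<otimes> (a \<ominus> d)) \<in> P j"
          using P_mult[OF cP ad] sj by (intro P_lmult[OF \<open>e \<in> carrier R\<close>]) auto
      qed
      then have "act (flip g) x = act g x"
        unfolding gk[symmetric] using G kG xV by (simp add: act_mult M)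
      then show ?thesis by simp
    qed
  qed
qed

text \<open>Used twice: with \<open>s = 0\<close> and \<open>X = V\<close> for characters of the
  full lower unipotent group, and with \<open>s = 1\<close> for those of the lower unipotent
  matrices with entries in the maximal ideal.\<close>

lemma generic_multiplicity_one:
  assumes "y0 \<in> P (j - 1)" "\<phi> y0 \<noteq> 1"
    and gen: "\<And>x. x \<in> X \<Longrightarrow> x \<noteq> 0 \<Longrightarrow> X \<subseteq> span (orbit (congr_lower s) x)"
  shows "\<exists>z. X \<inter> eigenspace (low ` P s) (\<phi> \<circ> e21) \<subseteq> span {z}"
proof (rule gelfand_trick[OF char_low[OF \<phi>] congr_lower_subgroup _ X gen, of flip])
  show "low ` P s \<subseteq> congr_lower s" using P_closed by (auto simp: congr_lower_def e21_low)
qed (use flip_closed flip_mult generic_flip[OF assms(1,2)] in \<open>auto simp: congr_lower_def flip_def low_def\<close>)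

end

end

context lin_rep
begin

lemma eigenvalue_mult:
  assumes "a \<in> carrier G" "b \<in> carrier G" "y \<in> V" "y \<noteq> 0"
    and "act a y = \<alpha> *s y" "act b y = \<beta> *s y" "act (a \<otimes> b) y = \<gamma> *s y"
  shows "\<gamma> = \<alpha> * \<beta>" 
proof -
  have "\<gamma> *s y = (\<alpha> * \<beta>) *s y" using assms by (simp add: act_mult act_scale mult.commute)
  then show ?thesis using assms(4) by simp
qed

lemma eigenvalue_nonzero: "a \<in> carrier G \<Longrightarrow> y \<in> V \<Longrightarrow> y \<noteq> 0 \<Longrightarrow> act a y = \<alpha> *s y \<Longrightarrow> \<alpha> \<noteq> 0"
  using act_eq_zero[of a y] by auto

lemma proj_one_invariant:
  assumes A: "A \<subseteq> carrier G" "finite A" "A \<noteq> {}" and L: "lin_on V L" and x: "x \<in> V" and "\<And>a. a \<in> A \<Longrightarrow> L (act a x) = L x"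
  shows "L (proj A (\<lambda>_. 1) x) = L x"
proof -
  have m: "act a x \<in> V" if "a \<in> A" for a using A x that by (auto intro: act_closed)
  then have s: "(\<Sum>a\<in>A. act a x) \<in> V" by (intro subspace_sum[OF sub])
  have "L (proj A (\<lambda>_. 1) x) = (1 / of_nat (card A)) *s (\<Sum>a\<in>A. L x)"
    unfolding proj_def using assms(6) m by (simp add: lin_onD(2)[OF L s] lin_on_sum[OF L sub])
  also have "(\<Sum>a\<in>A. L x) = of_nat (card A) *s L x"
    by (induction A rule: infinite_finite_induct) (auto simp: scale_left_distrib)
  finally show ?thesis using A by (simp add: card_eq_0_iff)
qed

end

section \<open>Homomorphisms from representations of the Borel subgroup\<close>

context finite_chain_ring
begin

abbreviation Borel where "Borel \<equiv> upper_triangular_GL2 R"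

lemma mem_Borel: "Mat2 a b c d \<in> Borel \<longleftrightarrow> Mat2 a b c d \<in> carrier GL \<and> c = \<zero>"
  by (auto simp: upper_triangular_GL2_def)

lemma Borel_subset: "Borel \<subseteq> carrier GL"
  by (auto simp: upper_triangular_GL2_def)

lemma Borel_congr_lower: "Borel \<subseteq> congr_lower s"
  by (auto simp: upper_triangular_GL2_def congr_lower_def P_zero)

lemma upper_gen_Borel [simp]:
  "x \<in> carrier R \<Longrightarrow> uni x \<in> Borel" "a \<in> Units R \<Longrightarrow> d \<in> Units R \<Longrightarrow> dia a d \<in> Borel"
  using gen_closed(1)[of x] gen_closed(3)[of a d] by (auto simp: upper_triangular_GL2_def uni_def dia_def)

lemma finite_Units: "finite (Units R)"
  by (rule finite_subset[OF _ finite_carrier]) auto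

lemma Borel_decomposition:
  assumes "g \<in> Borel"
  obtains x a d where "x \<in> carrier R" "a \<in> Units R" "d \<in> Units R" "g = uni x \<otimes>\<^bsub>GL\<^esub> dia a d"
proof -
  obtain a b c d where g: "g = Mat2 a b c d" by (cases g)
  then have G: "Mat2 a b c d \<in> carrier GL" and c: "c = \<zero>" using assms by (auto simp: mem_Borel)
  have m: "a \<in> carrier R" "b \<in> carrier R" "d \<in> carrier R" using G by (auto simp: carrier_GL2)
  have "b \<otimes> c \<in> P 1" using m by (simp add: c P_zero)
  note U = det_unit_diag[OF G this]
  have "g = uni (b \<otimes> inv d) \<otimes>\<^bsub>GL\<^esub> dia a d"
    using m U by (simp add: g c gen_defs mult_GL2 m_assoc)
  from that[OF _ U this] show ?thesis using m U by simp
qed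

definition congr_Borel :: "nat \<Rightarrow> 'a mat2 set" where
  "congr_Borel i = {A \<in> Borel. e11 A \<ominus> \<one> \<in> P i \<and> e12 A \<in> P i \<and> e22 A \<ominus> \<one> \<in> P i}"

lemma one_minus_mult:
  assumes "x \<in> carrier R" "y \<in> carrier R" "x \<ominus> \<one> \<in> P i" "y \<ominus> \<one> \<in> P i"
  shows "x \<otimes> y \<ominus> \<one> \<in> P i"
proof -
  have "x \<otimes> y \<ominus> \<one> = x \<otimes> (y \<ominus> \<one>) \<oplus> (x \<ominus> \<one>)" by (insert assms, rule is_diff_eqI, (rule is_diff_intros | simp add: diff_simps)+)
  then show ?thesis using assms by (auto intro: P_add P_lmult)
qed

lemma one_minus_inv:
  assumes "x \<in> Units R" "x \<ominus> \<one> \<in> P i"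
  shows "inv x \<ominus> \<one> \<in> P i"
proof -
  define y where "y = inv x"
  have [simp]: "x \<in> carrier R" "y \<in> carrier R" and xy: "x \<otimes> y = \<one>" using assms by (auto simp: y_def)
  have "y \<ominus> \<one> = \<ominus> y \<otimes> (x \<ominus> \<one>)"
    by (rule eq_modI[OF xy, where k = "\<one>"], rule is_diff_eqI, (rule is_diff_intros | simp add: diff_simps)+)
  then show ?thesis using assms by (auto simp: y_def intro: P_lmult)
qed

lemma congr_Borel_subgroup: "subgroup (congr_Borel i) GL"
proof (rule subgroup.intro)
  show "congr_Borel i \<subseteq> carrier GL" using Borel_subset by (auto simp: congr_Borel_def)
  show "\<one>\<^bsub>GL\<^esub> \<in> congr_Borel i"
    using GL.one_closed unfolding one_GL2 by (simp add: congr_Borel_def mem_Borel P_zero a_minus_def r_neg)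
next
  fix A B assume AB: "A \<in> congr_Borel i" "B \<in> congr_Borel i"
  obtain a b c d a' b' c' d' where M: "A = Mat2 a b c d" "B = Mat2 a' b' c' d'" by (cases A; cases B)
  have "A \<otimes>\<^bsub>GL\<^esub> B \<in> carrier GL" using AB Borel_subset by (auto simp: congr_Borel_def)
  moreover have "a \<otimes> a' \<ominus> \<one> \<in> P i" "d \<otimes> d' \<ominus> \<one> \<in> P i" "a \<otimes> b' \<oplus> b \<otimes> d' \<in> P i"
    using AB unfolding M
    by (auto simp: congr_Borel_def mem_Borel carrier_GL2 intro: one_minus_mult P_add P_lmult P_rmult)
  ultimately show "A \<otimes>\<^bsub>GL\<^esub> B \<in> congr_Borel i"
    using AB unfolding M by (auto simp: congr_Borel_def mem_Borel mult_GL2 carrier_GL2)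
next
  fix A assume A: "A \<in> congr_Borel i"
  obtain a b c d where M: "A = Mat2 a b c d" by (cases A)
  have G: "A \<in> carrier GL" and c0: "c = \<zero>" using A by (auto simp: M congr_Borel_def mem_Borel)
  have m [simp]: "a \<in> carrier R" "b \<in> carrier R" "d \<in> carrier R" using G by (auto simp: M carrier_GL2)
  have "b \<otimes> c \<in> P 1" by (simp add: c0 P_zero)
  note U = det_unit_diag[OF G[unfolded M] this]
  let ?I = "Mat2 (inv a) (\<ominus> (inv a \<otimes> b \<otimes> inv d)) \<zero> (inv d)"
  have "?I \<in> carrier GL" using U by (simp add: carrier_GL2 a_minus_def)
  moreover have "?I \<otimes>\<^bsub>GL\<^esub> A = \<one>\<^bsub>GL\<^esub>"
    using U by (simp add: M c0 mult_GL2 one_GL2 m_assoc l_minus r_neg)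
  ultimately have I: "inv\<^bsub>GL\<^esub> A = ?I" using G by (intro GL.inv_equality) auto
  show "inv\<^bsub>GL\<^esub> A \<in> congr_Borel i"
    unfolding I using A U \<open>?I \<in> carrier GL\<close>
    by (auto simp: M congr_Borel_def mem_Borel intro: one_minus_inv P_neg P_lmult P_rmult)
qed

lemma congr_Borel_decomposition:
  assumes "g \<in> congr_Borel i"
  obtains x a d where "x \<in> P i" "a \<in> Units R" "d \<in> Units R" "a \<ominus> \<one> \<in> P i" "d \<ominus> \<one> \<in> P i"
    "g = uni x \<otimes>\<^bsub>GL\<^esub> dia a d" "e22 g = d"
proof -
  obtain x a d where g: "x \<in> carrier R" "a \<in> Units R" "d \<in> Units R" "g = uni x \<otimes>\<^bsub>GL\<^esub> dia a d"
    using Borel_decomposition[of g] assms by (auto simp: congr_Borel_def)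
  then have g': "g = Mat2 a (x \<otimes> d) \<zero> d" by (simp add: gen_defs mult_GL2)
  then have "x \<otimes> d \<otimes> inv d \<in> P i" "a \<ominus> \<one> \<in> P i" "d \<ominus> \<one> \<in> P i"
    using assms g by (auto simp: congr_Borel_def intro: P_rmult)
  then have "x \<in> P i" using g by (simp add: m_assoc)
  moreover have "e22 g = d" by (simp add: g')
  ultimately show ?thesis using that[of x a d] g \<open>a \<ominus> \<one> \<in> P i\<close> \<open>d \<ominus> \<one> \<in> P i\<close> by blast
qed

lemma gen_congr_Borel:
  "x \<in> P i \<Longrightarrow> uni x \<in> congr_Borel i"
  "a \<in> Units R \<Longrightarrow> d \<in> Units R \<Longrightarrow> a \<ominus> \<one> \<in> P i \<Longrightarrow> d \<ominus> \<one> \<in> P i \<Longrightarrow> dia a d \<in> congr_Borel i"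
  using upper_gen_Borel(1)[of x] upper_gen_Borel(2)[of a d] P_closed[of x i]
  by (auto simp: congr_Borel_def uni_def dia_def P_zero a_minus_def r_neg)

lemma finite_congr_Borel: "finite (congr_Borel i)"
  using finite_subset[OF _ finite_GL2[OF finite_carrier]] subgroup.subset[OF congr_Borel_subgroup] by blast

lemma uni_subgroup: "subgroup (uni ` carrier R) GL"
proof (rule subgroup.intro)
  show "uni ` carrier R \<subseteq> carrier GL" by auto
  show "\<one>\<^bsub>GL\<^esub> \<in> uni ` carrier R" using uni_zero by (metis imageI zero_closed)
  fix A B assume AB: "A \<in> uni ` carrier R" "B \<in> uni ` carrier R"
  then show "A \<otimes>\<^bsub>GL\<^esub> B \<in> uni ` carrier R" by (auto simp: uni_mult)
  from AB obtain x where x: "x \<in> carrier R" "A = uni x" by auto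
  then have "uni (\<ominus> x) \<otimes>\<^bsub>GL\<^esub> A = \<one>\<^bsub>GL\<^esub>" by (simp add: uni_mult l_neg uni_zero)
  then have "inv\<^bsub>GL\<^esub> A = uni (\<ominus> x)" using x by (intro GL.inv_equality) auto
  then show "inv\<^bsub>GL\<^esub> A \<in> uni ` carrier R" using x by auto
qed

end

text \<open>\<open>V\<close> and \<open>W\<close> share the ambient vector space merely to share its
  scalar multiplication; no relation between them is meant. Dependence of every such
  \<open>f\<close> and \<open>g\<close> says that Hom_B(W, V) has dimension at most one.\<close>

locale borel_pair = gl2_rep R p scale V act + W: lin_rep scale "(GL2 R)\<lparr>carrier := upper_triangular_GL2 R\<rparr>" W actB
  for R :: "'a ring" (structure) and p and scale :: "complex \<Rightarrow> 'v::ab_group_add \<Rightarrow> 'v" (infixr \<open>*s\<close> 75)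
    and V :: "'v set" and act :: "'a mat2 \<Rightarrow> 'v \<Rightarrow> 'v" and W :: "'v set" and actB +
  fixes f g :: "'v \<Rightarrow> 'v"
  assumes irrV: irreducible and irrW: W.irreducible
    and f_closed: "w \<in> W \<Longrightarrow> f w \<in> V" and g_closed: "w \<in> W \<Longrightarrow> g w \<in> V"
    and f_lin: "lin_on W f" and g_lin: "lin_on W g"
    and f_equiv: "h \<in> upper_triangular_GL2 R \<Longrightarrow> w \<in> W \<Longrightarrow> f (actB h w) = act h (f w)"
    and g_equiv: "h \<in> upper_triangular_GL2 R \<Longrightarrow> w \<in> W \<Longrightarrow> g (actB h w) = act h (g w)"
begin

definition dependent_maps :: bool where
  "dependent_maps \<longleftrightarrow> (\<exists>a b. (a \<noteq> 0 \<or> b \<noteq> 0) \<and> (\<forall>w\<in>W. a *s f w + b *s g w = 0))"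

lemma W_nontrivial: "W \<noteq> {0}"
  using irrW by (simp add: W.irreducible_def)

text \<open>The kernel of the combination of \<open>f\<close> and \<open>g\<close> is stable under
  the Borel subgroup, so by irreducibility of \<open>W\<close> a single nonzero vector in it makes
  it all of \<open>W\<close>.\<close>

lemma dependent_at:
  assumes w: "w \<in> W" "w \<noteq> 0" and ab: "a \<noteq> 0 \<or> b \<noteq> 0" "a *s f w + b *s g w = 0"
  shows dependent_maps
proof -
  define S where "S = {w\<in>W. a *s f w + b *s g w = 0}"
  have Ssub: "subspace S"
    unfolding subspace_def
  proof (intro conjI ballI allI)
    show "0 \<in> S" using subspace_0[OF W.sub] lin_on_zero[OF f_lin W.sub] lin_on_zero[OF g_lin W.sub] by (simp add: S_def)
  next
    fix x y assume xy: "x \<in> S" "y \<in> S"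
    then have "x \<in> W" "y \<in> W" by (auto simp: S_def)
    then have "a *s f (x + y) + b *s g (x + y) = (a *s f x + b *s g x) + (a *s f y + b *s g y)"
      by (simp add: lin_onD[OF f_lin] lin_onD[OF g_lin] scale_right_distrib)
    then show "x + y \<in> S" using xy subspace_add[OF W.sub] by (simp add: S_def)
  next
    fix c x assume x: "x \<in> S"
    then have "x \<in> W" by (simp add: S_def)
    then have "a *s f (c *s x) + b *s g (c *s x) = c *s (a *s f x + b *s g x)"
      by (simp add: lin_onD[OF f_lin] lin_onD[OF g_lin] scale_right_distrib mult.commute)
    then show "c *s x \<in> S" using x subspace_scale[OF W.sub] by (simp add: S_def)
  qed
  have "actB h x \<in> S" if h: "h \<in> Borel" and x: "x \<in> S" for h x
  proof -
    have hG: "h \<in> carrier GL" using h Borel_subset by blast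
    have xW: "x \<in> W" using x by (simp add: S_def)
    have "a *s f (actB h x) + b *s g (actB h x) = act h (a *s f x + b *s g x)"
      using xW h hG f_closed g_closed by (simp add: f_equiv g_equiv act_add act_scale subspace_scale[OF sub])
    then show ?thesis using x h hG W.act_closed by (simp add: S_def act_zero)
  qed
  then have "W.invariant Borel S" using Ssub by (auto simp: W.invariant_def S_def)
  then have "S = {0} \<or> S = W" using irrW by (simp add: W.irreducible_def)
  moreover have "w \<in> S" using w ab by (simp add: S_def)
  ultimately have "S = W" using w by auto
  then show ?thesis unfolding dependent_maps_def using ab(1) by (auto simp: S_def)
qed

lemma dependent_at_span:
  assumes "w \<in> W" "w \<noteq> 0" "f w \<in> span {z}" "g w \<in> span {z}"
  shows dependent_maps
  using dependent_pair[OF assms(3,4)] dependent_at[OF assms(1,2)] by blast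

lemma dependent_at_zero: "w \<in> W \<Longrightarrow> w \<noteq> 0 \<Longrightarrow> f w = 0 \<Longrightarrow> dependent_maps"
  by (rule dependent_at[of _ 1 0]) auto

lemma unipotent_eigenvector:
  obtains w \<psi> where "w \<in> W" "w \<noteq> 0" "\<And>x. x \<in> carrier R \<Longrightarrow> actB (uni x) w = \<psi> (uni x) *s w"
proof -
  have inv: "W.invariant (uni ` carrier R) W"
    using W.act_closed W.sub by (auto simp: W.invariant_def)
  have comm: "a \<otimes>\<^bsub>GL\<lparr>carrier := Borel\<rparr>\<^esub> b = b \<otimes>\<^bsub>GL\<lparr>carrier := Borel\<rparr>\<^esub> a"
    if "a \<in> uni ` carrier R" "b \<in> uni ` carrier R" for a b
    using that by (auto simp: uni_mult a_comm)
  have s: "uni ` carrier R \<subseteq> carrier (GL\<lparr>carrier := Borel\<rparr>)" by auto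
  show ?thesis
    by (rule W.common_eigenvector[OF _ s comm inv W_nontrivial]) (use that finite_carrier in auto)
qed

text \<open>For an eigenvector \<open>w\<close> of the upper unipotent group, \<open>f w\<close> and
  \<open>g w\<close> share its character, which is nontrivial on \<open>P (j - 1)\<close> by
  \<open>nofix\<close>. The swap makes them eigenvectors of the lower unipotent group, where
  multiplicity one with \<open>s = 0\<close> applies.\<close>

lemma generic_case:
  assumes j: "1 \<le> j" and triv: "\<And>v. v \<in> V \<Longrightarrow> fixed j j v"
    and nofix: "\<And>w. w \<in> W \<Longrightarrow> (\<forall>x\<in>P (j - 1). actB (uni x) w = w) \<Longrightarrow> w = 0"
  shows dependent_maps
proof -
  obtain w \<psi> where w: "w \<in> W" "w \<noteq> 0" "\<And>x. x \<in> carrier R \<Longrightarrow> actB (uni x) w = \<psi> (uni x) *s w"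
    using unipotent_eigenvector by blast
  define \<phi> where "\<phi> x = \<psi> (uni x)" for x
  have "additive_char R (P 0) \<phi>"
    unfolding additive_char_def P_0 \<phi>_def
  proof (intro conjI ballI)
    fix x assume x: "x \<in> carrier R"
    show "\<psi> (uni x) \<noteq> 0" by (rule W.eigenvalue_nonzero[of "uni x" w]) (use x w in auto)
    fix y assume y: "y \<in> carrier R"
    show "\<psi> (uni (x \<oplus> y)) = \<psi> (uni x) * \<psi> (uni y)"
      by (rule W.eigenvalue_mult[of "uni x" "uni y" w]) (use x y w in \<open>auto simp: uni_mult\<close>)
  qed
  note \<phi> = this
  obtain y0 where y0: "y0 \<in> P (j - 1)" "\<phi> y0 \<noteq> 1"
    using nofix[OF w(1)] w P_closed unfolding \<phi>_def by force
  have "\<exists>z. V \<inter> eigenspace (low ` P 0) (\<phi> \<circ> e21) \<subseteq> span {z}"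
  proof (rule generic_multiplicity_one[of 0 j V \<phi> y0])
    show "invariant (congr_lower 0) V" unfolding congr_lower_0 by (auto simp: invariant_def sub act_closed)
    show "V \<subseteq> span (orbit (congr_lower 0) x)" if "x \<in> V" "x \<noteq> 0" for x
      using irreducible_span_orbit[OF irrV that] by (simp add: congr_lower_0)
  qed (use j triv \<phi> y0 in auto)
  then obtain z where z: "V \<inter> eigenspace (low ` P 0) (\<phi> \<circ> e21) \<subseteq> span {z}" by blast
  have sw: "act swp v \<in> span {z}" if v: "v \<in> V" "\<And>x. x \<in> carrier R \<Longrightarrow> act (uni x) v = \<phi> x *s v" for v
  proof -
    have "act (low x) (act swp v) = \<phi> x *s act swp v" if x: "x \<in> carrier R" for x
    proof -
      have "act (low x) (act swp v) = act (swp \<otimes>\<^bsub>GL\<^esub> uni x) v" using x v by (simp add: act_mult swp_gen)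
      also have "\<dots> = \<phi> x *s act swp v" using x v by (simp add: act_mult act_scale)
      finally show ?thesis .
    qed
    then have "act swp v \<in> eigenspace (low ` P 0) (\<phi> \<circ> e21)" using v by (auto simp: eigenspace_def act_closed P_0 e21_low)
    then show ?thesis using z v by (auto simp: act_closed)
  qed
  have fw: "act (uni x) (f w) = \<phi> x *s f w" "act (uni x) (g w) = \<phi> x *s g w" if "x \<in> carrier R" for x
    using that w f_equiv[of "uni x" w] g_equiv[of "uni x" w] by (simp_all add: \<phi>_def lin_onD[OF f_lin] lin_onD[OF g_lin])
  have "act swp (f w) \<in> span {z}" "act swp (g w) \<in> span {z}"
    using fw w by (auto intro!: sw f_closed g_closed)
  then obtain a b where ab: "a \<noteq> 0 \<or> b \<noteq> 0" "a *s act swp (f w) + b *s act swp (g w) = 0"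
    using dependent_pair by blast
  have m: "f w \<in> V" "g w \<in> V" using w f_closed g_closed by auto
  have "act swp (a *s f w + b *s g w) = 0" using ab m by (simp add: act_add act_scale subspace_scale[OF sub])
  then have "a *s f w + b *s g w = 0"
    by (rule act_eq_zero[rotated 2]) (use m in \<open>auto intro!: subspace_add[OF sub] subspace_scale[OF sub]\<close>)
  then show ?thesis using dependent_at[OF w(1,2) ab(1)] by blast
qed

end

section \<open>Non-generic representations of the Borel subgroup\<close>

text \<open>Here \<open>V\<close> is trivial on the congruence subgroup of level \<open>j\<close>, and \<open>W\<close> on the upper unipotent
  matrices of level \<open>j - 1\<close>. A twist by a character of the determinant has made the first diagonal
  entry act trivially on \<open>w0\<close>.\<close>

locale borel_pair_level = borel_pair R p scale V act W actB f g
  for R :: "'a ring" (structure) and p and scale :: "complex \<Rightarrow> 'v::ab_group_add \<Rightarrow> 'v" (infixr \<open>*s\<close> 75)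
    and V :: "'v set" and act :: "'a mat2 \<Rightarrow> 'v \<Rightarrow> 'v" and W :: "'v set" and actB and f g :: "'v \<Rightarrow> 'v" +
  fixes j :: nat and w0 :: 'v and \<chi> :: "'a \<Rightarrow> complex"
  assumes j: "1 \<le> j" and triv: "\<And>v. v \<in> V \<Longrightarrow> fixed j j v"
    and Ufix: "\<And>w x. w \<in> W \<Longrightarrow> x \<in> P (j - 1) \<Longrightarrow> actB (uni x) w = w"
    and w0: "w0 \<in> W" "w0 \<noteq> 0"
    and \<chi>: "\<And>a d. a \<in> Units R \<Longrightarrow> d \<in> Units R \<Longrightarrow> actB (dia a d) w0 = \<chi> d *s w0"
begin

definition X :: "'v set" where "X = eigenspace (congr_Borel (j - 1)) (\<chi> \<circ> e22)"

lemma chi_mult: "d \<in> Units R \<Longrightarrow> d' \<in> Units R \<Longrightarrow> \<chi> (d \<otimes> d') = \<chi> d * \<chi> d'"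
  by (rule W.eigenvalue_mult[of "dia \<one> d" "dia \<one> d'" w0]) (use w0 \<chi> in \<open>auto simp: dia_mult\<close>)

lemma chi_nonzero: "d \<in> Units R \<Longrightarrow> \<chi> d \<noteq> 0"
  by (rule W.eigenvalue_nonzero[of "dia \<one> d" w0]) (use w0 \<chi> in auto)

lemma chi_one: "\<chi> \<one> = 1"
  using chi_mult[of \<one> \<one>] chi_nonzero[of \<one>] by simp

lemma in_X_iff: "v \<in> X \<longleftrightarrow> v \<in> V \<and> (\<forall>x\<in>P (j - 1). act (uni x) v = v) \<and>
    (\<forall>a\<in>Units R. \<forall>d\<in>Units R. a \<ominus> \<one> \<in> P (j - 1) \<longrightarrow> d \<ominus> \<one> \<in> P (j - 1) \<longrightarrow> act (dia a d) v = \<chi> d *s v)"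
    (is "_ \<longleftrightarrow> ?R")
proof
  assume v: "v \<in> X"
  have "act (uni x) v = v" if "x \<in> P (j - 1)" for x
    using v gen_congr_Borel(1)[OF that] chi_one unfolding X_def eigenspace_def by (auto simp: uni_def)
  moreover have "act (dia a d) v = \<chi> d *s v"
    if "a \<in> Units R" "d \<in> Units R" "a \<ominus> \<one> \<in> P (j - 1)" "d \<ominus> \<one> \<in> P (j - 1)" for a d
    using v gen_congr_Borel(2)[OF that] unfolding X_def eigenspace_def by (auto simp: dia_def)
  ultimately show ?R using v by (auto simp: X_def eigenspace_def)
next
  assume R: ?R
  have "act k v = \<chi> (e22 k) *s v" if k: "k \<in> congr_Borel (j - 1)" for k
  proof -
    obtain x a d where xad: "x \<in> P (j - 1)" "a \<in> Units R" "d \<in> Units R" "a \<ominus> \<one> \<in> P (j - 1)"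
        "d \<ominus> \<one> \<in> P (j - 1)" "k = uni x \<otimes>\<^bsub>GL\<^esub> dia a d" "e22 k = d"
      using congr_Borel_decomposition[OF k] .
    have x: "x \<in> carrier R" using xad P_closed by blast
    have "act k v = act (uni x) (act (dia a d) v)" unfolding xad(6) using xad R x by (simp add: act_mult)
    also have "\<dots> = \<chi> d *s v" using xad R x by (simp add: act_scale)
    finally show ?thesis using xad(7) by simp
  qed
  then show "v \<in> X" using R by (simp add: X_def eigenspace_def)
qed

lemma X_V: "X \<subseteq> V" by (auto simp: X_def eigenspace_def)

lemma X_subspace: "subspace X"
  unfolding X_def by (rule eigenspace_subspace[OF subgroup.subset[OF congr_Borel_subgroup]])

lemma char_X: "character (congr_Borel (j - 1)) (\<chi> \<circ> e22)"
  unfolding character_def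
proof (intro conjI ballI congr_Borel_subgroup finite_congr_Borel)
  fix k assume "k \<in> congr_Borel (j - 1)"
  then obtain d where d: "d \<in> Units R" "e22 k = d" using congr_Borel_decomposition by metis
  then show "(\<chi> \<circ> e22) k \<noteq> 0" using chi_nonzero by simp
  fix k' assume k': "k' \<in> congr_Borel (j - 1)"
  then obtain d' where d': "d' \<in> Units R" "e22 k' = d'" using congr_Borel_decomposition by metis
  have "e21 k = \<zero>" "e21 k' = \<zero>" "k \<in> carrier GL" "k' \<in> carrier GL"
    using \<open>k \<in> congr_Borel (j - 1)\<close> k' by (auto simp: congr_Borel_def upper_triangular_GL2_def)
  then have "e22 (k \<otimes>\<^bsub>GL\<^esub> k') = d \<otimes> d'" using d d' by (cases k; cases k') (auto simp: mult_GL2 carrier_GL2)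
  then show "(\<chi> \<circ> e22) (k \<otimes>\<^bsub>GL\<^esub> k') = (\<chi> \<circ> e22) k * (\<chi> \<circ> e22) k'" using d d' chi_mult by simp
qed

lemma X_uni_shift:
  assumes v: "v \<in> X" and xy: "x \<in> carrier R" "y \<in> carrier R" "x \<ominus> y \<in> P (j - 1)"
  shows "act (uni x) v = act (uni y) v"
proof -
  have "x = y \<oplus> (x \<ominus> y)" using xy(1,2) by algebra
  then have "uni x = uni y \<otimes>\<^bsub>GL\<^esub> uni (x \<ominus> y)" using xy by (simp add: uni_mult)
  then have "act (uni x) v = act (uni y) (act (uni (x \<ominus> y)) v)"
    using act_mult[of "uni y" "uni (x \<ominus> y)" v] xy v X_V by auto
  then show ?thesis using v xy by (simp add: in_X_iff)
qed

lemma V_low_shift: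
  assumes v: "v \<in> V" and xy: "x \<in> carrier R" "y \<in> carrier R" "x \<ominus> y \<in> P j"
  shows "act (low x) v = act (low y) v"
proof -
  have "x = y \<oplus> (x \<ominus> y)" using xy(1,2) by algebra
  then have "low x = low y \<otimes>\<^bsub>GL\<^esub> low (x \<ominus> y)" using xy by (simp add: low_mult)
  then have "act (low x) v = act (low y) (act (low (x \<ominus> y)) v)"
    using act_mult[of "low y" "low (x \<ominus> y)" v] xy v by auto
  then show ?thesis using triv[OF v] xy by (simp add: fixed_def)
qed

text \<open>Moving \<open>dia a d\<close> past \<open>uni y\<close> changes \<open>y\<close> by a
  multiple of \<open>(a \<ominus> \<one>) \<ominus> (d \<ominus> \<one>)\<close>, an element of
  \<open>P (j - 1)\<close>, and such a change is invisible on \<open>X\<close>.\<close>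

lemma X_uni: assumes v: "v \<in> X" and y: "y \<in> carrier R" shows "act (uni y) v \<in> X"
proof -
  have vV: "v \<in> V" using v X_V by blast
  have "act (uni x) (act (uni y) v) = act (uni y) v" if x: "x \<in> P (j - 1)" for x
  proof -
    have [simp]: "x \<in> carrier R" using x P_closed by blast
    have "x \<oplus> y \<ominus> y = x" by (insert y, rule is_diff_eqI, (rule is_diff_intros | simp add: diff_simps)+)
    then have "act (uni (x \<oplus> y)) v = act (uni y) v" using x y by (intro X_uni_shift[OF v]) auto
    then show ?thesis using y vV by (simp add: act_mult[symmetric] uni_mult)
  qed
  moreover have "act (dia a d) (act (uni y) v) = \<chi> d *s act (uni y) v"
    if ad: "a \<in> Units R" "d \<in> Units R" "a \<ominus> \<one> \<in> P (j - 1)" "d \<ominus> \<one> \<in> P (j - 1)" for a d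
  proof -
    define e where "e = inv d"
    have [simp]: "a \<in> carrier R" "d \<in> carrier R" "e \<in> carrier R" and de: "d \<otimes> e = \<one>" using ad by (auto simp: e_def)
    have "act (dia a d) (act (uni y) v) = act (uni (a \<otimes> y \<otimes> e)) (act (dia a d) v)"
      using ad y vV by (simp add: act_mult[symmetric] dia_uni e_def)
    also have "act (dia a d) v = \<chi> d *s v" using ad v by (simp add: in_X_iff)
    also have "act (uni (a \<otimes> y \<otimes> e)) (\<chi> d *s v) = \<chi> d *s act (uni (a \<otimes> y \<otimes> e)) v"
      using y vV by (simp add: act_scale)
    also have "act (uni (a \<otimes> y \<otimes> e)) v = act (uni y) v"
    proof (rule X_uni_shift[OF v])
      have "a \<otimes> y \<otimes> e \<ominus> y = y \<otimes> e \<otimes> ((a \<ominus> \<one>) \<ominus> (d \<ominus> \<one>))"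
        by (insert y, rule eq_modI[OF de, where k = "y"], rule is_diff_eqI, (rule is_diff_intros | simp add: diff_simps)+)
      then show "a \<otimes> y \<otimes> e \<ominus> y \<in> P (j - 1)" using ad y P_diff[OF ad(3,4)] by (auto intro: P_lmult)
    qed (use y in auto)
    finally show ?thesis .
  qed
  ultimately show ?thesis using vV y by (simp add: in_X_iff act_closed)
qed

lemma X_dia: assumes v: "v \<in> X" and b: "b \<in> Units R" "c \<in> Units R" shows "act (dia b c) v \<in> X"
proof -
  have vV: "v \<in> V" using v X_V by blast
  have "act (uni x) (act (dia b c) v) = act (dia b c) v" if x: "x \<in> P (j - 1)" for x
  proof -
    have [simp]: "x \<in> carrier R" using x P_closed by blast
    have "dia b c \<otimes>\<^bsub>GL\<^esub> uni (inv b \<otimes> x \<otimes> c) = uni x \<otimes>\<^bsub>GL\<^esub> dia b c"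
      using b by (subst dia_uni) (auto simp: m_assoc m_assoc[symmetric, of b])
    then have "act (uni x) (act (dia b c) v) = act (dia b c) (act (uni (inv b \<otimes> x \<otimes> c)) v)"
      using b vV by (simp add: act_mult[symmetric])
    also have "act (uni (inv b \<otimes> x \<otimes> c)) v = v" using v x b by (simp add: in_X_iff P_lmult P_rmult)
    finally show ?thesis .
  qed
  moreover have "act (dia a d) (act (dia b c) v) = \<chi> d *s act (dia b c) v"
    if ad: "a \<in> Units R" "d \<in> Units R" "a \<ominus> \<one> \<in> P (j - 1)" "d \<ominus> \<one> \<in> P (j - 1)" for a d
  proof -
    have "act (dia a d) (act (dia b c) v) = act (dia b c) (act (dia a d) v)"
      using ad b vV by (simp add: act_mult[symmetric] dia_mult m_comm)
    then show ?thesis using ad b v vV by (simp add: in_X_iff act_scale)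
  qed
  ultimately show ?thesis using vV b by (simp add: in_X_iff act_closed)
qed

text \<open>Moving \<open>uni x\<close> past \<open>low c\<close> produces the product
  \<open>x \<otimes> c\<close>. With \<open>x\<close> in \<open>P (j - 1)\<close> and
  \<open>c\<close> in \<open>P 1\<close> it lies in \<open>P j\<close>, and at level
  \<open>j\<close> everything acts trivially on \<open>V\<close>; this is why the entry is taken
  from the maximal ideal.\<close>

lemma X_low: assumes v: "v \<in> X" and c: "c \<in> P 1" shows "act (low c) v \<in> X"
proof -
  have vV: "v \<in> V" using v X_V by blast
  have [simp]: "c \<in> carrier R" using c P_closed by blast
  have "act (uni x) (act (low c) v) = act (low c) v" if x: "x \<in> P (j - 1)" for x
  proof -
    have [simp]: "x \<in> carrier R" using x P_closed by blast
    have xc: "x \<otimes> c \<in> P j" using P_mult[OF x c] j by simp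
    have U: "\<one> \<oplus> x \<otimes> c \<in> Units R" using one_add_P1[OF xc j] .
    define e where "e = inv (\<one> \<oplus> x \<otimes> c)"
    have eU: "e \<in> Units R" using U by (simp add: e_def)
    have [simp]: "e \<in> carrier R" using eU by simp
    have e1: "\<one> \<oplus> x \<otimes> c \<ominus> \<one> = x \<otimes> c" by (rule is_diff_eqI, (rule is_diff_intros | simp add: diff_simps)+)
    then have e2: "e \<ominus> \<one> \<in> P j" unfolding e_def by (intro one_minus_inv U) (simp add: xc)
    have "act (uni x) (act (low c) v) = act (low (c \<otimes> e)) (act (dia (\<one> \<oplus> x \<otimes> c) e) (act (uni (x \<otimes> e)) v))"
      using vV U eU by (simp add: act_mult[symmetric] low_uni(2)[OF _ _ U, folded e_def])
        (simp add: act_mult act_closed)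
    also have "act (uni (x \<otimes> e)) v = v" using v x by (simp add: in_X_iff P_rmult)
    also have "act (dia (\<one> \<oplus> x \<otimes> c) e) v = v" using triv[OF vV] U eU e1 e2 xc by (simp add: fixed_def)
    also have "act (low (c \<otimes> e)) v = act (low c) v"
    proof (rule V_low_shift[OF vV])
      have "c \<otimes> e \<ominus> c = c \<otimes> (e \<ominus> \<one>)" by (rule is_diff_eqI, (rule is_diff_intros | simp add: diff_simps)+)
      then show "c \<otimes> e \<ominus> c \<in> P j" using e2 by (simp add: P_lmult)
    qed auto
    finally show ?thesis .
  qed
  moreover have "act (dia a d) (act (low c) v) = \<chi> d *s act (low c) v"
    if ad: "a \<in> Units R" "d \<in> Units R" "a \<ominus> \<one> \<in> P (j - 1)" "d \<ominus> \<one> \<in> P (j - 1)" for a d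
  proof -
    define e where "e = inv a"
    have [simp]: "a \<in> carrier R" "d \<in> carrier R" "e \<in> carrier R" and ae: "a \<otimes> e = \<one>" using ad by (auto simp: e_def)
    have "act (dia a d) (act (low c) v) = act (low (d \<otimes> c \<otimes> e)) (act (dia a d) v)"
      using ad vV by (simp add: act_mult[symmetric] dia_low e_def)
    also have "act (dia a d) v = \<chi> d *s v" using ad v by (simp add: in_X_iff)
    also have "act (low (d \<otimes> c \<otimes> e)) (\<chi> d *s v) = \<chi> d *s act (low (d \<otimes> c \<otimes> e)) v"
      using vV by (simp add: act_scale)
    also have "act (low (d \<otimes> c \<otimes> e)) v = act (low c) v"
    proof (rule V_low_shift[OF vV])
      have "d \<otimes> c \<otimes> e \<ominus> c = e \<otimes> (((d \<ominus> \<one>) \<ominus> (a \<ominus> \<one>)) \<otimes> c)"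
        by (rule eq_modI[OF ae, where k = "c"], rule is_diff_eqI, (rule is_diff_intros | simp add: diff_simps)+)
      moreover have "((d \<ominus> \<one>) \<ominus> (a \<ominus> \<one>)) \<otimes> c \<in> P j" using P_mult[OF P_diff[OF ad(4,3)] c] j by simp
      ultimately show "d \<otimes> c \<otimes> e \<ominus> c \<in> P j" by (simp add: P_lmult)
    qed auto
    finally show ?thesis .
  qed
  ultimately show ?thesis using vV by (simp add: in_X_iff act_closed)
qed

lemma X_invariant: "invariant (congr_lower 1) X"
  unfolding invariant_def
proof (intro conjI ballI X_subspace X_V)
  fix h v assume h: "h \<in> congr_lower 1" and v: "v \<in> X"
  obtain x a d c where hd: "x \<in> carrier R" "a \<in> Units R" "d \<in> Units R" "c \<in> P 1"
      "h = uni x \<otimes>\<^bsub>GL\<^esub> dia a d \<otimes>\<^bsub>GL\<^esub> low c" using congr_lower_decomposition[OF h] .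
  have "act h v = act (uni x) (act (dia a d) (act (low c) v))"
    unfolding hd(5) using hd P_closed[OF hd(4)] v X_V by (auto simp: act_mult act_closed)
  then show "act h v \<in> X" using hd v by (simp add: X_uni X_dia X_low)
qed

lemma w0_fg: "f w0 \<in> V" "g w0 \<in> V" "a \<in> Units R \<Longrightarrow> d \<in> Units R \<Longrightarrow> act (dia a d) (f w0) = \<chi> d *s f w0"
    "a \<in> Units R \<Longrightarrow> d \<in> Units R \<Longrightarrow> act (dia a d) (g w0) = \<chi> d *s g w0"
  using w0 f_closed g_closed f_equiv[of "dia a d" w0] g_equiv[of "dia a d" w0] \<chi>[of a d]
  by (simp_all add: lin_onD[OF f_lin] lin_onD[OF g_lin])

text \<open>The images of \<open>w0\<close> lie in \<open>X\<close> by its torus eigenvalues and by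
  \<open>Ufix\<close>; the Borel translates of \<open>w0\<close> span \<open>W\<close>, and
  \<open>X\<close> is stable under the Borel subgroup.\<close>

lemma maps_into_X: assumes w: "w \<in> W" shows "f w \<in> X" "g w \<in> X"
proof -
  have *: "F w \<in> X" if F: "lin_on W F" "\<And>w. w \<in> W \<Longrightarrow> F w \<in> V" "\<And>h w. h \<in> Borel \<Longrightarrow> w \<in> W \<Longrightarrow> F (actB h w) = act h (F w)"
      for F
  proof -
    have B: "orbit Borel (F w0) \<subseteq> X"
    proof -
      have "act (uni x) (F w0) = F w0" if "x \<in> P (j - 1)" for x
        using F(3)[of "uni x" w0] that w0 Ufix[of w0 x] P_closed by auto
      moreover have "act (dia a d) (F w0) = \<chi> d *s F w0" if "a \<in> Units R" "d \<in> Units R" for a d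
        using F(3)[of "dia a d" w0] that w0 \<chi>[of a d] by (simp add: lin_onD[OF F(1)])
      ultimately have "F w0 \<in> X" using F(2)[OF w0(1)] by (simp add: in_X_iff)
      then show ?thesis using invariantD(3)[OF X_invariant] Borel_congr_lower by (auto simp: orbit_def)
    qed
    have "w \<in> span (W.orbit Borel w0)"
      using W.irreducible_span_orbit[OF irrW w0] w by simp
    then show ?thesis
    proof (rule lin_on_span[OF F(1) W.sub _ X_subspace, rotated 2])
      show "W.orbit Borel w0 \<subseteq> W" using w0 W.act_closed by (auto simp: W.orbit_def)
      show "F x \<in> X" if "x \<in> W.orbit Borel w0" for x
        using that B F(3)[OF _ w0(1)] by (auto simp: W.orbit_def orbit_def)
    qed
  qed
  show "f w \<in> X" by (rule *[OF f_lin f_closed f_equiv])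
  show "g w \<in> X" by (rule *[OF g_lin g_closed g_equiv])
qed

abbreviation e\<^sub>X :: "'v \<Rightarrow> 'v" where "e\<^sub>X \<equiv> proj (congr_Borel (j - 1)) (\<chi> \<circ> e22)"

lemma e\<^sub>X_in: "v \<in> V \<Longrightarrow> e\<^sub>X v \<in> X"
  unfolding X_def by (rule proj_in_eigenspace[OF char_X])

lemma e\<^sub>X_id: "v \<in> X \<Longrightarrow> e\<^sub>X v = v"
  unfolding X_def by (rule proj_eigen[OF char_X])

lemma lin_e\<^sub>X: "lin_on V e\<^sub>X"
  by (rule lin_proj[OF characterD(2)[OF char_X]])

lemma e\<^sub>X_uni:
  assumes y: "y \<in> carrier R" and v: "v \<in> V"
  shows "e\<^sub>X (act (uni y) v) = act (uni y) (e\<^sub>X v)"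
proof -
  \<comment> \<open>Conjugation by \<open>uni y\<close> on upper triangular matrices. It moves the
    upper right entry by \<open>(a \<ominus> d) \<otimes> y\<close>, which stays in
    \<open>P (j - 1)\<close>, and keeps the lower right entry, on which the character
    depends.\<close>
  define \<sigma> where "\<sigma> A = Mat2 (e11 A) (e12 A \<oplus> (e11 A \<ominus> e22 A) \<otimes> y) \<zero> (e22 A)" for A
  have \<sigma>: "\<sigma> A \<in> congr_Borel (j - 1)" "A \<otimes>\<^bsub>GL\<^esub> uni y = uni y \<otimes>\<^bsub>GL\<^esub> \<sigma> A" "e22 (\<sigma> A) = e22 A"
    if A: "A \<in> congr_Borel (j - 1)" for A
  proof -
    obtain a b c d where M: "A = Mat2 a b c d" by (cases A)
    have A': "c = \<zero>" "Mat2 a b c d \<in> carrier GL" "a \<ominus> \<one> \<in> P (j - 1)" "b \<in> P (j - 1)" "d \<ominus> \<one> \<in> P (j - 1)"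
      using A by (auto simp: M congr_Borel_def mem_Borel)
    then have [simp]: "a \<in> carrier R" "b \<in> carrier R" "d \<in> carrier R" by (auto simp: carrier_GL2)
    have "a \<ominus> d = (a \<ominus> \<one>) \<ominus> (d \<ominus> \<one>)" by (rule is_diff_eqI, (rule is_diff_intros | simp add: diff_simps)+)
    then have "a \<ominus> d \<in> P (j - 1)" using P_diff[OF A'(3,5)] by simp
    then have "b \<oplus> (a \<ominus> d) \<otimes> y \<in> P (j - 1)" using A'(4) y by (intro P_add P_rmult) auto
    then show "\<sigma> A \<in> congr_Borel (j - 1)"
      using A' y by (simp add: \<sigma>_def M congr_Borel_def mem_Borel carrier_GL2)
    show "A \<otimes>\<^bsub>GL\<^esub> uni y = uni y \<otimes>\<^bsub>GL\<^esub> \<sigma> A"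
      unfolding \<sigma>_def M A'(1) uni_def mult_GL2 mat2.inject mat2.sel
      by (insert y, intro conjI; (rule is_diff_eqI, (rule is_diff_intros | simp add: diff_simps)+))
    show "e22 (\<sigma> A) = e22 A" by (simp add: \<sigma>_def)
  qed
  have cG: "congr_Borel (j - 1) \<subseteq> carrier GL" by (rule subgroup.subset[OF congr_Borel_subgroup])
  show ?thesis
  proof (rule proj_normalized[OF char_X _ v, of _ \<sigma>])
    fix A assume A: "A \<in> congr_Borel (j - 1)"
    then have "act A (act (uni y) v) = act (uni y) (act (\<sigma> A) v)"
      using \<sigma>(1,2)[OF A] act_mult[of A "uni y" v] act_mult[of "uni y" "\<sigma> A" v] subsetD[OF cG A] subsetD[OF cG \<sigma>(1)[OF A]] y v
      by simp
    then show "\<sigma> A \<in> congr_Borel (j - 1) \<and> act A (act (uni y) v) = act (uni y) (act (\<sigma> A) v) \<and>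
        (\<chi> \<circ> e22) (\<sigma> A) = (\<chi> \<circ> e22) A" using \<sigma>[OF A] by simp
  next
    show "inj_on \<sigma> (congr_Borel (j - 1))"
    proof (rule inj_onI)
      fix A B assume AB: "A \<in> congr_Borel (j - 1)" "B \<in> congr_Borel (j - 1)" "\<sigma> A = \<sigma> B"
      then have "A \<otimes>\<^bsub>GL\<^esub> uni y = B \<otimes>\<^bsub>GL\<^esub> uni y" using \<sigma>(2) by metis
      then show "A = B" using GL.right_cancel[of "uni y" A B] subsetD[OF cG AB(1)] subsetD[OF cG AB(2)] y by simp
    qed
  qed (use y in auto)
qed

text \<open>Translates of \<open>v\<close> under GL_2 span \<open>V\<close>, so their projections
  span \<open>X\<close>. Those by \<open>congr_lower 1\<close> already lie in \<open>X\<close>; one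
  from the other Bruhat cell projects to some \<open>act (uni z) (e\<^sub>X (act swp x))\<close>
  with \<open>x\<close> in \<open>X\<close>, and this is where \<open>Z\<close> enters.\<close>

lemma X_generated:
  assumes Z: "\<And>x. x \<in> X \<Longrightarrow> e\<^sub>X (act swp x) \<in> span (orbit (congr_lower 1) v)" and v: "v \<in> X" "v \<noteq> 0"
    and uni_stable: "\<And>x y. x \<in> carrier R \<Longrightarrow> y \<in> span (orbit (congr_lower 1) v) \<Longrightarrow> act (uni x) y \<in> span (orbit (congr_lower 1) v)"
  shows "X \<subseteq> span (orbit (congr_lower 1) v)"
proof
  fix x assume x: "x \<in> X"
  have vV: "v \<in> V" using v X_V by blast
  have o: "orbit (carrier GL) v \<subseteq> V" using vV by (auto simp: orbit_def act_closed)
  have "x \<in> span (orbit (carrier GL) v)" using irreducible_span_orbit[OF irrV vV v(2)] x X_V by auto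
  from lin_on_span[OF lin_e\<^sub>X sub o subspace_span _ this]
  have "e\<^sub>X x \<in> span (orbit (congr_lower 1) v)"
  proof -
    have "e\<^sub>X y \<in> span (orbit (congr_lower 1) v)" if y: "y \<in> orbit (carrier GL) v" for y
    proof -
      obtain h where h: "h \<in> carrier GL" "y = act h v" using y by (auto simp: orbit_def)
      show ?thesis
      proof (cases "h \<in> congr_lower 1")
        case True
        then have "y \<in> X" using invariantD(3)[OF X_invariant] v h by blast
        then show ?thesis using True h e\<^sub>X_id by (auto simp: orbit_def intro: span_base)
      next
        case False
        then obtain z k where k: "z \<in> carrier R" "k \<in> congr_lower 1" "h = uni z \<otimes>\<^bsub>GL\<^esub> (swp \<otimes>\<^bsub>GL\<^esub> k)"
          using bruhat_decomposition[OF h(1)] by metis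
        have kG: "k \<in> carrier GL" using k(2) by (simp add: congr_lower_def)
        have "y = act (uni z) (act swp (act k v))" unfolding h(2) k(3) using k kG vV by (simp add: act_mult act_closed)
        then have "e\<^sub>X y = act (uni z) (e\<^sub>X (act swp (act k v)))" using e\<^sub>X_uni[of z "act swp (act k v)"] k kG vV by (simp add: act_closed)
        moreover have "act k v \<in> X" using invariantD(3)[OF X_invariant] v k by blast
        ultimately show ?thesis using Z uni_stable k by simp
      qed
    qed
    then show ?thesis
      using \<open>(\<And>a. a \<in> orbit (carrier GL) v \<Longrightarrow> e\<^sub>X a \<in> span (orbit (congr_lower 1) v)) \<Longrightarrow> e\<^sub>X x \<in> span (orbit (congr_lower 1) v)\<close> by blast
  qed
  then show "x \<in> span (orbit (congr_lower 1) v)" using e\<^sub>X_id[OF x] by simp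
qed

lemma span_congr_lower_uni:
  assumes v: "v \<in> V" and x: "x \<in> carrier R" "y \<in> span (orbit (congr_lower 1) v)"
  shows "act (uni x) y \<in> span (orbit (congr_lower 1) v)"
proof -
  have "uni x \<in> congr_lower 1" using x Borel_congr_lower upper_gen_Borel(1) by blast
  then show ?thesis using invariantD(3)[OF span_orbit_invariant[OF congr_lower_subgroup v]] x by blast
qed

lemma X_generated_if_zero:
  assumes Z: "\<And>x. x \<in> X \<Longrightarrow> e\<^sub>X (act swp x) = 0" and v: "v \<in> X" "v \<noteq> 0"
  shows "X \<subseteq> span (orbit (congr_lower 1) v)"
  using X_generated[OF _ v] Z span_congr_lower_uni[of v] v X_V span_zero by auto

end

section \<open>The character \<chi> on units close to one, and the case where it is nontrivial
  there\<close>

context borel_pair_level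
begin

lemma chi_one_plus_P: 
  assumes "X \<noteq> {0}" "d \<in> Units R" "d \<ominus> \<one> \<in> P j"
  shows "\<chi> d = 1"
proof -
  obtain v where v: "v \<in> X" "v \<noteq> 0" using assms(1) subspace_0[OF X_subspace] by blast
  have vV: "v \<in> V" using v X_V by blast
  have one: "\<one> \<ominus> \<one> \<in> P i" for i by (simp add: a_minus_def r_neg P_zero)
  have "d \<ominus> \<one> \<in> P (j - 1)" using P_mono[of "j - 1" j] assms by simp
  then have "act (dia \<one> d) v = \<chi> d *s v" using v(1) one[of "j - 1"] assms by (simp add: in_X_iff)
  moreover have "act (dia \<one> d) v = v" using triv[OF vV] one[of j] assms by (simp add: fixed_def)
  ultimately show ?thesis using eq_scale_zero v(2) by metis
qed

lemma chi_cong: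
  assumes X: "X \<noteq> {0}" and d: "d \<in> Units R" "d' \<in> Units R" "d \<ominus> d' \<in> P j"
  shows "\<chi> d = \<chi> d'"
proof -
  define e where "e = inv d'"
  have eU: "e \<in> Units R" and [simp]: "e \<in> carrier R" and de: "d' \<otimes> e = \<one>" using d by (auto simp: e_def)
  have [simp]: "d \<in> carrier R" "d' \<in> carrier R" using d by auto
  have "d \<otimes> e \<ominus> \<one> = e \<otimes> (d \<ominus> d')"
    by (rule eq_modI[OF de, where k = "\<one>"], rule is_diff_eqI, (rule is_diff_intros | simp add: diff_simps)+)
  then have "d \<otimes> e \<ominus> \<one> \<in> P j" using d by (simp add: P_lmult)
  then have "\<chi> (d \<otimes> e) = 1" using chi_one_plus_P[OF X] d eU by simp
  moreover have "d = d' \<otimes> (d \<otimes> e)"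
    by (rule eq_modI[OF de, where k = "\<ominus> d"], rule is_diff_eqI, (rule is_diff_intros | simp add: diff_simps)+)
  ultimately show ?thesis using chi_mult[of d' "d \<otimes> e"] d eU by (metis Units_m_closed mult.right_neutral)
qed

text \<open>The product of the factors for \<open>x\<close> and \<open>y\<close> differs from the
  factor for \<open>x \<oplus> y\<close> by a multiple of the square of
  \<open>p [^] (j - 1)\<close>; for j at least 2 this lies in \<open>P j\<close>, where
  \<open>\<chi>\<close> does not see it.\<close>

lemma additive_char_chi:
  assumes X: "X \<noteq> {0}" and j2: "2 \<le> j"
  shows "additive_char R (carrier R) (\<lambda>r. \<chi> (\<one> \<oplus> p [^] (j - 1) \<otimes> r))"
  unfolding additive_char_def
proof (intro conjI ballI)
  have U: "\<one> \<oplus> p [^] (j - 1) \<otimes> r \<in> Units R" if "r \<in> carrier R" for r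
    using that j2 by (intro one_add_P1[of _ "j - 1"]) (auto simp: P_def)
  fix x assume x: "x \<in> carrier R"
  show "\<chi> (\<one> \<oplus> p [^] (j - 1) \<otimes> x) \<noteq> 0" using chi_nonzero[OF U[OF x]] .
  fix y assume y: "y \<in> carrier R"
  define q where "q = p [^] (j - 1)"
  have [simp]: "q \<in> carrier R" by (simp add: q_def)
  have "q \<otimes> q \<in> P (j - 1 + (j - 1))" unfolding q_def by (intro P_mult p_pow_in_P)
  then have qq: "q \<otimes> q \<in> P j" by (rule P_mono[rotated]) (use j2 in simp)
  have "\<chi> (\<one> \<oplus> q \<otimes> (x \<oplus> y)) = \<chi> ((\<one> \<oplus> q \<otimes> x) \<otimes> (\<one> \<oplus> q \<otimes> y))"
  proof (rule chi_cong[OF X])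
    have "\<one> \<oplus> q \<otimes> (x \<oplus> y) \<ominus> (\<one> \<oplus> q \<otimes> x) \<otimes> (\<one> \<oplus> q \<otimes> y) = \<ominus> (x \<otimes> y) \<otimes> (q \<otimes> q)"
      by (insert x y, rule is_diff_eqI, (rule is_diff_intros | simp add: diff_simps)+)
    then show "\<one> \<oplus> q \<otimes> (x \<oplus> y) \<ominus> (\<one> \<oplus> q \<otimes> x) \<otimes> (\<one> \<oplus> q \<otimes> y) \<in> P j"
      using x y qq by (simp add: P_lmult)
  qed (use U[of "x \<oplus> y"] U[of x] U[of y] x y in \<open>auto simp: q_def\<close>)
  also have "\<dots> = \<chi> (\<one> \<oplus> q \<otimes> x) * \<chi> (\<one> \<oplus> q \<otimes> y)"
    using U[OF x] U[OF y] by (intro chi_mult) (auto simp: q_def)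
  finally show "\<chi> (\<one> \<oplus> p [^] (j - 1) \<otimes> (x \<oplus> y)) =
      \<chi> (\<one> \<oplus> p [^] (j - 1) \<otimes> x) * \<chi> (\<one> \<oplus> p [^] (j - 1) \<otimes> y)" by (simp add: q_def)
qed

lemma low_P_invariant: "1 \<le> i \<Longrightarrow> invariant (low ` P i) X"
  using X_low P_mono[of 1 i] X_subspace X_V by (auto simp: invariant_def)

lemma low_eigenvector:
  assumes i: "1 \<le> i" and S: "invariant (low ` P i) S" "S \<noteq> {0}"
  obtains y \<nu> where "y \<in> S" "y \<noteq> 0" "\<And>c. c \<in> P i \<Longrightarrow> act (low c) y = \<nu> (low c) *s y"
    "additive_char R (P i) (\<lambda>c. \<nu> (low c))"
proof -
  have comm: "a \<otimes>\<^bsub>GL\<^esub> b = b \<otimes>\<^bsub>GL\<^esub> a" if "a \<in> low ` P i" "b \<in> low ` P i" for a b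
    using that by (auto simp: low_mult a_comm P_closed)
  have s: "low ` P i \<subseteq> carrier GL" using P_closed by auto
  obtain y \<nu> where y: "y \<in> S" "y \<noteq> 0" "\<And>a. a \<in> low ` P i \<Longrightarrow> act a y = \<nu> a *s y"
    by (rule common_eigenvector[OF _ s comm S]) (use finite_P in auto)
  have yV: "y \<in> V" using y invariantD(2)[OF S(1)] by blast
  have "additive_char R (P i) (\<lambda>c. \<nu> (low c))"
    unfolding additive_char_def
  proof (intro conjI ballI)
    fix x assume x: "x \<in> P i"
    show "\<nu> (low x) \<noteq> 0" by (rule eigenvalue_nonzero[of "low x" y]) (use x y yV P_closed in auto)
    fix z assume z: "z \<in> P i"
    show "\<nu> (low (x \<oplus> z)) = \<nu> (low x) * \<nu> (low z)"
      by (rule eigenvalue_mult[of "low x" "low z" y]) (use x z y yV P_closed P_add in \<open>auto simp: low_mult\<close>)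
  qed
  then show ?thesis using that[of y \<nu>] y by blast
qed

text \<open>The swap exchanges the diagonal entries: \<open>dia \<one> d0\<close> acts on
  \<open>act swp x\<close> as \<open>dia d0 \<one>\<close> acts on \<open>x\<close>, that is
  trivially, whereas on \<open>X\<close> it acts by \<open>\<chi> d0\<close>.\<close>

lemma unequal_swp_zero:
  assumes d0: "d0 \<in> Units R" "d0 \<ominus> \<one> \<in> P (j - 1)" "\<chi> d0 \<noteq> 1" and x: "x \<in> X"
  shows "e\<^sub>X (act swp x) = 0"
proof (rule proj_eq_zero[OF char_X, of "dia \<one> d0" _ 1])
  have xV: "x \<in> V" using x X_V by blast
  have one: "\<one> \<ominus> \<one> \<in> P i" for i by (simp add: a_minus_def r_neg P_zero)
  show "dia \<one> d0 \<in> congr_Borel (j - 1)" using d0 one by (intro gen_congr_Borel) auto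
  show "act swp x \<in> V" using xV by (simp add: act_closed)
  have "act (dia \<one> d0) (act swp x) = act swp (act (dia d0 \<one>) x)"
    using swp_gen(3)[of d0 \<one>] act_mult[of swp "dia d0 \<one>" x] act_mult[of "dia \<one> d0" swp x] d0 xV by simp
  also have "act (dia d0 \<one>) x = x" using x d0 one chi_one by (simp add: in_X_iff)
  finally show "act (dia \<one> d0) (act swp x) = 1 *s act swp x" by simp
  show "1 \<noteq> (\<chi> \<circ> e22) (dia \<one> d0)" using d0 by (simp add: dia_def)
qed

text \<open>Moving an eigenvector of \<open>low ` P i\<close> by \<open>uni y\<close>, with \<open>y\<close> of valuation \<open>j - 1 - i\<close>, changes its
  character by an arbitrary one that is trivial on \<open>P (Suc i)\<close>, so the character can be made trivial.\<close>

lemma unequal_low_fixed: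
  assumes X: "X \<noteq> {0}" and d0: "d0 \<in> Units R" "d0 \<ominus> \<one> \<in> P (j - 1)" "\<chi> d0 \<noteq> 1"
    and i: "i \<le> j" "1 \<le> i"
  shows "\<exists>x\<in>X. x \<noteq> 0 \<and> (\<forall>c\<in>P i. act (low c) x = x)"
  using i
\<comment> \<open>The level is lowered one step at a time, starting from \<open>P j\<close>, whose
  lower unipotent matrices fix all of \<open>V\<close>.\<close>
proof (induction i rule: inc_induct)
  case base
  then show ?case using X subspace_0[OF X_subspace] triv X_V by (fastforce simp: fixed_def)
next
  case (step i)
  have ij: "1 \<le> i" "i < j" using step by auto
  then have j2: "2 \<le> j" by simp
  define Y where "Y = X \<inter> eigenspace (low ` P (Suc i)) (\<lambda>_. 1)"
  have YX: "Y \<subseteq> X" "Y \<subseteq> V" using X_V by (auto simp: Y_def)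
  have Yfix: "act (low c) y = y" if "y \<in> Y" "c \<in> P (Suc i)" for y c
    using that by (auto simp: Y_def eigenspace_def)
  have "invariant (low ` P i) Y"
    unfolding invariant_def
  proof (intro conjI ballI YX(2))
    show "subspace Y" unfolding Y_def
      by (intro subspace_inter X_subspace eigenspace_subspace) (auto simp: P_closed)
    fix a y assume a: "a \<in> low ` P i" and y: "y \<in> Y"
    obtain c where c: "c \<in> P i" "a = low c" using a by blast
    have cP: "c \<in> P 1" using P_mono[OF ij(1) c(1)] .
    have "act (low c') (act (low c) y) = act (low c) y" if c': "c' \<in> P (Suc i)" for c'
    proof -
      have m: "c \<in> carrier R" "c' \<in> carrier R" "y \<in> V" using c c' P_closed y YX by auto
      have "act (low c') (act (low c) y) = act (low c) (act (low c') y)"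
        using act_mult[of "low c'" "low c" y] act_mult[of "low c" "low c'" y] m by (simp add: low_mult a_comm)
      then show ?thesis using Yfix[OF y c'] by simp
    qed
    moreover have "act (low c) y \<in> X" using X_low[OF _ cP] y YX by blast
    ultimately show "act a y \<in> Y" using X_V by (auto simp: Y_def eigenspace_def c(2))
  qed
  moreover have "Y \<noteq> {0}"
  proof -
    obtain x where "x \<in> X" "x \<noteq> 0" "\<forall>c\<in>P (Suc i). act (low c) x = x" using step by auto
    then have "x \<in> Y" using X_V by (auto simp: Y_def eigenspace_def)
    then show ?thesis using \<open>x \<noteq> 0\<close> by blast
  qed
  ultimately obtain x \<nu> where x: "x \<in> Y" "x \<noteq> 0" "\<And>c. c \<in> P i \<Longrightarrow> act (low c) x = \<nu> (low c) *s x"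
      "additive_char R (P i) (\<lambda>c. \<nu> (low c))"
    using low_eigenvector[OF ij(1)] by metis
  have xX: "x \<in> X" "x \<in> V" using x YX by auto
  define q where "q = p [^] (j - 1)"
  have [simp]: "q \<in> carrier R" by (simp add: q_def)
  define n where "n r = \<nu> (low (p [^] i \<otimes> r))" for r
  have pi: "p [^] i \<otimes> r \<in> P i" if "r \<in> carrier R" for r using that by (auto simp: P_def)
  have nchar: "additive_char R (carrier R) n"
    using x(4) pi unfolding additive_char_def n_def by (auto simp: r_distr)
  note chichar = additive_char_chi[OF X j2, folded q_def]
  \<comment> \<open>The kernel condition of duality holds because a unit \<open>a\<close> would
    reach \<open>d0\<close> in the form \<open>\<one> \<oplus> q \<otimes> (r \<otimes> a)\<close>,
    while for a nonunit \<open>a\<close> the element \<open>p [^] i \<otimes> a\<close> lies in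
    \<open>P (Suc i)\<close>, whose lower unipotent matrices fix \<open>x\<close>.\<close>
  have "\<exists>t\<in>carrier R. \<forall>a\<in>carrier R. n a = \<chi> (\<one> \<oplus> q \<otimes> (t \<otimes> a))"
  proof (rule additive_char_dual[OF finite_carrier chichar nchar])
    fix a assume a: "a \<in> carrier R" and ker: "\<forall>r\<in>carrier R. \<chi> (\<one> \<oplus> q \<otimes> (r \<otimes> a)) = 1"
    have "a \<notin> Units R"
    proof
      assume aU: "a \<in> Units R"
      obtain r0 where r0: "r0 \<in> carrier R" "d0 \<ominus> \<one> = q \<otimes> r0" using d0 by (auto simp: P_def q_def)
      have "\<one> \<oplus> q \<otimes> (r0 \<otimes> inv a \<otimes> a) = \<one> \<oplus> (d0 \<ominus> \<one>)" using aU r0 by (simp add: m_assoc)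
      also have "\<dots> = d0"
      proof -
        have [simp]: "d0 \<in> carrier R" using d0 by simp
        show ?thesis by (rule is_diff_eqI, (rule is_diff_intros | simp add: diff_simps)+)
      qed
      finally show False using ker[rule_format, of "r0 \<otimes> inv a"] d0 r0 aU by simp
    qed
    then have "a \<in> P 1" using a unit_iff by blast
    then have "p [^] i \<otimes> a \<in> P (Suc i)" using P_mult[OF p_pow_in_P[of i]] by fastforce
    then have "n a *s x = x" using Yfix[OF x(1)] x(3)[OF pi[OF a]] by (simp add: n_def)
    then show "n a = 1" using eq_scale_zero[of x "n a"] x(2) by metis
  qed
  then obtain t where t: "t \<in> carrier R" "\<And>a. a \<in> carrier R \<Longrightarrow> n a = \<chi> (\<one> \<oplus> q \<otimes> (t \<otimes> a))" by blast
  \<comment> \<open>The exponent makes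
    \<open>y \<otimes> z = \<ominus> (q \<otimes> (t \<otimes> r))\<close> for
    \<open>z = p [^] i \<otimes> r\<close>, so the torus factor
    \<open>\<one> \<oplus> y \<otimes> z\<close> arising from the commutation contributes the
    inverse of \<open>n r\<close>.\<close>
  define y where "y = \<ominus> (t \<otimes> p [^] (j - 1 - i))"
  have [simp]: "y \<in> carrier R" using t by (simp add: y_def)
  have "act (low z) (act (uni y) x) = act (uni y) x" if zP: "z \<in> P i" for z
  proof -
    obtain r where r: "r \<in> carrier R" "z = p [^] i \<otimes> r" using zP by (auto simp: P_def)
    have [simp]: "z \<in> carrier R" "r \<in> carrier R" "t \<in> carrier R" using r t by auto
    have "y \<otimes> z = \<ominus> (p [^] (j - 1 - i) \<otimes> p [^] i \<otimes> (t \<otimes> r))"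
    proof -
      have "\<ominus> (t \<otimes> b) \<otimes> (c \<otimes> r) = \<ominus> (b \<otimes> c \<otimes> (t \<otimes> r))" if [simp]: "b \<in> carrier R" "c \<in> carrier R" for b c
        by (rule is_diff_eqI, (rule is_diff_intros | simp add: diff_simps)+)
      then show ?thesis unfolding y_def r(2) by simp
    qed
    also have "p [^] (j - 1 - i) \<otimes> p [^] i = q" unfolding nat_pow_mult[OF p_closed] q_def using ij by simp
    finally have yz: "y \<otimes> z = \<ominus> (q \<otimes> (t \<otimes> r))" .
    have qP: "q \<otimes> s \<in> P (j - 1)" if "s \<in> carrier R" for s using that by (auto simp: q_def P_def)
    have yzP: "y \<otimes> z \<in> P (j - 1)" unfolding yz by (intro P_neg qP) simp
    have U: "\<one> \<oplus> y \<otimes> z \<in> Units R" by (rule one_add_P1[OF yzP]) (use j2 in simp)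
    define e where "e = inv (\<one> \<oplus> y \<otimes> z)"
    have eU: "e \<in> Units R" and [simp]: "e \<in> carrier R" using U by (auto simp: e_def)
    have u1: "\<one> \<oplus> y \<otimes> z \<ominus> \<one> = y \<otimes> z" by (rule is_diff_eqI, (rule is_diff_intros | simp add: diff_simps)+)
    have e1: "e \<ominus> \<one> \<in> P (j - 1)" unfolding e_def by (intro one_minus_inv U) (simp only: u1 yzP)
    have "act (low z) (act (uni y) x) = act (uni (y \<otimes> e)) (act (dia e (\<one> \<oplus> y \<otimes> z)) (act (low (z \<otimes> e)) x))"
      using act_mult[of "low z" "uni y" x] xX U eU
      by (simp add: low_uni(1)[OF _ _ U, folded e_def]) (simp add: act_mult act_closed)
    also have "act (low (z \<otimes> e)) x = n (r \<otimes> e) *s x"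
      using x(3)[OF P_rmult[OF \<open>e \<in> carrier R\<close> zP]] by (simp add: n_def r(2) m_assoc)
    \<comment> \<open>The unit \<open>e\<close> differs from one by an element of
      \<open>P (j - 1)\<close>, and the factor \<open>q\<close> pushes the difference into
      \<open>P j\<close>, so the value of \<open>\<chi>\<close> is unchanged.\<close>
    also have "n (r \<otimes> e) = \<chi> (\<one> \<oplus> q \<otimes> (t \<otimes> r))"
    proof -
      have "q \<otimes> (t \<otimes> (r \<otimes> e)) = q \<otimes> (t \<otimes> r \<otimes> e)" by (simp add: m_assoc)
      have "\<chi> (\<one> \<oplus> q \<otimes> (t \<otimes> (r \<otimes> e))) = \<chi> (\<one> \<oplus> q \<otimes> (t \<otimes> r))"
      proof (rule chi_cong[OF X])
        have "\<one> \<oplus> q \<otimes> (t \<otimes> (r \<otimes> e)) \<ominus> (\<one> \<oplus> q \<otimes> (t \<otimes> r)) = t \<otimes> r \<otimes> (q \<otimes> (e \<ominus> \<one>))"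
          by (rule is_diff_eqI, (rule is_diff_intros | simp add: diff_simps)+)
        moreover have "q \<otimes> (e \<ominus> \<one>) \<in> P j"
          using P_mono[OF _ P_mult[OF p_pow_in_P e1], of j "j - 1"] j2 by (simp add: q_def)
        ultimately show "\<one> \<oplus> q \<otimes> (t \<otimes> (r \<otimes> e)) \<ominus> (\<one> \<oplus> q \<otimes> (t \<otimes> r)) \<in> P j" by (simp add: P_lmult)
      qed (rule one_add_P1[OF qP]; use j2 in simp)+
      then show ?thesis using t(2)[of "r \<otimes> e"] by simp
    qed
    also have "act (dia e (\<one> \<oplus> y \<otimes> z)) (\<chi> (\<one> \<oplus> q \<otimes> (t \<otimes> r)) *s x)
        = (\<chi> (\<one> \<oplus> q \<otimes> (t \<otimes> r)) * \<chi> (\<one> \<oplus> y \<otimes> z)) *s x"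
    proof -
      have "act (dia e (\<one> \<oplus> y \<otimes> z)) x = \<chi> (\<one> \<oplus> y \<otimes> z) *s x"
        using xX(1) U eU e1 u1 yzP by (simp add: in_X_iff)
      then show ?thesis using xX U eU by (simp add: act_scale)
    qed
    \<comment> \<open>The product of the two arguments is one minus the square of
      \<open>q \<otimes> (t \<otimes> r)\<close>, which is one modulo \<open>P j\<close> since j is
      at least 2.\<close>
    also have "\<chi> (\<one> \<oplus> q \<otimes> (t \<otimes> r)) * \<chi> (\<one> \<oplus> y \<otimes> z) = 1"
    proof -
      have "q \<otimes> (t \<otimes> r) \<in> P (j - 1)" by (rule qP) simp
      then have U': "\<one> \<oplus> q \<otimes> (t \<otimes> r) \<in> Units R" by (rule one_add_P1) (use j2 in simp)
      have "(\<one> \<oplus> q \<otimes> (t \<otimes> r)) \<otimes> (\<one> \<oplus> y \<otimes> z) \<ominus> \<one> = \<ominus> (t \<otimes> r \<otimes> t \<otimes> r) \<otimes> (q \<otimes> q)"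
        unfolding yz by (rule is_diff_eqI, (rule is_diff_intros | simp add: diff_simps)+)
      moreover have "q \<otimes> q \<in> P j"
        using P_mono[OF _ P_mult[OF p_pow_in_P p_pow_in_P], of j "j - 1" "j - 1"] j2 by (simp add: q_def)
      ultimately have "(\<one> \<oplus> q \<otimes> (t \<otimes> r)) \<otimes> (\<one> \<oplus> y \<otimes> z) \<ominus> \<one> \<in> P j" by (simp add: P_lmult)
      then have "\<chi> ((\<one> \<oplus> q \<otimes> (t \<otimes> r)) \<otimes> (\<one> \<oplus> y \<otimes> z)) = 1"
        by (rule chi_one_plus_P[OF X, rotated]) (use U U' in simp)
      then show ?thesis using chi_mult[OF U' U] by simp
    qed
    also have "act (uni (y \<otimes> e)) (1 *s x) = act (uni y) x"
    proof -
      have "y \<otimes> e \<ominus> y = y \<otimes> (e \<ominus> \<one>)" by (rule is_diff_eqI, (rule is_diff_intros | simp add: diff_simps)+)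
      then have "act (uni (y \<otimes> e)) x = act (uni y) x"
        by (intro X_uni_shift[OF xX(1)]) (use P_lmult[OF _ e1, of y] in simp_all)
      then show ?thesis by simp
    qed
    finally show ?thesis .
  qed
  moreover have "act (uni y) x \<in> X" using X_uni[OF xX(1)] by simp
  moreover have "act (uni y) x \<noteq> 0" using act_eq_zero[of "uni y" x] xX x(2) by auto
  ultimately show ?case by blast
qed

text \<open>\<open>X\<close> is generated by one vector over the commutative group of upper unipotent matrices, so the
  eigenspaces of that group in \<open>X\<close> are lines.\<close>

lemma unequal_case:
  assumes d0: "d0 \<in> Units R" "d0 \<ominus> \<one> \<in> P (j - 1)" "\<chi> d0 \<noteq> 1"
  shows dependent_maps
proof (cases "X = {0}")
  case True
  then show ?thesis using maps_into_X(1)[OF w0(1)] dependent_at_zero[OF w0] by blast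
next
  case X: False
  define Y where "Y = X \<inter> eigenspace (low ` P 1) (\<lambda>_. 1)"
  have YX: "Y \<subseteq> X" "Y \<subseteq> V" using X_V by (auto simp: Y_def)
  have Yfix: "act (low c) y = y" if "y \<in> Y" "c \<in> P 1" for y c
    using that by (auto simp: Y_def eigenspace_def)
  define T where "T = (\<lambda>(a, d). dia a d) ` (Units R \<times> Units R)"
  have Tinv: "invariant T Y"
    unfolding invariant_def
  proof (intro conjI ballI YX(2))
    show "subspace Y" unfolding Y_def
      by (intro subspace_inter X_subspace eigenspace_subspace) (auto simp: P_closed)
    fix h y assume h: "h \<in> T" and y: "y \<in> Y"
    obtain a d where ad: "a \<in> Units R" "d \<in> Units R" "h = dia a d" using h by (auto simp: T_def)
    have yV: "y \<in> V" using y YX by blast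
    have "act (low c) (act (dia a d) y) = act (dia a d) y" if c: "c \<in> P 1" for c
    proof -
      have [simp]: "c \<in> carrier R" using c P_closed by blast
      have "dia a d \<otimes>\<^bsub>GL\<^esub> low (inv d \<otimes> c \<otimes> a) = low c \<otimes>\<^bsub>GL\<^esub> dia a d"
        using ad by (subst dia_low) (auto simp: m_assoc m_assoc[symmetric, of d])
      then have "act (low c) (act (dia a d) y) = act (dia a d) (act (low (inv d \<otimes> c \<otimes> a)) y)"
        using ad yV act_mult[of "low c" "dia a d" y] act_mult[of "dia a d" "low (inv d \<otimes> c \<otimes> a)" y] by simp
      also have "act (low (inv d \<otimes> c \<otimes> a)) y = y" using Yfix[OF y, of "inv d \<otimes> c \<otimes> a"] c ad by (simp add: P_lmult P_rmult)
      finally show ?thesis .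
    qed
    moreover have "act (dia a d) y \<in> X" using X_dia y YX ad by blast
    ultimately show "act h y \<in> Y" using X_V by (auto simp: Y_def eigenspace_def ad(3))
  qed
  have "Y \<noteq> {0}"
  proof -
    obtain x where "x \<in> X" "x \<noteq> 0" "\<forall>c\<in>P 1. act (low c) x = x" using unequal_low_fixed[OF X d0 j] by auto
    then have "x \<in> Y" using X_V by (auto simp: Y_def eigenspace_def)
    then show ?thesis using \<open>x \<noteq> 0\<close> by blast
  qed
  have TG: "T \<subseteq> carrier GL" and Tfin: "finite T" using finite_Units by (auto simp: T_def)
  have Tcomm: "a \<otimes>\<^bsub>GL\<^esub> b = b \<otimes>\<^bsub>GL\<^esub> a" if "a \<in> T" "b \<in> T" for a b
    using that by (auto simp: T_def dia_mult m_comm)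
  obtain v0 \<kappa> where v0: "v0 \<in> Y" "v0 \<noteq> 0" "\<And>h. h \<in> T \<Longrightarrow> act h v0 = \<kappa> h *s v0"
    using common_eigenvector[OF Tfin TG Tcomm Tinv \<open>Y \<noteq> {0}\<close>] by metis
  have v0X: "v0 \<in> X" "v0 \<in> V" using v0 YX by auto
  have "X \<subseteq> span (orbit (congr_lower 1) v0)"
    using X_generated_if_zero[OF unequal_swp_zero[OF d0] v0X(1) v0(2)] .
  \<comment> \<open>In the factorisation \<open>uni x \<otimes> dia a d \<otimes> low c\<close> the
    last factor fixes \<open>v0\<close> and the middle one acts on it by a scalar, so only the upper
    unipotent factor moves the line of \<open>v0\<close>.\<close>
  also have "\<dots> \<subseteq> span (orbit (uni ` carrier R) v0)"
  proof (rule span_minimal[OF _ subspace_span], rule subsetI)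
    fix y assume "y \<in> orbit (congr_lower 1) v0"
    then obtain h where h: "h \<in> congr_lower 1" "y = act h v0" by (auto simp: orbit_def)
    obtain x a d c where hd: "x \<in> carrier R" "a \<in> Units R" "d \<in> Units R" "c \<in> P 1"
      "h = uni x \<otimes>\<^bsub>GL\<^esub> dia a d \<otimes>\<^bsub>GL\<^esub> low c" using congr_lower_decomposition[OF h(1)] .
    have "y = act (uni x) (act (dia a d) (act (low c) v0))"
      unfolding h(2) hd(5) using hd P_closed[OF hd(4)] v0X by (simp add: act_mult act_closed)
    also have "\<dots> = \<kappa> (dia a d) *s act (uni x) v0"
    proof -
      have "dia a d \<in> T" unfolding T_def using hd by blast
      then show ?thesis using Yfix[OF v0(1) hd(4)] v0(3)[of "dia a d"] hd v0X by (simp add: act_scale)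
    qed
    finally show "y \<in> span (orbit (uni ` carrier R) v0)"
      using hd(1) by (simp add: orbit_def span_scale span_base)
  qed
  finally have gen: "X \<subseteq> span (orbit (uni ` carrier R) v0)" .
  obtain w \<psi> where w: "w \<in> W" "w \<noteq> 0" "\<And>x. x \<in> carrier R \<Longrightarrow> actB (uni x) w = \<psi> (uni x) *s w"
    using unipotent_eigenvector by blast
  show ?thesis
  proof (cases "f w = 0")
    case True
    then show ?thesis using dependent_at_zero w by blast
  next
    case False
    have fw: "act (uni x) (f w) = \<psi> (uni x) *s f w" "act (uni x) (g w) = \<psi> (uni x) *s g w" if "x \<in> carrier R" for x
      using that w f_equiv[of "uni x" w] g_equiv[of "uni x" w] by (simp_all add: lin_onD[OF f_lin] lin_onD[OF g_lin])
    have m: "f w \<in> X" "g w \<in> X" using maps_into_X w by auto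
    have "character (uni ` carrier R) \<psi>"
      by (rule eigen_character[OF uni_subgroup _ _ False]) (use finite_carrier fw m X_V in auto)
    moreover have "f w \<in> eigenspace (uni ` carrier R) \<psi>" "g w \<in> eigenspace (uni ` carrier R) \<psi>"
      using fw m X_V by (auto simp: eigenspace_def)
    ultimately have "f w \<in> span {proj (uni ` carrier R) \<psi> v0}" "g w \<in> span {proj (uni ` carrier R) \<psi> v0}"
      using cyclic_eigenspace[OF _ v0X(2)] gen m by blast+
    then show ?thesis using dependent_at_span[OF w(1,2)] by blast
  qed
qed

end

section \<open>The case where \<chi> is trivial on units close to one\<close>

lemma (in lin_rep) linear_swap:
  "g \<in> carrier G \<Longrightarrow> lin_on V L \<Longrightarrow> (\<And>v. v \<in> V \<Longrightarrow> L v \<in> V) \<Longrightarrow> lin_on V (\<lambda>v. L (act g v))"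
  unfolding lin_on_def by (simp add: act_add act_scale act_closed)

context borel_pair_level
begin

lemma e\<^sub>X_big_cell:
  assumes h: "h \<in> carrier GL" "h \<notin> congr_lower 1" and y: "y \<in> X"
    and fix_y: "\<And>k. k \<in> congr_lower 1 \<Longrightarrow> act k y = y"
  obtains z where "z \<in> carrier R" "e\<^sub>X (act h y) = act (uni z) (e\<^sub>X (act swp y))"
proof -
  obtain z k where k: "z \<in> carrier R" "k \<in> congr_lower 1" "h = uni z \<otimes>\<^bsub>GL\<^esub> (swp \<otimes>\<^bsub>GL\<^esub> k)"
    using bruhat_decomposition[OF h] by metis
  have kG: "k \<in> carrier GL" using k(2) by (simp add: congr_lower_def)
  have yV: "y \<in> V" using y X_V by blast
  have "act h y = act (uni z) (act swp (act k y))" unfolding k(3) using k kG yV by (simp add: act_mult act_closed)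
  then have "e\<^sub>X (act h y) = act (uni z) (e\<^sub>X (act swp y))"
    using e\<^sub>X_uni[of z "act swp y"] fix_y[OF k(2)] k(1) yV by (simp add: act_closed)
  then show ?thesis using that k(1) by blast
qed

text \<open>At level one all of \<open>congr_lower 1\<close> fixes \<open>X\<close>. So if
  \<open>z\<close> is an eigenvector of the Hecke operator, its translates from either Bruhat cell
  project to multiples of \<open>z\<close>; since they span \<open>V\<close>, the space
  \<open>X\<close> is the line of \<open>z\<close>.\<close>

lemma equal_case_level_one:
  assumes j1: "j = 1" and \<chi>1: "\<And>d. d \<in> Units R \<Longrightarrow> \<chi> d = 1"
  shows dependent_maps
proof (cases "X = {0}")
  case True
  then show ?thesis using maps_into_X(1)[OF w0(1)] dependent_at_zero[OF w0] by blast
next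
  case False
  have fix_I: "act k x = x" if x: "x \<in> X" and k: "k \<in> congr_lower 1" for k x
  proof -
    obtain y a d c where kd: "y \<in> carrier R" "a \<in> Units R" "d \<in> Units R" "c \<in> P 1"
      "k = uni y \<otimes>\<^bsub>GL\<^esub> dia a d \<otimes>\<^bsub>GL\<^esub> low c" using congr_lower_decomposition[OF k] .
    have xV: "x \<in> V" using x X_V by blast
    have "act k x = act (uni y) (act (dia a d) (act (low c) x))"
      unfolding kd(5) using kd P_closed[OF kd(4)] xV by (simp add: act_mult act_closed)
    also have "act (low c) x = x" using triv[OF xV] kd(4) by (simp add: fixed_def j1)
    also have "act (dia a d) x = x" using x[unfolded in_X_iff] kd \<chi>1 by (simp add: j1 P_0)
    also have "act (uni y) x = x" using x[unfolded in_X_iff] kd by (simp add: j1 P_0)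
    finally show ?thesis .
  qed
  obtain B where B: "finite B" "V \<subseteq> span B" using fin_dim by blast
  obtain x0 where x0: "x0 \<in> X" "x0 \<noteq> 0" using False subspace_0[OF X_subspace] by blast
  have lin: "lin_on V (\<lambda>v. e\<^sub>X (act swp v))" by (rule linear_swap[OF _ lin_e\<^sub>X]) (use e\<^sub>X_in X_V in auto)
  have "\<exists>z\<in>X. z \<noteq> 0 \<and> (\<exists>c. e\<^sub>X (act swp z) = c *s z)"
  proof (rule eigenvector_exists[OF lin_on_mono[OF lin X_V] X_subspace _ B(1) _ x0])
    show "(\<lambda>v. e\<^sub>X (act swp v)) ` X \<subseteq> X" using e\<^sub>X_in X_V by (auto simp: act_closed subset_iff)
  qed (use B X_V in auto)
  then obtain z c where z: "z \<in> X" "z \<noteq> 0" "e\<^sub>X (act swp z) = c *s z" by blast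
  have zV: "z \<in> V" using z X_V by blast
  have "x \<in> span {z}" if x: "x \<in> X" for x
  proof -
    have o: "orbit (carrier GL) z \<subseteq> V" using zV by (auto simp: orbit_def act_closed)
    have e: "e\<^sub>X y \<in> span {z}" if "y \<in> orbit (carrier GL) z" for y
    proof -
      obtain h where h: "h \<in> carrier GL" "y = act h z" using \<open>y \<in> _\<close> by (auto simp: orbit_def)
      show ?thesis
      proof (cases "h \<in> congr_lower 1")
        case True
        then have "y = z" using h fix_I[OF z(1)] by blast
        then show ?thesis using e\<^sub>X_id[OF z(1)] by (simp add: span_base)
      next
        case False
        obtain t where t: "t \<in> carrier R" "e\<^sub>X y = act (uni t) (e\<^sub>X (act swp z))"
          using e\<^sub>X_big_cell[OF h(1) False z(1) fix_I[OF z(1)]] h(2) by metis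
        have "uni t \<in> congr_lower 1" using t Borel_congr_lower upper_gen_Borel(1) by blast
        then have "act (uni t) (e\<^sub>X (act swp z)) = e\<^sub>X (act swp z)"
          by (rule fix_I[rotated]) (use e\<^sub>X_in zV in \<open>simp add: act_closed\<close>)
        then show ?thesis using t(2) z(3) by (simp add: span_base span_scale)
      qed
    qed
    have xs: "x \<in> span (orbit (carrier GL) z)" using irreducible_span_orbit[OF irrV zV z(2)] x X_V by auto
    have "e\<^sub>X x \<in> span {z}" by (rule lin_on_span[OF lin_e\<^sub>X sub o subspace_span e xs])
    then show ?thesis using e\<^sub>X_id[OF x] by simp
  qed
  then show ?thesis using dependent_at_span[OF w0, of z] maps_into_X[OF w0(1)] by blast
qed

text \<open>The vectors fixed by the congruence subgroup of level \<open>j - 1\<close> form a \<open>GL\<^sub>2\<close>-invariant subspace.\<close>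

lemma equal_case_fixed:
  assumes j2: "2 \<le> j" and \<chi>1: "\<And>d. d \<in> Units R \<Longrightarrow> d \<ominus> \<one> \<in> P (j - 1) \<Longrightarrow> \<chi> d = 1"
    and x: "x \<in> X" "x \<noteq> 0" "\<And>c. c \<in> P (j - 1) \<Longrightarrow> act (low c) x = x" and v: "v \<in> V"
  shows "fixed (j - 1) (j - 1) v"
proof -
  \<comment> \<open>Given \<open>\<chi>1\<close>, these are the vectors fixed by the principal
    congruence subgroup of level \<open>j - 1\<close>. Their stability reflects the normality of
    that subgroup and is verified for \<open>uni\<close>, \<open>dia\<close> and \<open>swp\<close>,
    from which everything else is composed.\<close>
  define S where "S = {v \<in> X. \<forall>c\<in>P (j - 1). act (low c) v = v}"
  have SV: "S \<subseteq> V" using X_V by (auto simp: S_def)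
  have S_iff: "v \<in> S \<longleftrightarrow> v \<in> V \<and> fixed (j - 1) (j - 1) v" for v
    using \<chi>1 by (auto simp: S_def in_X_iff fixed_def)
  have Ssub: "subspace S"
    using X_subspace X_V unfolding subspace_def S_def by (auto simp: act_zero act_add act_scale P_closed subset_iff)
  have j1: "1 \<le> j - 1" using j2 by simp
  have S_uni: "act (uni y) s \<in> S" if s: "s \<in> S" and y: "y \<in> carrier R" for s y
  proof -
    have sX: "s \<in> X" "s \<in> V" using s SV by (auto simp: S_def)
    have "act (low c) (act (uni y) s) = act (uni y) s" if c: "c \<in> P (j - 1)" for c
    proof -
      have [simp]: "c \<in> carrier R" "y \<in> carrier R" using c P_closed y by auto
      have yc: "y \<otimes> c \<in> P (j - 1)" using c by (simp add: P_lmult)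
      have U: "\<one> \<oplus> y \<otimes> c \<in> Units R" using one_add_P1[OF yc j1] .
      define e where "e = inv (\<one> \<oplus> y \<otimes> c)"
      have eU: "e \<in> Units R" and [simp]: "e \<in> carrier R" using U by (auto simp: e_def)
      have u1: "\<one> \<oplus> y \<otimes> c \<ominus> \<one> = y \<otimes> c" by (rule is_diff_eqI, (rule is_diff_intros | simp add: diff_simps)+)
      have e1: "e \<ominus> \<one> \<in> P (j - 1)" unfolding e_def by (intro one_minus_inv U) (simp only: u1 yc)
      have "act (low c) (act (uni y) s) = act (uni (y \<otimes> e)) (act (dia e (\<one> \<oplus> y \<otimes> c)) (act (low (c \<otimes> e)) s))"
        using act_mult[of "low c" "uni y" s] sX U eU
        by (simp add: low_uni(1)[OF _ _ U, folded e_def]) (simp add: act_mult act_closed)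
      also have "act (low (c \<otimes> e)) s = s" using s c by (simp add: S_def P_rmult)
      also have "act (dia e (\<one> \<oplus> y \<otimes> c)) s = s" using s U eU e1 u1 yc by (simp add: S_iff fixed_def)
      also have "act (uni (y \<otimes> e)) s = act (uni y) s"
      proof -
        have "y \<otimes> e \<ominus> y = y \<otimes> (e \<ominus> \<one>)" by (rule is_diff_eqI, (rule is_diff_intros | simp add: diff_simps)+)
        then show ?thesis by (intro X_uni_shift[OF sX(1)]) (use P_lmult[OF _ e1, of y] in simp_all)
      qed
      finally show ?thesis .
    qed
    then show ?thesis using X_uni[OF sX(1) y] by (simp add: S_def)
  qed
  have S_dia: "act (dia a d) s \<in> S" if s: "s \<in> S" and ad: "a \<in> Units R" "d \<in> Units R" for s a d
  proof -
    have sX: "s \<in> X" "s \<in> V" using s SV by (auto simp: S_def)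
    have "act (low c) (act (dia a d) s) = act (dia a d) s" if c: "c \<in> P (j - 1)" for c
    proof -
      have [simp]: "c \<in> carrier R" using c P_closed by blast
      have "dia a d \<otimes>\<^bsub>GL\<^esub> low (inv d \<otimes> c \<otimes> a) = low c \<otimes>\<^bsub>GL\<^esub> dia a d"
        using ad by (subst dia_low) (auto simp: m_assoc m_assoc[symmetric, of d])
      then have "act (low c) (act (dia a d) s) = act (dia a d) (act (low (inv d \<otimes> c \<otimes> a)) s)"
        using ad sX act_mult[of "low c" "dia a d" s] act_mult[of "dia a d" "low (inv d \<otimes> c \<otimes> a)" s] by simp
      also have "act (low (inv d \<otimes> c \<otimes> a)) s = s" using s c ad by (simp add: S_def P_lmult P_rmult)
      finally show ?thesis .
    qed
    then show ?thesis using X_dia[OF sX(1) ad] by (simp add: S_def)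
  qed
  have S_swp: "act swp s \<in> S" if s: "s \<in> S" for s
  proof -
    have sV: "s \<in> V" "fixed (j - 1) (j - 1) s" using s by (auto simp: S_iff)
    have "act (uni y) (act swp s) = act swp s" "act (low y) (act swp s) = act swp s" if y: "y \<in> P (j - 1)" for y
      using swp_gen(1,2)[of y] act_mult[of "uni y" swp s] act_mult[of "low y" swp s]
        act_mult[of swp "uni y" s] act_mult[of swp "low y" s] sV y P_closed[OF y] by (simp_all add: fixed_def)
    moreover have "act (dia a d) (act swp s) = act swp s"
      if "a \<in> Units R" "d \<in> Units R" "a \<ominus> \<one> \<in> P (j - 1)" "d \<ominus> \<one> \<in> P (j - 1)" for a d
      using swp_gen(3)[of d a] act_mult[of "dia a d" swp s] act_mult[of swp "dia d a" s] sV that by (simp add: fixed_def)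
    ultimately show ?thesis using sV by (simp add: S_iff fixed_def act_closed)
  qed
  have S_low: "act (low c) s \<in> S" if s: "s \<in> S" and c: "c \<in> carrier R" for s c
  proof -
    have "act (low c) s = act swp (act (uni c) (act swp s))"
    proof -
      have "low c = swp \<otimes>\<^bsub>GL\<^esub> (uni c \<otimes>\<^bsub>GL\<^esub> swp)"
        using c by (simp add: GL.m_assoc[symmetric] swp_gen) (simp add: GL.m_assoc swp_swp)
      then show ?thesis using s SV c by (auto simp: act_mult act_closed)
    qed
    then show ?thesis using S_swp S_uni s c by simp
  qed
  have S_I: "act h s \<in> S" if h: "h \<in> congr_lower 1" and s: "s \<in> S" for h s
  proof -
    obtain y a d c where hd: "y \<in> carrier R" "a \<in> Units R" "d \<in> Units R" "c \<in> P 1"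
      "h = uni y \<otimes>\<^bsub>GL\<^esub> dia a d \<otimes>\<^bsub>GL\<^esub> low c" using congr_lower_decomposition[OF h] .
    have "act h s = act (uni y) (act (dia a d) (act (low c) s))"
      unfolding hd(5) using hd P_closed[OF hd(4)] s SV by (auto simp: act_mult act_closed)
    then show ?thesis using S_uni S_dia S_low hd P_closed[OF hd(4)] s by simp
  qed
  have "act h s \<in> S" if h: "h \<in> carrier GL" and s: "s \<in> S" for h s
  proof (cases "h \<in> congr_lower 1")
    case False
    obtain z k where k: "z \<in> carrier R" "k \<in> congr_lower 1" "h = uni z \<otimes>\<^bsub>GL\<^esub> (swp \<otimes>\<^bsub>GL\<^esub> k)"
      using bruhat_decomposition[OF h False] by metis
    have "k \<in> carrier GL" using k(2) by (simp add: congr_lower_def)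
    then have "act h s = act (uni z) (act swp (act k s))"
      unfolding k(3) using k s SV by (auto simp: act_mult act_closed)
    then show ?thesis using S_uni S_swp S_I k s by simp
  qed (use S_I s in blast)
  then have "invariant (carrier GL) S" using Ssub SV by (auto simp: invariant_def)
  moreover have "x \<in> S" using x by (simp add: S_def)
  ultimately have "S = V" using irrV x(2) unfolding irreducible_def by blast
  then show ?thesis using v S_iff by blast
qed

text \<open>All characters of \<open>low ` P 1\<close> in \<open>X\<close> are conjugate under the diagonal torus, by
  duality on the ring. Hence a torus eigenvector of \<open>X\<close> vanishes as soon as its projection to one of
  their eigenspaces does, and these eigenspaces are lines.\<close>

lemma equal_case_generic:
  assumes j2: "2 \<le> j" and \<chi>1: "\<And>d. d \<in> Units R \<Longrightarrow> d \<ominus> \<one> \<in> P (j - 1) \<Longrightarrow> \<chi> d = 1"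
    and nofix: "\<And>x. x \<in> X \<Longrightarrow> (\<forall>c\<in>P (j - 1). act (low c) x = x) \<Longrightarrow> x = 0"
  shows dependent_maps
proof (cases "f w0 = 0")
  case True
  then show ?thesis using dependent_at_zero[OF w0] by blast
next
  case f0: False
  have j1: "1 \<le> j - 1" using j2 by simp
  \<comment> \<open>The swap turns \<open>low c\<close> into \<open>uni c\<close>, which
    \<open>e\<^sub>X\<close> absorbs for \<open>c\<close> in \<open>P (j - 1)\<close>. So the
    operator takes the same value on \<open>x\<close> and on the average of \<open>x\<close> over
    that layer, and the average is zero by \<open>nofix\<close>.\<close>
  have Z: "e\<^sub>X (act swp x) = 0" if x: "x \<in> X" for x
  proof -
    define L where "L v = e\<^sub>X (act swp v)" for v
    have L: "lin_on V L" unfolding L_def by (rule linear_swap[OF _ lin_e\<^sub>X]) (use e\<^sub>X_in X_V in auto)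
    let ?N = "low ` P (j - 1)"
    define m where "m = proj ?N (\<lambda>_. 1) x"
    have xV: "x \<in> V" using x X_V by blast
    have NG: "?N \<subseteq> carrier GL" using P_closed by auto
    have ch: "character ?N (\<lambda>_. 1)" unfolding character_def using low_subgroup finite_P by auto
    have "m \<in> X" unfolding m_def by (rule proj_in_invariant[OF low_P_invariant[OF j1] x])
    moreover have "act (low c) m = m" if "c \<in> P (j - 1)" for c
      unfolding m_def using act_proj[OF ch _ xV, of "low c"] that by simp
    ultimately have "m = 0" using nofix by blast
    moreover have "L m = L x"
      unfolding m_def
    proof (rule proj_one_invariant[OF NG _ _ L xV])
      fix a assume "a \<in> ?N"
      then obtain c where c: "c \<in> P (j - 1)" "a = low c" by blast
      have "act swp (act (low c) x) = act (uni c) (act swp x)"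
        using swp_gen(2)[of c] act_mult[of swp "low c" x] act_mult[of "uni c" swp x] P_closed[OF c(1)] xV by simp
      then have "L (act a x) = e\<^sub>X (act (uni c) (act swp x))" by (simp add: L_def c(2))
      also have "\<dots> = (\<chi> \<circ> e22) (uni c) *s e\<^sub>X (act swp x)"
        by (rule proj_act[OF char_X gen_congr_Borel(1)[OF c(1)]]) (use xV in \<open>simp add: act_closed\<close>)
      finally show "L (act a x) = L x" using chi_one by (simp add: L_def uni_def)
    qed (use finite_P P_zero in auto)
    ultimately have "L x = 0" using lin_on_zero[OF L sub] by simp
    then show ?thesis by (simp add: L_def)
  qed
  have fgX: "f w0 \<in> X" "g w0 \<in> X" using maps_into_X w0 by auto
  then have X0: "X \<noteq> {0}" using f0 by blast
  obtain y \<nu> where y: "y \<in> X" "y \<noteq> 0" "\<And>c. c \<in> P 1 \<Longrightarrow> act (low c) y = \<nu> (low c) *s y"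
      "additive_char R (P 1) (\<lambda>c. \<nu> (low c))"
    using low_eigenvector[OF order_refl low_P_invariant[OF order_refl] X0] by metis
  \<comment> \<open>Together with \<open>trivial\<close> below: the characters of the lower
    unipotent matrices that occur in \<open>X\<close> live exactly at level \<open>j\<close>,
    nontrivial on \<open>P (j - 1)\<close> and trivial on \<open>P j\<close>. Comparing two of them
    requires both bounds.\<close>
  have generic: "\<exists>c\<in>P (j - 1). \<mu> (low c) \<noteq> 1"
    if "y \<in> X" "y \<noteq> 0" "\<And>c. c \<in> P 1 \<Longrightarrow> act (low c) y = \<mu> (low c) *s y" for y \<mu>
  proof (rule ccontr)
    assume "\<not> ?thesis"
    then have "\<forall>c\<in>P (j - 1). act (low c) y = y" using that(3) P_mono[OF j1] by auto
    then show False using nofix that by blast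
  qed
  have trivial: "\<mu> (low c) = 1"
    if "y \<in> X" "y \<noteq> 0" "\<And>c. c \<in> P 1 \<Longrightarrow> act (low c) y = \<mu> (low c) *s y" "c \<in> P j" for y \<mu> c
  proof -
    have "act (low c) y = y" using triv[of y] X_V that by (auto simp: fixed_def)
    then have "y = \<mu> (low c) *s y" using that(3)[OF P_mono[OF j that(4)]] by simp
    then show ?thesis using eq_scale_zero that(2) by blast
  qed
  define \<phi> where "\<phi> c = \<nu> (low c)" for c
  have \<phi>: "additive_char R (P 1) \<phi>" using y(4) by (simp add: \<phi>_def additive_char_def)
  obtain c0 where c0: "c0 \<in> P (j - 1)" "\<phi> c0 \<noteq> 1" using generic[OF y(1-3)] by (auto simp: \<phi>_def)
  have Xfix: "fixed (j - 1) j x" if "x \<in> X" for x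
    using that \<chi>1 triv[of x] X_V by (auto simp: in_X_iff fixed_def)
  let ?N = "low ` P 1"
  obtain z where z: "X \<inter> eigenspace ?N (\<phi> \<circ> e21) \<subseteq> span {z}"
    using generic_multiplicity_one[OF _ X_invariant Xfix \<phi> c0 X_generated_if_zero[OF Z]] j2 by auto
  have chN: "character ?N (\<phi> \<circ> e21)" using char_low[OF \<phi>] .
  let ?e = "proj ?N (\<phi> \<circ> e21)"
  have e_span: "?e x \<in> span {z}" if "x \<in> X" for x
    using z proj_in_invariant[OF low_P_invariant[OF order_refl] that] proj_in_eigenspace[OF chN] that X_V by blast
  \<comment> \<open>The combination is at first made to vanish only in its
    \<open>\<phi>\<close>-part; conjugation by the torus then spreads this to all other
    characters.\<close>
  obtain a b where ab: "a \<noteq> 0 \<or> b \<noteq> 0" "a *s ?e (f w0) + b *s ?e (g w0) = 0"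
    using dependent_pair[OF e_span[OF fgX(1)] e_span[OF fgX(2)]] by blast
  define v where "v = a *s f w0 + b *s g w0"
  have vX: "v \<in> X" unfolding v_def using fgX by (intro subspace_add[OF X_subspace] subspace_scale[OF X_subspace])
  have vV: "v \<in> V" using vX X_V by blast
  have ev: "?e v = 0"
    unfolding v_def using ab(2) fgX X_V lin_onD[OF lin_proj[OF characterD(2)[OF chN]]] subspace_scale[OF sub] w0_fg(1,2)
    by (auto simp: subset_iff)
  \<comment> \<open>Here the twist pays off: the first diagonal entry acts trivially on the images
    of \<open>w0\<close>, so the torus elements that permute the characters fix
    \<open>v\<close>.\<close>
  have vT: "act (dia t \<one>) v = v" if "t \<in> Units R" for t
    unfolding v_def using that w0_fg chi_one by (simp add: act_add act_scale subspace_scale[OF sub])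
  have "v = 0"
  proof (rule ccontr)
    assume v0: "v \<noteq> 0"
    have "invariant ?N (span (orbit ?N v))" by (rule span_orbit_invariant[OF low_subgroup vV])
    moreover have "span (orbit ?N v) \<noteq> {0}" using mem_span_orbit[OF low_subgroup vV] v0 by blast
    ultimately obtain y' \<mu> where y': "y' \<in> span (orbit ?N v)" "y' \<noteq> 0" "\<And>c. c \<in> P 1 \<Longrightarrow> act (low c) y' = \<mu> (low c) *s y'"
      "additive_char R (P 1) (\<lambda>c. \<mu> (low c))"
      using low_eigenvector[OF order_refl] by metis
    have oX: "orbit ?N v \<subseteq> X" using X_low vX by (auto simp: orbit_def)
    have y'X: "y' \<in> X" using span_minimal[OF oX X_subspace] y'(1) by blast
    define \<psi> where "\<psi> c = \<mu> (low c)" for c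
    have \<psi>: "additive_char R (P 1) \<psi>" using y'(4) by (simp add: \<psi>_def additive_char_def)
    have p1: "p \<otimes> r \<in> P 1" if "r \<in> carrier R" for r using that by (auto simp: P_def)
    \<comment> \<open>Duality is available for characters of the whole ring, so those of
      \<open>P 1\<close> are pulled back along multiplication by \<open>p\<close>.\<close>
    have shift: "additive_char R (carrier R) (\<lambda>r. \<eta> (p \<otimes> r))" if "additive_char R (P 1) \<eta>" for \<eta>
      using that p1 unfolding additive_char_def by (auto simp: r_distr)
    have "\<exists>t\<in>carrier R. \<forall>r\<in>carrier R. \<psi> (p \<otimes> r) = \<phi> (p \<otimes> (t \<otimes> r))"
    proof (rule additive_char_dual[OF finite_carrier shift[OF \<phi>] shift[OF \<psi>]])
      fix r assume r: "r \<in> carrier R" and ker: "\<forall>s\<in>carrier R. \<phi> (p \<otimes> (s \<otimes> r)) = 1"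
      have "r \<in> P (j - 1)"
      proof (rule ccontr)
        assume "r \<notin> P (j - 1)"
        then obtain u k where uk: "u \<in> Units R" "k < j - 1" "r = u \<otimes> p [^] (k::nat)" using not_P_valuation[OF r] by blast
        obtain r0 where r0: "r0 \<in> carrier R" "c0 = p [^] (j - 1) \<otimes> r0" using c0 by (auto simp: P_def)
        \<comment> \<open>The power of \<open>p\<close> that \<open>p \<otimes> r\<close> lacks to
          reach exponent \<open>j - 1\<close>; with it a multiple of \<open>p \<otimes> r\<close>
          hits \<open>c0\<close>.\<close>
        define m where "m = j - 2 - k"
        have m: "j - 1 = Suc (m + k)" using uk(2) by (simp add: m_def)
        have "p \<otimes> (p [^] m \<otimes> r0 \<otimes> inv u \<otimes> r) = (p [^] m \<otimes> p [^] k \<otimes> p) \<otimes> r0 \<otimes> (inv u \<otimes> u)"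
          unfolding uk(3) using uk(1) r0(1) by (simp add: m_ac del: Units_l_inv Units_r_inv)
        also have "\<dots> = c0" unfolding nat_pow_mult[OF p_closed] r0(2) m using uk(1) r0(1) by simp
        finally show False using ker[rule_format, of "p [^] m \<otimes> r0 \<otimes> inv u"] c0(2) uk(1) r0(1) by simp
      qed
      then have "p \<otimes> r \<in> P j" using P_mult[OF p_pow_in_P[of 1], of r "j - 1"] j by simp
      then show "\<psi> (p \<otimes> r) = 1" using trivial[OF y'X y'(2,3)] by (simp add: \<psi>_def)
    qed
    then obtain t where t: "t \<in> carrier R" "\<And>r. r \<in> carrier R \<Longrightarrow> \<psi> (p \<otimes> r) = \<phi> (p \<otimes> (t \<otimes> r))" by blast
    have \<psi>t: "\<psi> c = \<phi> (t \<otimes> c)" if c: "c \<in> P 1" for c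
    proof -
      obtain r where r: "r \<in> carrier R" "c = p \<otimes> r" using c by (auto simp: P_def)
      then have "p \<otimes> (t \<otimes> r) = t \<otimes> c" using t(1) by (simp add: m_lcomm)
      then show ?thesis using t(2)[OF r(1)] r by simp
    qed
    \<comment> \<open>A nonunit \<open>t\<close> would push \<open>P (j - 1)\<close> into
      \<open>P j\<close>, on which \<open>\<phi>\<close> is trivial, and so leave
      \<open>\<psi>\<close> trivial on \<open>P (j - 1)\<close>.\<close>
    have tU: "t \<in> Units R"
    proof (rule ccontr)
      assume "t \<notin> Units R"
      then have tP: "t \<in> P 1" using unit_iff t(1) by blast
      obtain c1 where c1: "c1 \<in> P (j - 1)" "\<psi> c1 \<noteq> 1" using generic[OF y'X y'(2,3)] by (auto simp: \<psi>_def)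
      have "t \<otimes> c1 \<in> P j" using P_mult[OF tP c1(1)] j by simp
      then have "\<phi> (t \<otimes> c1) = 1" using trivial[OF y(1-3)] by (simp add: \<phi>_def)
      then show False using \<psi>t[OF P_mono[OF j1 c1(1)]] c1(2) by simp
    qed
    have ch\<psi>: "character ?N (\<psi> \<circ> e21)" using char_low[OF \<psi>] .
    define \<sigma> where "\<sigma> A = low (t \<otimes> e21 A)" for A
    \<comment> \<open>Conjugation by \<open>dia t \<one>\<close> carries \<open>\<phi>\<close> to
      \<open>\<psi>\<close>. As this element fixes \<open>v\<close>, the \<open>\<psi>\<close>-part
      of \<open>v\<close> vanishes with the \<open>\<phi>\<close>-part; but \<open>y'\<close> is a
      nonzero \<open>\<psi>\<close>-eigenvector in the cyclic span of \<open>v\<close>.\<close>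
    have "proj ?N (\<psi> \<circ> e21) (act (dia t \<one>) v) = act (dia t \<one>) (proj ?N (\<phi> \<circ> e21) v)"
    proof (rule proj_normalized[OF ch\<psi> _ vV, of _ \<sigma>])
      fix A assume "A \<in> ?N"
      then obtain c where c: "c \<in> P 1" "A = low c" by blast
      have [simp]: "c \<in> carrier R" using c P_closed by blast
      have "inv t \<otimes> (t \<otimes> c) = c" using tU by (simp add: m_assoc[symmetric])
      then have "\<one> \<otimes> (t \<otimes> c) \<otimes> inv t = c" using tU by (simp add: m_comm)
      then have "dia t \<one> \<otimes>\<^bsub>GL\<^esub> low (t \<otimes> c) = low c \<otimes>\<^bsub>GL\<^esub> dia t \<one>"
        using dia_low[of t \<one> "t \<otimes> c"] tU by simp
      then have "act (low c) (act (dia t \<one>) v) = act (dia t \<one>) (act (low (t \<otimes> c)) v)"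
        using act_mult[of "low c" "dia t \<one>" v] act_mult[of "dia t \<one>" "low (t \<otimes> c)" v] tU vV by simp
      then show "\<sigma> A \<in> ?N \<and> act A (act (dia t \<one>) v) = act (dia t \<one>) (act (\<sigma> A) v) \<and> (\<phi> \<circ> e21) (\<sigma> A) = (\<psi> \<circ> e21) A"
        using c tU \<psi>t[OF c(1)] by (simp add: \<sigma>_def e21_low P_lmult)
    next
      show "inj_on \<sigma> ?N"
      proof (rule inj_onI)
        fix A B assume AB: "A \<in> ?N" "B \<in> ?N" "\<sigma> A = \<sigma> B"
        then obtain c d where cd: "c \<in> P 1" "A = low c" "d \<in> P 1" "B = low d" by blast
        have [simp]: "c \<in> carrier R" "d \<in> carrier R" using cd P_closed by auto
        have "t \<otimes> c = t \<otimes> d" using AB(3) by (simp add: \<sigma>_def cd e21_low) (simp add: low_def)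
        then have "inv t \<otimes> (t \<otimes> c) = inv t \<otimes> (t \<otimes> d)" by simp
        then show "A = B" using tU cd by (simp add: m_assoc[symmetric])
      qed
    qed (use tU in auto)
    then have "proj ?N (\<psi> \<circ> e21) v = 0" using vT[OF tU] ev act_zero tU by simp
    moreover have "y' \<in> eigenspace ?N (\<psi> \<circ> e21)" using y'(3) y'X X_V by (auto simp: eigenspace_def \<psi>_def e21_low)
    ultimately have "y' \<in> span {0}" using cyclic_eigenspace[OF ch\<psi> vV y'(1)] by simp
    then show False using y'(2) by simp
  qed
  then show ?thesis using dependent_at[OF w0 ab(1)] by (simp add: v_def)
qed

lemma dependent_or_lower_level:
  "dependent_maps \<or> (2 \<le> j \<and> (\<forall>v\<in>V. fixed (j - 1) (j - 1) v))"
proof (cases "\<exists>d\<in>Units R. d \<ominus> \<one> \<in> P (j - 1) \<and> \<chi> d \<noteq> 1")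
  case True
  then show ?thesis using unequal_case by blast
next
  case \<chi>1: False
  show ?thesis
  proof (cases "j = 1")
    case True
    then show ?thesis using equal_case_level_one \<chi>1 by (simp add: P_0)
  next
    case False
    then have "2 \<le> j" using j by simp
    then show ?thesis using equal_case_fixed equal_case_generic \<chi>1 by metis
  qed
qed

end

section \<open>Twisting by characters of the determinant, and induction on the level\<close>

context finite_chain_ring
begin

definition det2 :: "'a mat2 \<Rightarrow> 'a" where
  "det2 A = e11 A \<otimes> e22 A \<ominus> e12 A \<otimes> e21 A"

lemma det2_unit: "A \<in> carrier GL \<Longrightarrow> det2 A \<in> Units R"
  by (cases A) (simp add: det2_def carrier_GL2)

lemma det2_mult:
  assumes "A \<in> carrier GL" "B \<in> carrier GL"
  shows "det2 (A \<otimes>\<^bsub>GL\<^esub> B) = det2 A \<otimes> det2 B"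
proof -
  obtain a b c d a' b' c' d' where M: "A = Mat2 a b c d" "B = Mat2 a' b' c' d'" by (cases A; cases B)
  have [simp]: "a \<in> carrier R" "b \<in> carrier R" "c \<in> carrier R" "d \<in> carrier R"
      "a' \<in> carrier R" "b' \<in> carrier R" "c' \<in> carrier R" "d' \<in> carrier R"
    using assms unfolding M by (auto simp: carrier_GL2)
  show ?thesis unfolding M det2_def mult_GL2 mat2.sel by (rule is_diff_eqI, (rule is_diff_intros | simp add: diff_simps)+)
qed

lemma det2_gen:
  "x \<in> carrier R \<Longrightarrow> det2 (uni x) = \<one>" "x \<in> carrier R \<Longrightarrow> det2 (low x) = \<one>"
  "a \<in> carrier R \<Longrightarrow> d \<in> carrier R \<Longrightarrow> det2 (dia a d) = a \<otimes> d"
  by (simp_all add: det2_def gen_defs a_minus_def)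

end

context borel_pair
begin

text \<open>Scalars do not change which subspaces are invariant, and applied to both sides they
  preserve the equivariance of \<open>f\<close> and \<open>g\<close>; so dependence may be proved
  after twisting.\<close>

lemma twist:
  assumes \<delta>: "\<And>a. a \<in> Units R \<Longrightarrow> \<delta> a \<noteq> 0"
    "\<And>a b. a \<in> Units R \<Longrightarrow> b \<in> Units R \<Longrightarrow> \<delta> (a \<otimes> b) = \<delta> a * \<delta> b"
  shows "borel_pair R p scale V (\<lambda>A v. \<delta> (det2 A) *s act A v) W (\<lambda>A v. \<delta> (det2 A) *s actB A v) f g"
proof -
  have one: "\<delta> \<one> = 1" using \<delta>(1)[of \<one>] \<delta>(2)[of \<one> \<one>] by simp
  have det1: "det2 \<one>\<^bsub>GL\<^esub> = \<one>" by (simp add: one_GL2 det2_def a_minus_def)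
  have dm: "\<delta> (det2 (A \<otimes>\<^bsub>GL\<^esub> B)) = \<delta> (det2 A) * \<delta> (det2 B)" if "A \<in> carrier GL" "B \<in> carrier GL" for A B
    using that \<delta>(2) det2_unit by (simp add: det2_mult)
  have BG: "A \<in> carrier GL" if "A \<in> Borel" for A using that Borel_subset by blast
  interpret V': lin_rep scale "GL2 R" V "\<lambda>A v. \<delta> (det2 A) *s act A v"
    using sub fin_dim one det1
    by unfold_locales
      (auto simp: act_add act_scale scale_right_distrib act_closed subspace_scale dm act_mult mult_ac act_one)
  interpret W': lin_rep scale "(GL2 R)\<lparr>carrier := Borel\<rparr>" W "\<lambda>A v. \<delta> (det2 A) *s actB A v"
  proof unfold_locales
    show "subspace W" by (rule W.sub)
    show "\<exists>B. finite B \<and> W \<subseteq> span B" by (rule W.fin_dim)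
    fix A assume "A \<in> carrier (GL\<lparr>carrier := Borel\<rparr>)"
    then have A: "A \<in> Borel" "A \<in> carrier GL" using BG by auto
    fix x assume x: "x \<in> W"
    show "\<delta> (det2 A) *s actB A x \<in> W" using A x W.act_closed W.sub by (simp add: subspace_scale)
    show "\<delta> (det2 A) *s actB A (c *s x) = c *s \<delta> (det2 A) *s actB A x" for c
      using W.act_scale[of A x c] A x by (simp add: mult_ac)
    show "\<delta> (det2 A) *s actB A (x + y) = \<delta> (det2 A) *s actB A x + \<delta> (det2 A) *s actB A y" if "y \<in> W" for y
      using W.act_add[of A x y] A x that by (simp add: scale_right_distrib)
    fix B assume "B \<in> carrier (GL\<lparr>carrier := Borel\<rparr>)"
    then have B: "B \<in> Borel" "B \<in> carrier GL" using BG by auto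
    have "actB (A \<otimes>\<^bsub>GL\<^esub> B) x = actB A (actB B x)" using W.act_mult[of A B x] A B x by simp
    moreover have "actB A (\<delta> (det2 B) *s actB B x) = \<delta> (det2 B) *s actB A (actB B x)"
      using W.act_scale[of A "actB B x"] W.act_closed[of B x] A B x by simp
    ultimately show "\<delta> (det2 (A \<otimes>\<^bsub>GL\<lparr>carrier := Borel\<rparr>\<^esub> B)) *s actB (A \<otimes>\<^bsub>GL\<lparr>carrier := Borel\<rparr>\<^esub> B) x
        = \<delta> (det2 A) *s actB A (\<delta> (det2 B) *s actB B x)"
      using dm[OF A(2) B(2)] by simp
  qed (use one det1 W.act_one in auto)
  have cancel: "\<delta> (det2 A) *s x \<in> S \<longleftrightarrow> x \<in> S" if "A \<in> carrier GL" "subspace S" for A x S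
  proof
    assume "\<delta> (det2 A) *s x \<in> S"
    then have "inverse (\<delta> (det2 A)) *s \<delta> (det2 A) *s x \<in> S" using that(2) by (rule subspace_scale[rotated])
    then show "x \<in> S" using \<delta>(1)[OF det2_unit[OF that(1)]] by simp
  qed (rule subspace_scale[OF that(2)])
  have invV: "V'.invariant (carrier GL) S \<longleftrightarrow> invariant (carrier GL) S" for S
    unfolding V'.invariant_def invariant_def using cancel by blast
  have invW: "W'.invariant Borel S \<longleftrightarrow> W.invariant Borel S" for S
    unfolding W'.invariant_def W.invariant_def using cancel BG by blast
  show ?thesis
  proof unfold_locales
    show "V'.irreducible" using irrV invV by (simp add: V'.irreducible_def irreducible_def)
    show "W'.irreducible" using irrW invW by (simp add: W'.irreducible_def W.irreducible_def)
    fix h w assume h: "h \<in> Borel" and w: "w \<in> W"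
    have "actB h w \<in> W" using W.act_closed h w by simp
    then show "f (\<delta> (det2 h) *s actB h w) = \<delta> (det2 h) *s act h (f w)"
      "g (\<delta> (det2 h) *s actB h w) = \<delta> (det2 h) *s act h (g w)"
      using h w by (simp_all add: lin_onD[OF f_lin] lin_onD[OF g_lin] f_equiv g_equiv)
  qed (use f_closed g_closed f_lin g_lin in auto)
qed

text \<open>The Borel subgroup normalises the upper unipotent matrices with entries in
  \<open>P i\<close>, so their fixed vectors in the irreducible \<open>W\<close> are zero or
  everything.\<close>

lemma unipotent_fixed_dichotomy:
  assumes w: "w \<in> W" "w \<noteq> 0" "\<And>x. x \<in> P i \<Longrightarrow> actB (uni x) w = w"
    and v: "v \<in> W" and x: "x \<in> P i"
  shows "actB (uni x) v = v"
proof -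
  define S where "S = W.eigenspace (uni ` P i) (\<lambda>_. 1)"
  have SW: "S \<subseteq> W" by (auto simp: S_def W.eigenspace_def)
  have fix_S: "actB (uni x) s = s" if "s \<in> S" "x \<in> P i" for s x using that by (auto simp: S_def W.eigenspace_def)
  have "actB h s \<in> S" if h: "h \<in> Borel" and s: "s \<in> S" for h s
  proof -
    obtain a b c d where M: "h = Mat2 a b c d" by (cases h)
    have G: "Mat2 a b c d \<in> carrier GL" and c0: "c = \<zero>" using h by (auto simp: M mem_Borel)
    have [simp]: "a \<in> carrier R" "b \<in> carrier R" "d \<in> carrier R" using G by (auto simp: carrier_GL2)
    have "b \<otimes> c \<in> P 1" by (simp add: c0 P_zero)
    note U = det_unit_diag[OF G this]
    define e where "e = inv a"
    have [simp]: "e \<in> carrier R" and ae: "a \<otimes> e = \<one>" using U by (auto simp: e_def)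
    have "actB (uni x) (actB h s) = actB h s" if x: "x \<in> P i" for x
    proof -
      have [simp]: "x \<in> carrier R" using x P_closed by blast
      have "uni x \<otimes>\<^bsub>GL\<^esub> h = h \<otimes>\<^bsub>GL\<^esub> uni (e \<otimes> d \<otimes> x)"
        unfolding M c0 uni_def mult_GL2 mat2.inject
        apply (intro conjI)
        subgoal by (rule is_diff_eqI, (rule is_diff_intros | simp add: diff_simps)+)
        subgoal by (rule eq_modI[OF ae, where k = "\<ominus> d \<otimes> x"], rule is_diff_eqI, (rule is_diff_intros | simp add: diff_simps)+)
        subgoal by (rule is_diff_eqI, (rule is_diff_intros | simp add: diff_simps)+)
        subgoal by (rule is_diff_eqI, (rule is_diff_intros | simp add: diff_simps)+)
        done
      then have "actB (uni x) (actB h s) = actB h (actB (uni (e \<otimes> d \<otimes> x)) s)"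
        using W.act_mult[of "uni x" h s] W.act_mult[of h "uni (e \<otimes> d \<otimes> x)" s] h s SW by (simp add: subset_iff)
      then show ?thesis using fix_S[OF s] x by (simp add: P_lmult)
    qed
    then show ?thesis using W.act_closed[of h s] h s SW by (auto simp: S_def W.eigenspace_def)
  qed
  moreover have "subspace S" unfolding S_def by (rule W.eigenspace_subspace) (auto simp: P_closed)
  ultimately have "W.invariant Borel S" using SW by (auto simp: W.invariant_def)
  moreover have "w \<in> S" using w by (auto simp: S_def W.eigenspace_def)
  ultimately have "S = W" using irrW w(2) unfolding W.irreducible_def by auto
  then show ?thesis using fix_S v x by blast
qed

lemma torus_eigenvector:
  obtains w \<kappa> where "w \<in> W" "w \<noteq> 0" "\<And>a d. a \<in> Units R \<Longrightarrow> d \<in> Units R \<Longrightarrow> actB (dia a d) w = \<kappa> (dia a d) *s w"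
proof -
  define T where "T = (\<lambda>(a, d). dia a d) ` (Units R \<times> Units R)"
  have inv: "W.invariant T W"
    using W.act_closed W.sub by (auto simp: W.invariant_def T_def)
  have comm: "a \<otimes>\<^bsub>GL\<lparr>carrier := Borel\<rparr>\<^esub> b = b \<otimes>\<^bsub>GL\<lparr>carrier := Borel\<rparr>\<^esub> a" if "a \<in> T" "b \<in> T" for a b
    using that by (auto simp: T_def dia_mult m_comm)
  have s: "T \<subseteq> carrier (GL\<lparr>carrier := Borel\<rparr>)" "finite T" using finite_Units by (auto simp: T_def)
  obtain w \<kappa> where w: "w \<in> W" "w \<noteq> 0" "\<And>h. h \<in> T \<Longrightarrow> actB h w = \<kappa> h *s w"
    using W.common_eigenvector[OF s(2,1) comm inv W_nontrivial] by metis
  have "dia a d \<in> T" if "a \<in> Units R" "d \<in> Units R" for a d using that unfolding T_def by blast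
  then show ?thesis using that[of w \<kappa>] w by blast
qed

end

text \<open>The two actions vary in the induction because each descent replaces them by twists; the
  maps and the underlying spaces stay the same, and with them the claim.\<close>

lemma (in finite_chain_ring) dependent_of_level:
  assumes "borel_pair R p scale V act W actB f g" "1 \<le> j"
    "\<And>v. v \<in> V \<Longrightarrow> gl2_rep.fixed R p act j j v"
  shows "borel_pair.dependent_maps scale W f g"
  using assms
proof (induction j arbitrary: act actB rule: less_induct)
  case (less j)
  interpret B: borel_pair R p scale V act W actB f g by fact
  have triv: "B.fixed j j v" if "v \<in> V" for v using less.prems(3)[OF that] .
  show ?case
  proof (cases "\<forall>w\<in>W. (\<forall>x\<in>P (j - 1). actB (uni x) w = w) \<longrightarrow> w = 0")
    case True
    then show ?thesis using B.generic_case[OF less.prems(2) triv] by blast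
  next
    case False
    then have Ufix: "actB (uni x) w = w" if "w \<in> W" "x \<in> P (j - 1)" for w x
      using B.unipotent_fixed_dichotomy that by blast
    obtain w0 \<kappa> where w0: "w0 \<in> W" "w0 \<noteq> 0"
        "\<And>a d. a \<in> Units R \<Longrightarrow> d \<in> Units R \<Longrightarrow> actB (dia a d) w0 = scale (\<kappa> (dia a d)) w0"
      using B.torus_eigenvector by blast
    show ?thesis
    proof (cases "f w0 = 0")
      case True
      then show ?thesis using B.dependent_at_zero w0 by blast
    next
      case f0: False
      have \<kappa>m: "\<kappa> (dia (a \<otimes> a') (d \<otimes> d')) = \<kappa> (dia a d) * \<kappa> (dia a' d')"
        if "a \<in> Units R" "a' \<in> Units R" "d \<in> Units R" "d' \<in> Units R" for a a' d d'
        by (rule B.W.eigenvalue_mult[of "dia a d" "dia a' d'" w0]) (use w0 that in \<open>auto simp: dia_mult\<close>)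
      have \<kappa>0: "\<kappa> (dia a d) \<noteq> 0" if "a \<in> Units R" "d \<in> Units R" for a d
        by (rule B.W.eigenvalue_nonzero[of "dia a d" w0]) (use w0 that in auto)
      \<comment> \<open>The inverse of the character by which the first diagonal entry acts on
        \<open>w0\<close>; twisting by it makes that entry act trivially there.\<close>
      define \<delta> where "\<delta> a = inverse (\<kappa> (dia a \<one>))" for a
      have \<delta>0: "\<delta> a \<noteq> 0" if "a \<in> Units R" for a using \<kappa>0[OF that] by (simp add: \<delta>_def)
      have \<delta>m: "\<delta> (a \<otimes> b) = \<delta> a * \<delta> b" if "a \<in> Units R" "b \<in> Units R" for a b
        using \<kappa>m[of a b \<one> \<one>] that by (simp add: \<delta>_def)
      have \<delta>1: "\<delta> \<one> = 1" using \<delta>0[of \<one>] \<delta>m[of \<one> \<one>] by simp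
      \<comment> \<open>The twist must not raise the level. On units congruent to one modulo
        \<open>P j\<close> it is trivial, because \<open>f w0\<close> is a nonzero vector of
        \<open>V\<close> and is fixed by the congruence subgroup of level \<open>j\<close>.\<close>
      have \<delta>P: "\<delta> a = 1" if a: "a \<in> Units R" "a \<ominus> \<one> \<in> P j" for a
      proof -
        have fV: "f w0 \<in> V" using B.f_closed w0 by blast
        have "act (dia a \<one>) (f w0) = f w0"
          using triv[OF fV] a by (simp add: B.fixed_def a_minus_def r_neg P_zero)
        moreover have "act (dia a \<one>) (f w0) = scale (\<kappa> (dia a \<one>)) (f w0)"
          using B.f_equiv[of "dia a \<one>" w0] w0 a by (simp add: B.lin_onD[OF B.f_lin])
        ultimately have "f w0 = scale (\<kappa> (dia a \<one>)) (f w0)" by simp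
        then have "\<kappa> (dia a \<one>) = 1" using B.eq_scale_zero f0 by blast
        then show ?thesis by (simp add: \<delta>_def)
      qed
      define act' where "act' A v = scale (\<delta> (det2 A)) (act A v)" for A v
      define actB' where "actB' A w = scale (\<delta> (det2 A)) (actB A w)" for A w
      define \<chi> where "\<chi> d = \<kappa> (dia \<one> d) * \<delta> d" for d
      have pair': "borel_pair R p scale V act' W actB' f g"
        unfolding act'_def[abs_def] actB'_def[abs_def] using \<delta>0 \<delta>m by (rule B.twist)
      interpret B': borel_pair R p scale V act' W actB' f g by (rule pair')
      have triv': "B'.fixed j j v" if "v \<in> V" for v
      proof -
        have "\<delta> (a \<otimes> d) = 1" if "a \<in> Units R" "d \<in> Units R" "a \<ominus> \<one> \<in> P j" "d \<ominus> \<one> \<in> P j" for a d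
          using that \<delta>m \<delta>P by simp
        then show ?thesis
          using triv[OF that] P_closed by (auto simp: B.fixed_def B'.fixed_def act'_def det2_gen \<delta>1)
      qed
      interpret L: borel_pair_level R p scale V act' W actB' f g j w0 \<chi>
      proof unfold_locales
        show "1 \<le> j" by fact
        show "B'.fixed j j v" if "v \<in> V" for v using triv'[OF that] .
        show "actB' (uni x) w = w" if "w \<in> W" "x \<in> P (j - 1)" for w x
          using Ufix[OF that] P_closed[OF that(2)] by (simp add: actB'_def det2_gen \<delta>1)
        show "w0 \<in> W" "w0 \<noteq> 0" using w0 by auto
        fix a d assume ad: "a \<in> Units R" "d \<in> Units R"
        have "\<kappa> (dia a d) = \<kappa> (dia a \<one>) * \<kappa> (dia \<one> d)" using \<kappa>m[of a \<one> \<one> d] ad by simp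
        then have "\<delta> (a \<otimes> d) * \<kappa> (dia a d) = \<chi> d"
          using ad \<delta>m[OF ad] \<kappa>0[of a \<one>] by (simp add: \<chi>_def \<delta>_def)
        then show "actB' (dia a d) w0 = scale (\<chi> d) w0"
          using w0(3)[OF ad] ad by (simp add: actB'_def det2_gen)
      qed
      show ?thesis
        using L.dependent_or_lower_level
      proof
        assume "2 \<le> j \<and> (\<forall>v\<in>V. B'.fixed (j - 1) (j - 1) v)"
        moreover from this have "j - 1 < j" "1 \<le> j - 1" by auto
        ultimately show ?thesis using less.IH[OF _ pair', of "j - 1"] by blast
      qed
    qed
  qed
qed

lemma (in borel_pair) dependent: dependent_maps
proof -
  \<comment> \<open>At the nilpotency index the congruence subgroup is trivial, so every
    \<open>V\<close> has this level and the induction can start.\<close>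
  obtain m where m: "P m = {\<zero>}" using P_eq_zero by blast
  have "m \<noteq> 0" using m one_not_zero one_closed P_0 by (metis singletonD)
  moreover have "fixed m m v" if v: "v \<in> V" for v
  proof -
    have "dia a d = \<one>\<^bsub>GL\<^esub>" if "a \<in> Units R" "d \<in> Units R" "a \<ominus> \<one> = \<zero>" "d \<ominus> \<one> = \<zero>" for a d
      using that dia_one by simp
    then show ?thesis using v by (auto simp: fixed_def m uni_zero low_zero act_one)
  qed
  moreover have "borel_pair R p scale V act W actB f g" by unfold_locales
  ultimately show ?thesis using dependent_of_level[of scale V act W actB f g m] by simp
qed

section \<open>Invariant complements\<close>

context lin_rep
begin

text \<open>Maschke's theorem: average a linear projection onto \<open>S\<close> over the group.\<close>

lemma invariant_complement:
  assumes fin: "finite (carrier G)" and S: "invariant (carrier G) S"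
  obtains S' where "invariant (carrier G) S'" "S \<inter> S' = {0}" "\<And>v. v \<in> V \<Longrightarrow> \<exists>s\<in>S. \<exists>s'\<in>S'. v = s + s'"
proof -
  note SD = invariantD[OF S]
  interpret pair: vector_space_pair scale scale by unfold_locales
  have "Vector_Spaces.linear scale scale id" by (rule linear_id)
  from pair.linear_exists_left_inverse_on[OF this SD(1) inj_on_id]
  obtain p where p: "p ` UNIV \<subseteq> S" "Vector_Spaces.linear scale scale p" "\<forall>v\<in>S. p (id v) = v" by blast
  have p_add: "p (x + y) = p x + p y" and p_scale: "p (c *s x) = c *s p x" for x y c
    using p(2) by (simp_all add: Vector_Spaces.linear_iff)
  have p_S: "p x \<in> S" and p_V: "p x \<in> V" for x using p(1) SD(2) by auto
  let ?n = "of_nat (card (carrier G)) :: complex"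
  have n0: "?n \<noteq> 0" using fin one_closed by (auto simp: card_eq_0_iff)
  define q where "q x = (1 / ?n) *s (\<Sum>g\<in>carrier G. act g (p (act (inv g) x)))" for x
  have q_S: "q x \<in> S" for x
    unfolding q_def by (intro subspace_scale[OF SD(1)] subspace_sum[OF SD(1)] SD(3) p_S)
  have q_id: "q x = x" if x: "x \<in> S" for x
  proof -
    have "act g (p (act (inv g) x)) = x" if g: "g \<in> carrier G" for g
      using p(3) SD(3)[of "inv g" x] g x SD(2) by (simp add: act_inv_cancel(2) subset_iff)
    then have "(\<Sum>g\<in>carrier G. act g (p (act (inv g) x))) = (\<Sum>g\<in>carrier G. x)" by simp
    also have "\<dots> = ?n *s x"
      by (induction "carrier G" rule: infinite_finite_induct) (auto simp: scale_left_distrib sum_constant_scale)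
    finally show ?thesis using n0 by (simp add: q_def)
  qed
  have lin_q: "lin_on V q"
    unfolding lin_on_def q_def
    by (auto simp: act_add act_scale p_add p_scale p_V scale_right_distrib sum.distrib scale_sum_right mult.commute
        intro!: sum.cong)
  have q_act: "q (act h x) = act h (q x)" if h: "h \<in> carrier G" and x: "x \<in> V" for h x
  proof -
    have "(\<Sum>g\<in>carrier G. act g (p (act (inv g) (act h x)))) = (\<Sum>g\<in>carrier G. act h (act g (p (act (inv g) x))))"
    proof (rule sum.reindex_bij_witness[of _ "\<lambda>g. h \<otimes> g" "\<lambda>g. inv h \<otimes> g"])
      fix g assume g: "g \<in> carrier G"
      have "act (inv (inv h \<otimes> g)) x = act (inv g) (act h x)" using g h x by (simp add: inv_mult_group act_mult)
      then show "act h (act (inv h \<otimes> g) (p (act (inv (inv h \<otimes> g)) x))) = act g (p (act (inv g) (act h x)))"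
        using g h p_V by (simp add: act_mult[symmetric] m_assoc[symmetric])
    qed (use h in \<open>auto simp: m_assoc[symmetric]\<close>)
    also have "\<dots> = act h (\<Sum>g\<in>carrier G. act g (p (act (inv g) x)))"
      by (rule lin_on_sum[OF lin_act[OF h] sub, symmetric]) (simp add: act_closed p_V)
    finally show ?thesis unfolding q_def
      using h by (simp add: act_scale subspace_sum[OF sub] act_closed p_V)
  qed
  define S' where "S' = {x \<in> V. q x = 0}"
  have "invariant (carrier G) S'"
    unfolding invariant_def S'_def subspace_def
    using lin_onD[OF lin_q] lin_on_zero[OF lin_q sub] q_act sub
    by (auto simp: act_closed subspace_0 subspace_add subspace_scale act_zero)
  moreover have "S \<inter> S' = {0}"
    using q_id SD(2) subspace_0[OF SD(1)] subspace_0[OF sub] by (auto simp: S'_def)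
  moreover have "\<exists>s\<in>S. \<exists>s'\<in>S'. v = s + s'" if v: "v \<in> V" for v
  proof -
    have "q (v - q v) = q v - q (q v)"
      using lin_onD(1)[OF lin_q, of "v - q v" "q v"] v q_S SD(2) subspace_diff[OF sub] by (simp add: subset_iff eq_diff_eq)
    then have "v - q v \<in> S'" using q_id[OF q_S] v q_S SD(2) subspace_diff[OF sub] by (auto simp: S'_def subset_iff)
    then show ?thesis using q_S[of v] by (intro bexI[of _ "q v"] bexI[of _ "v - q v"]) auto
  qed
  ultimately show ?thesis using that by blast
qed

end

section \<open>Matrix representations and complete reducibility\<close>

text \<open>Functions on the naturals serve as one ambient space for all degrees: column vectors of
  length \<open>n\<close> become functions vanishing from \<open>n\<close> on. Representations of
  different degrees, such as \<open>V\<close> and \<open>W\<close> above, then live in the same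
  type.\<close>

definition fscale :: "complex \<Rightarrow> (nat \<Rightarrow> complex) \<Rightarrow> nat \<Rightarrow> complex" where
  "fscale c f = (\<lambda>i. c * f i)"

interpretation cfun: complex_vs fscale
  by unfold_locales (auto simp: fscale_def fun_eq_iff algebra_simps)

lemma fscale_apply [simp]: "fscale c f i = c * f i"
  by (simp add: fscale_def)

lemma sum_fun_apply: "(\<Sum>a\<in>A. F a) i = (\<Sum>a\<in>A. F a (i::nat) :: complex)"
  by (induction A rule: infinite_finite_induct) auto

definition fspace :: "nat \<Rightarrow> (nat \<Rightarrow> complex) set" where
  "fspace n = {f. \<forall>i\<ge>n. f i = 0}"

definition unit_fun :: "nat \<Rightarrow> nat \<Rightarrow> complex" where
  "unit_fun j = (\<lambda>i. if i = j then 1 else 0)"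

definition mapply :: "complex mat \<Rightarrow> (nat \<Rightarrow> complex) \<Rightarrow> nat \<Rightarrow> complex" where
  "mapply A f = (\<lambda>i. if i < dim_row A then \<Sum>j<dim_col A. A $$ (i, j) * f j else 0)"

lemma subspace_fspace: "cfun.subspace (fspace n)"
  by (auto simp: cfun.subspace_def fspace_def)

lemma fspace_expand: "f \<in> fspace n \<Longrightarrow> f = (\<Sum>j<n. fscale (f j) (unit_fun j))"
  by (rule ext) (auto simp: sum_fun_apply unit_fun_def fspace_def if_distrib cong: if_cong)

lemma fspace_span: "fspace n \<subseteq> cfun.span (unit_fun ` {..<n})"
proof
  fix f assume "f \<in> fspace n"
  then have "f = (\<Sum>j<n. fscale (f j) (unit_fun j))" by (rule fspace_expand)
  also have "\<dots> \<in> cfun.span (unit_fun ` {..<n})"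
    by (intro cfun.span_sum cfun.span_scale cfun.span_base) auto
  finally show "f \<in> cfun.span (unit_fun ` {..<n})" .
qed

lemma unit_fun_in [simp]: "j < n \<Longrightarrow> unit_fun j \<in> fspace n"
  by (auto simp: unit_fun_def fspace_def)

lemma inj_unit_fun: "inj unit_fun"
  by (rule injI) (metis unit_fun_def zero_neq_one)

lemma independent_unit_fun: "cfun.independent (unit_fun ` {..<n})"
proof (rule cfun.independent_if_scalars_zero)
  fix f v assume z: "(\<Sum>x\<in>unit_fun ` {..<n}. fscale (f x) x) = 0" and v: "v \<in> unit_fun ` {..<n}"
  obtain j where j: "j < n" "v = unit_fun j" using v by auto
  have "(\<Sum>x\<in>unit_fun ` {..<n}. fscale (f x) x) = (\<Sum>i<n. fscale (f (unit_fun i)) (unit_fun i))"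
    by (subst sum.reindex) (auto intro: inj_on_subset[OF inj_unit_fun])
  then have "(\<Sum>i<n. fscale (f (unit_fun i)) (unit_fun i)) j = 0" using z by simp
  then show "f v = 0" using j by (simp add: sum_fun_apply unit_fun_def if_distrib cong: if_cong)
qed simp

lemma mapply_in: "A \<in> carrier_mat m n \<Longrightarrow> mapply A f \<in> fspace m"
  by (auto simp: mapply_def fspace_def)

lemma mapply_add: "mapply A (f + g) = mapply A f + mapply A g"
  by (auto simp: mapply_def fun_eq_iff algebra_simps sum.distrib)

lemma mapply_scale: "mapply A (fscale c f) = fscale c (mapply A f)"
  by (auto simp: mapply_def fun_eq_iff sum_distrib_left mult_ac intro!: sum.cong)

lemma mapply_lin: "cfun.lin_on V (mapply A)"
  by (simp add: cfun.lin_on_def mapply_add mapply_scale)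

lemma mapply_one: "f \<in> fspace n \<Longrightarrow> mapply (1\<^sub>m n) f = f"
proof
  fix i assume f: "f \<in> fspace n"
  have "i < n \<Longrightarrow> (\<Sum>j<n. (1\<^sub>m n :: complex mat) $$ (i, j) * f j) = (\<Sum>j<n. if j = i then f j else 0)"
    by (intro sum.cong) auto
  then show "mapply (1\<^sub>m n) f i = f i" using f by (auto simp: mapply_def fspace_def)
qed

lemma mapply_unit:
  "A \<in> carrier_mat m n \<Longrightarrow> j < n \<Longrightarrow> mapply A (unit_fun j) = (\<lambda>i. if i < m then A $$ (i, j) else 0)"
  by (rule ext) (auto simp: mapply_def unit_fun_def if_distrib cong: if_cong)

lemma mapply_mult:
  assumes "A \<in> carrier_mat m n" "B \<in> carrier_mat n k"
  shows "mapply (A * B) f = mapply A (mapply B f)"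
proof
  fix i
  show "mapply (A * B) f i = mapply A (mapply B f) i"
  proof (cases "i < m")
    case True
    have "mapply (A * B) f i = (\<Sum>j<k. \<Sum>l<n. A $$ (i, l) * B $$ (l, j) * f j)"
      using True assms by (auto simp: mapply_def scalar_prod_def sum_distrib_right lessThan_atLeast0 intro!: sum.cong)
    also have "\<dots> = (\<Sum>l<n. A $$ (i, l) * (\<Sum>j<k. B $$ (l, j) * f j))"
      by (subst sum.swap) (simp add: sum_distrib_left mult.assoc)
    also have "\<dots> = mapply A (mapply B f) i" using True assms by (auto simp: mapply_def)
    finally show ?thesis .
  qed (use assms in \<open>auto simp: mapply_def\<close>)
qed

lemma mapply_mult_vec:
  "A \<in> carrier_mat m n \<Longrightarrow> w \<in> carrier_vec n \<Longrightarrow>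
    (\<lambda>i. if i < m then (A *\<^sub>v w) $ i else 0) = mapply A (\<lambda>i. if i < n then w $ i else 0)"
  by (rule ext) (auto simp: mapply_def scalar_prod_def lessThan_atLeast0 intro!: sum.cong)

lemma matrix_repD:
  assumes "group G" "matrix_rep G n \<rho>"
  shows "g \<in> carrier G \<Longrightarrow> \<rho> g \<in> carrier_mat n n"
    and "g \<in> carrier G \<Longrightarrow> h \<in> carrier G \<Longrightarrow> \<rho> (g \<otimes>\<^bsub>G\<^esub> h) = \<rho> g * \<rho> h"
    and "\<rho> \<one>\<^bsub>G\<^esub> = 1\<^sub>m n"
proof -
  let ?M = "ring_mat TYPE(complex) n ()"
  interpret G: group G by fact
  interpret M: ring ?M by (rule ring_mat)
  have h: "\<rho> \<in> hom G (units_of ?M)" using assms(2) by (simp add: matrix_rep_def)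
  show c: "\<rho> g \<in> carrier_mat n n" if "g \<in> carrier G" for g
    using hom_in_carrier[OF h that] M.Units_closed by (auto simp: units_of_carrier ring_mat_simps)
  show "\<rho> (g \<otimes>\<^bsub>G\<^esub> h) = \<rho> g * \<rho> h" if "g \<in> carrier G" "h \<in> carrier G" for g h
    using hom_mult[OF \<open>\<rho> \<in> hom G (units_of ?M)\<close> that] by (simp add: units_of_mult ring_mat_simps)
  show "\<rho> \<one>\<^bsub>G\<^esub> = 1\<^sub>m n"
    using hom_one[OF h G.group_axioms M.units_group] by (simp add: units_of_one ring_mat_simps)
qed

lemma matrix_repI:
  assumes "group G" "\<And>g. g \<in> carrier G \<Longrightarrow> \<rho> g \<in> carrier_mat n n"
    and "\<And>g h. g \<in> carrier G \<Longrightarrow> h \<in> carrier G \<Longrightarrow> \<rho> (g \<otimes>\<^bsub>G\<^esub> h) = \<rho> g * \<rho> h" "\<rho> \<one>\<^bsub>G\<^esub> = 1\<^sub>m n"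
  shows "matrix_rep G n \<rho>"
  unfolding matrix_rep_def
proof (rule homI)
  interpret G: group G by fact
  fix g assume g: "g \<in> carrier G"
  have "\<rho> (inv\<^bsub>G\<^esub> g) * \<rho> g = 1\<^sub>m n" "\<rho> g * \<rho> (inv\<^bsub>G\<^esub> g) = 1\<^sub>m n"
    using assms(3)[of g "inv\<^bsub>G\<^esub> g"] assms(3)[of "inv\<^bsub>G\<^esub> g" g] assms(4) g by simp_all
  then show "\<rho> g \<in> carrier (units_of (ring_mat TYPE(complex) n ()))"
    using assms(2)[OF g] assms(2)[of "inv\<^bsub>G\<^esub> g"] g
    by (auto simp: units_of_carrier Units_def ring_mat_simps intro!: bexI[of _ "\<rho> (inv\<^bsub>G\<^esub> g)"])
qed (use assms in \<open>auto simp: units_of_mult ring_mat_simps\<close>)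

lemma lin_rep_matrix:
  assumes G: "group G" and \<rho>: "matrix_rep G n \<rho>"
  shows "lin_rep fscale G (fspace n) (\<lambda>g. mapply (\<rho> g))"
proof -
  interpret G: group G by fact
  note R = matrix_repD[OF G \<rho>]
  have "\<exists>B. finite B \<and> fspace n \<subseteq> cfun.span B"
    using fspace_span[of n] by (intro exI[of _ "unit_fun ` {..<n}"]) auto
  then show ?thesis
    by unfold_locales
      (auto simp: subspace_fspace mapply_add mapply_scale mapply_in[OF R(1)] R(2,3) mapply_one mapply_mult[OF R(1) R(1)])
qed

lemma vec_subspace_iff:
  "VectorSpace.subspace class_ring W (module_vec TYPE(complex) n) \<longleftrightarrow>
    W \<subseteq> carrier_vec n \<and> 0\<^sub>v n \<in> W \<and> (\<forall>v\<in>W. \<forall>w\<in>W. v + w \<in> W) \<and> (\<forall>c. \<forall>v\<in>W. c \<cdot>\<^sub>v v \<in> W)"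
proof -
  interpret vec_space "TYPE(complex)" n .
  show ?thesis
    using vec_vs vec_module
    by (auto simp: VectorSpace.subspace_def submodule_def module_vec_simps class_ring_simps)
qed

definition fun_of_vec :: "nat \<Rightarrow> complex vec \<Rightarrow> nat \<Rightarrow> complex" where
  "fun_of_vec n w = (\<lambda>i. if i < n then w $ i else 0)"

lemma fun_of_vec_inj: "v \<in> carrier_vec n \<Longrightarrow> w \<in> carrier_vec n \<Longrightarrow> fun_of_vec n v = fun_of_vec n w \<longleftrightarrow> v = w"
  by (auto simp: fun_of_vec_def fun_eq_iff intro!: eq_vecI)

lemma fun_of_vec_simps:
  "v \<in> carrier_vec n \<Longrightarrow> w \<in> carrier_vec n \<Longrightarrow> fun_of_vec n (v + w) = fun_of_vec n v + fun_of_vec n w"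
  "v \<in> carrier_vec n \<Longrightarrow> fun_of_vec n (c \<cdot>\<^sub>v v) = fscale c (fun_of_vec n v)"
  "fun_of_vec n (0\<^sub>v n) = 0"
  "A \<in> carrier_mat n n \<Longrightarrow> v \<in> carrier_vec n \<Longrightarrow> fun_of_vec n (A *\<^sub>v v) = mapply A (fun_of_vec n v)"
  using mapply_mult_vec[of A n n v] by (auto simp: fun_of_vec_def fun_eq_iff simp del: index_mult_mat_vec)

lemma fun_of_vec_vec: "f \<in> fspace n \<Longrightarrow> fun_of_vec n (vec n f) = f"
  by (auto simp: fun_of_vec_def fspace_def fun_eq_iff)

text \<open>Padding vectors with zeros matches the invariant subspaces on both sides, and
  \<open>0 < n\<close> says that the space is nonzero.\<close>

lemma irreducible_rep_iff:
  assumes G: "group G" and \<rho>: "matrix_rep G n \<rho>"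
  shows "irreducible_rep G n \<rho> \<longleftrightarrow> lin_rep.irreducible fscale G (fspace n) (\<lambda>g. mapply (\<rho> g))"
proof -
  interpret lin_rep fscale G "fspace n" "\<lambda>g. mapply (\<rho> g)" by (rule lin_rep_matrix[OF G \<rho>])
  note R = matrix_repD[OF G \<rho>]
  have n0: "0 < n \<longleftrightarrow> fspace n \<noteq> {0}"
  proof
    assume "0 < n"
    then have "unit_fun 0 \<in> fspace n" by simp
    moreover have "unit_fun 0 \<noteq> 0" by (auto simp: unit_fun_def fun_eq_iff)
    ultimately show "fspace n \<noteq> {0}" by blast
  qed (auto simp: fspace_def fun_eq_iff intro: gr0I)
  let ?P = "\<lambda>W. VectorSpace.subspace class_ring W (module_vec TYPE(complex) n) \<and> (\<forall>g\<in>carrier G. \<forall>w\<in>W. \<rho> g *\<^sub>v w \<in> W)"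
  let ?F = "fun_of_vec n"
  have to: "invariant (carrier G) (?F ` W) \<and> (?F ` W = {0} \<longrightarrow> W = {0\<^sub>v n}) \<and> (?F ` W = fspace n \<longrightarrow> W = carrier_vec n)" if W: "?P W" for W
  proof -
    have Wc: "W \<subseteq> carrier_vec n" using W by (simp add: vec_subspace_iff)
    have "cfun.subspace (?F ` W)"
      unfolding cfun.subspace_def
    proof (intro conjI ballI allI)
      have "0\<^sub>v n \<in> W" using W by (simp add: vec_subspace_iff)
      then show "0 \<in> ?F ` W" using fun_of_vec_simps(3)[of n] by (metis imageI)
      fix x assume "x \<in> ?F ` W"
      then obtain v where v: "v \<in> W" "x = ?F v" by blast
      then have "fscale c x = ?F (c \<cdot>\<^sub>v v)" for c using Wc by (auto simp: fun_of_vec_simps)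
      then show "fscale c x \<in> ?F ` W" for c using W v by (auto simp: vec_subspace_iff)
      fix y assume "y \<in> ?F ` W"
      then obtain u where u: "u \<in> W" "y = ?F u" by blast
      then have "x + y = ?F (v + u)" using v fun_of_vec_simps(1)[OF subsetD[OF Wc v(1)] subsetD[OF Wc u(1)]] by simp
      then show "x + y \<in> ?F ` W" using W v u by (auto simp: vec_subspace_iff)
    qed
    moreover have "?F ` W \<subseteq> fspace n" by (auto simp: fun_of_vec_def fspace_def)
    moreover have "mapply (\<rho> g) x \<in> ?F ` W" if g: "g \<in> carrier G" and x: "x \<in> ?F ` W" for g x
    proof -
      obtain v where v: "v \<in> W" "x = ?F v" using x by blast
      then have "mapply (\<rho> g) x = ?F (\<rho> g *\<^sub>v v)" using Wc R(1)[OF g] by (auto simp: fun_of_vec_simps)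
      then show ?thesis using W v g by blast
    qed
    moreover have "W = {0\<^sub>v n}" if "?F ` W = {0}"
    proof -
      have "v = 0\<^sub>v n" if v: "v \<in> W" for v
      proof -
        have "?F v = ?F (0\<^sub>v n)" using v \<open>?F ` W = {0}\<close> by (auto simp: fun_of_vec_simps)
        then show ?thesis using Wc v by (subst (asm) fun_of_vec_inj) auto
      qed
      then show ?thesis using W by (auto simp: vec_subspace_iff)
    qed
    moreover have "W = carrier_vec n" if "?F ` W = fspace n"
    proof (rule antisym[OF Wc], rule subsetI)
      fix v :: "complex vec" assume v: "v \<in> carrier_vec n"
      have "?F v \<in> ?F ` W" unfolding that by (auto simp: fun_of_vec_def fspace_def)
      then obtain u where "u \<in> W" "?F v = ?F u" by blast
      then show "v \<in> W" using v Wc by (subst (asm) fun_of_vec_inj) auto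
    qed
    ultimately show ?thesis by (auto simp: invariant_def)
  qed
  have of_invariant: "?P {v \<in> carrier_vec n. ?F v \<in> S}" if S: "invariant (carrier G) S" for S
  proof -
    note SD = invariantD[OF S]
    have "VectorSpace.subspace class_ring {v \<in> carrier_vec n. ?F v \<in> S} (module_vec TYPE(complex) n)"
      unfolding vec_subspace_iff
      using cfun.subspace_0[OF SD(1)] cfun.subspace_add[OF SD(1)] cfun.subspace_scale[OF SD(1)]
      by (auto simp: fun_of_vec_simps)
    moreover have "\<rho> g *\<^sub>v w \<in> {v \<in> carrier_vec n. ?F v \<in> S}"
      if g: "g \<in> carrier G" and w: "w \<in> {v \<in> carrier_vec n. ?F v \<in> S}" for g w
      using SD(3)[OF g, of "?F w"] w R(1)[OF g] by (auto simp: fun_of_vec_simps)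
    ultimately show ?thesis by blast
  qed
  show ?thesis
  proof
    assume I: "irreducible_rep G n \<rho>"
    show irreducible
      unfolding irreducible_def
    proof (intro conjI allI impI)
      show "fspace n \<noteq> {0}" using I n0 by (simp add: irreducible_rep_def)
      fix S assume S: "invariant (carrier G) S"
      have SV: "S \<subseteq> fspace n" using invariantD[OF S] by blast
      have "{v \<in> carrier_vec n. ?F v \<in> S} = {0\<^sub>v n} \<or> {v \<in> carrier_vec n. ?F v \<in> S} = carrier_vec n"
        using I of_invariant[OF S] unfolding irreducible_rep_def by blast
      then show "S = {0} \<or> S = fspace n"
      proof
        assume z: "{v \<in> carrier_vec n. ?F v \<in> S} = {0\<^sub>v n}"
        have "f = 0" if "f \<in> S" for f
        proof -
          have e: "?F (vec n f) = f" using SV that by (intro fun_of_vec_vec) auto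
          then have "vec n f \<in> {v \<in> carrier_vec n. ?F v \<in> S}" using that by simp
          then have "vec n f = 0\<^sub>v n" using z by blast
          then show ?thesis using e fun_of_vec_simps(3)[of n] by simp
        qed
        then show ?thesis using cfun.subspace_0[OF invariantD(1)[OF S]] by blast
      next
        assume z: "{v \<in> carrier_vec n. ?F v \<in> S} = carrier_vec n"
        have "f \<in> S" if f: "f \<in> fspace n" for f
        proof -
          have "vec n f \<in> {v \<in> carrier_vec n. ?F v \<in> S}" unfolding z by simp
          then show ?thesis using fun_of_vec_vec[OF f] by simp
        qed
        then show ?thesis using SV by blast
      qed
    qed
  next
    assume I: irreducible
    show "irreducible_rep G n \<rho>"
      unfolding irreducible_rep_def
    proof (intro conjI allI impI \<rho>)
      show "0 < n" using I n0 by (simp add: irreducible_def)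
      fix W assume W: "?P W"
      then have "?F ` W = {0} \<or> ?F ` W = fspace n" using I to[OF W] unfolding irreducible_def by blast
      then show "W = {0\<^sub>v n} \<or> W = carrier_vec n" using to[OF W] by blast
    qed
  qed
qed

text \<open>\<open>P\<close> has the basis as its columns and \<open>Q\<close> takes coordinates.
  Only \<open>P * Q\<close> is computed from the expansion of the unit vectors; the product in the
  other order follows for square matrices.\<close>

lemma basis_matrix:
  assumes bs: "distinct bs" "cfun.independent (set bs)" "set bs \<subseteq> fspace n" "fspace n \<subseteq> cfun.span (set bs)"
  defines "P \<equiv> mat n n (\<lambda>(i, j). (bs ! j) i)"
  obtains Q where "length bs = n" "Q \<in> carrier_mat n n" "P * Q = 1\<^sub>m n" "Q * P = 1\<^sub>m n"
    "\<And>j. j < n \<Longrightarrow> mapply Q (bs ! j) = unit_fun j"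
proof -
  have cu: "card (unit_fun ` {..<n}) = n"
    by (simp add: card_image inj_on_subset[OF inj_unit_fun])
  have "card (set bs) \<le> card (unit_fun ` {..<n})"
    using cfun.independent_span_bound[of "unit_fun ` {..<n}" "set bs"] bs fspace_span by auto
  moreover have "card (unit_fun ` {..<n}) \<le> card (set bs)"
  proof -
    have "unit_fun ` {..<n} \<subseteq> cfun.span (set bs)" using bs(4) unit_fun_in by blast
    then show ?thesis using cfun.independent_span_bound[of "set bs" "unit_fun ` {..<n}"] independent_unit_fun by auto
  qed
  ultimately have len: "length bs = n" using cu distinct_card[OF bs(1)] by simp
  define Q where "Q = mat n n (\<lambda>(i, j). cfun.representation (set bs) (unit_fun j) (bs ! i))"
  have Pc: "P \<in> carrier_mat n n" and Qc: "Q \<in> carrier_mat n n" by (auto simp: P_def Q_def)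
  have PQ: "P * Q = 1\<^sub>m n"
  proof (rule eq_matI)
    fix i j assume "i < dim_row (1\<^sub>m n :: complex mat)" "j < dim_col (1\<^sub>m n :: complex mat)"
    then have ij: "i < n" "j < n" by auto
    let ?r = "cfun.representation (set bs) (unit_fun j)"
    have set_bs: "set bs = (!) bs ` {..<n}" using len by (auto simp: set_conv_nth)
    have inj: "inj_on ((!) bs) {..<n}" using bs(1) len by (auto simp: inj_on_nth)
    have "(P * Q) $$ (i, j) = (\<Sum>k<n. ?r (bs ! k) * (bs ! k) i)"
      using ij by (simp add: P_def Q_def scalar_prod_def lessThan_atLeast0 mult.commute)
    also have "\<dots> = (\<Sum>b\<in>set bs. ?r b * b i)" unfolding set_bs by (simp add: sum.reindex[OF inj])
    also have "\<dots> = (\<Sum>b\<in>set bs. fscale (?r b) b) i" by (simp add: sum_fun_apply)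
    also have "(\<Sum>b\<in>set bs. fscale (?r b) b) = unit_fun j"
      using bs(4) unit_fun_in[OF ij(2)] by (intro cfun.sum_representation_eq[OF bs(2)]) auto
    finally show "(P * Q) $$ (i, j) = 1\<^sub>m n $$ (i, j)" using ij by (simp add: unit_fun_def)
  qed (use Pc Qc in auto)
  have QP: "Q * P = 1\<^sub>m n" by (rule mat_mult_left_right_inverse[OF Pc Qc PQ])
  have "mapply Q (bs ! j) = unit_fun j" if j: "j < n" for j
  proof -
    have "bs ! j \<in> fspace n" using bs(3) j len by auto
    then have "mapply P (unit_fun j) = bs ! j"
      unfolding mapply_unit[OF Pc j] by (rule_tac ext) (use j in \<open>auto simp: P_def fspace_def\<close>)
    then have "mapply Q (bs ! j) = mapply (Q * P) (unit_fun j)" by (simp add: mapply_mult[OF Qc Pc])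
    then show ?thesis using j by (simp add: QP mapply_one)
  qed
  then show ?thesis using that[OF len Qc PQ QP] by blast
qed

section \<open>Equivalence of matrix representations and complete reducibility\<close>

lemma equivalent_rep_matrix_dim:
  assumes "equivalent_rep G \<rho> \<sigma>" "g \<in> carrier G" "\<rho> g \<in> carrier_mat n n"
  shows "\<sigma> g \<in> carrier_mat n n"
proof -
  obtain P Q where "similar_mat_wit (\<rho> g) (\<sigma> g) P Q" using assms(1,2) unfolding equivalent_rep_def by auto
  from similar_mat_witD2(5)[OF assms(3) this] show ?thesis .
qed

lemma equivalent_rep_trans:
  assumes "equivalent_rep G \<rho> \<sigma>" "equivalent_rep G \<sigma> \<tau>"
  shows "equivalent_rep G \<rho> \<tau>"
proof -
  obtain P Q where 1: "similar_mat_wit (\<rho> g) (\<sigma> g) P Q" if "g \<in> carrier G" for g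
    using assms(1) unfolding equivalent_rep_def by auto
  obtain P' Q' where 2: "similar_mat_wit (\<sigma> g) (\<tau> g) P' Q'" if "g \<in> carrier G" for g
    using assms(2) unfolding equivalent_rep_def by auto
  have "\<forall>g\<in>carrier G. similar_mat_wit (\<rho> g) (\<tau> g) (P * P') (Q' * Q)"
    using similar_mat_wit_trans[OF 1 2] by simp
  then show ?thesis unfolding equivalent_rep_def by (intro exI)
qed

lemma equivalent_rep_four_block:
  assumes "equivalent_rep G A A'" "equivalent_rep G D D'"
    and A: "\<And>g. g \<in> carrier G \<Longrightarrow> A g \<in> carrier_mat m m" and D: "\<And>g. g \<in> carrier G \<Longrightarrow> D g \<in> carrier_mat k k"
  shows "equivalent_rep G (\<lambda>g. four_block_mat (A g) (0\<^sub>m m k) (0\<^sub>m k m) (D g))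
    (\<lambda>g. four_block_mat (A' g) (0\<^sub>m m k) (0\<^sub>m k m) (D' g))"
proof -
  obtain P Q where 1: "\<And>g. g \<in> carrier G \<Longrightarrow> similar_mat_wit (A g) (A' g) P Q"
    using assms(1) unfolding equivalent_rep_def by blast
  obtain P' Q' where 2: "\<And>g. g \<in> carrier G \<Longrightarrow> similar_mat_wit (D g) (D' g) P' Q'"
    using assms(2) unfolding equivalent_rep_def by blast
  have "similar_mat_wit (four_block_mat (A g) (0\<^sub>m m k) (0\<^sub>m k m) (D g)) (four_block_mat (A' g) (0\<^sub>m m k) (0\<^sub>m k m) (D' g))
      (four_block_mat P (0\<^sub>m m k) (0\<^sub>m k m) P') (four_block_mat Q (0\<^sub>m m k) (0\<^sub>m k m) Q')" if g: "g \<in> carrier G" for g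
    by (rule similar_mat_wit_four_block[OF 1[OF g] 2[OF g] _ _ A[OF g] D[OF g]])
      (use similar_mat_witD2[OF A[OF g] 1[OF g]] similar_mat_witD2[OF D[OF g] 2[OF g]] in auto)
  then show ?thesis unfolding equivalent_rep_def by blast
qed

lemma four_block_mat_eqD:
  assumes "four_block_mat A B C D = four_block_mat A' B' C' D'"
    and "A \<in> carrier_mat m m" "A' \<in> carrier_mat m m" "D \<in> carrier_mat k k" "D' \<in> carrier_mat k k"
  shows "A = A'" "D = D'"
proof -
  have ent: "four_block_mat A B C D $$ (i, j) = four_block_mat A' B' C' D' $$ (i, j)" for i j using assms(1) by simp
  show "A = A'"
  proof (rule eq_matI)
    fix i j assume "i < dim_row A'" "j < dim_col A'"
    then show "A $$ (i, j) = A' $$ (i, j)" using ent[of i j] assms(2-) by simp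
  qed (use assms in auto)
  show "D = D'"
  proof (rule eq_matI)
    fix i j assume "i < dim_row D'" "j < dim_col D'"
    then show "D $$ (i, j) = D' $$ (i, j)" using ent[of "i + m" "j + m"] assms(2-) by simp
  qed (use assms in auto)
qed

text \<open>Induction on the degree. A proper nonzero invariant subspace and its complement provide
  a basis in which the matrices become block diagonal, and the two blocks are again representations,
  of smaller degree.\<close>

theorem completely_reducible:
  fixes G :: "'g monoid"
  assumes G: "group G" and fin: "finite (carrier G)" and "matrix_rep G n \<rho>"
  shows "\<exists>\<sigma>s. (\<forall>\<sigma>\<in>set \<sigma>s. \<exists>k. irreducible_rep G k \<sigma>) \<and>
    equivalent_rep G \<rho> (\<lambda>g. diag_block_mat (map (\<lambda>\<sigma>. \<sigma> g) \<sigma>s))"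
  using assms(3)
proof (induction n arbitrary: \<rho> rule: less_induct)
  case (less n)
  interpret G: group G by (rule G)
  note R = matrix_repD[OF G less.prems]
  interpret V: lin_rep fscale G "fspace n" "\<lambda>g. mapply (\<rho> g)" by (rule lin_rep_matrix[OF G less.prems])
  consider "n = 0" | "irreducible_rep G n \<rho>" | "0 < n" "\<not> irreducible_rep G n \<rho>" by blast
  then show ?case
  proof cases
    \<comment> \<open>Degree zero is the empty sum: the block diagonal matrix of the empty list has
      no rows and no columns.\<close>
    case 1
    have "similar_mat_wit (\<rho> g) (diag_block_mat []) (1\<^sub>m 0) (1\<^sub>m 0)" if "g \<in> carrier G" for g
      by (rule similar_mat_witI[of _ _ 0]) (use R(1)[OF that] 1 in \<open>auto intro!: eq_matI\<close>)
    then have "equivalent_rep G \<rho> (\<lambda>g. diag_block_mat (map (\<lambda>\<sigma>. \<sigma> g) []))"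
      unfolding equivalent_rep_def by auto
    then show ?thesis by (intro exI[of _ "[]"]) simp
  next
    case 2
    have "equivalent_rep G \<rho> (\<lambda>g. diag_block_mat (map (\<lambda>\<sigma>. \<sigma> g) [\<rho>]))"
      unfolding equivalent_rep_def list.map diag_block_mat_singleton
      by (intro exI[of _ "1\<^sub>m n"] ballI similar_mat_wit_refl R(1))
    then show ?thesis using 2 by (intro exI[of _ "[\<rho>]"]) auto
  next
    case 3
    have "fspace n \<noteq> {0}"
    proof -
      have "unit_fun 0 \<in> fspace n" using 3 by simp
      moreover have "unit_fun 0 \<noteq> 0" by (auto simp: unit_fun_def fun_eq_iff)
      ultimately show ?thesis by blast
    qed
    then obtain S where S: "V.invariant (carrier G) S" "S \<noteq> {0}" "S \<noteq> fspace n"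
      using 3 irreducible_rep_iff[OF G less.prems] unfolding V.irreducible_def by blast
    note SD = V.invariantD[OF S(1)]
    obtain S' where S': "V.invariant (carrier G) S'" "S \<inter> S' = {0}" "\<And>v. v \<in> fspace n \<Longrightarrow> \<exists>s\<in>S. \<exists>s'\<in>S'. v = s + s'"
      using V.invariant_complement[OF fin S(1)] by metis
    note SD' = V.invariantD[OF S'(1)]
    have fin_ind: "finite B" if "cfun.independent B" "B \<subseteq> fspace n" for B
      using cfun.independent_span_bound[of "unit_fun ` {..<n}" B] that fspace_span[of n] by auto
    obtain B where B: "B \<subseteq> S" "cfun.independent B" "S \<subseteq> cfun.span B"
      using cfun.maximal_independent_subset[of S] by metis
    obtain B' where B': "B' \<subseteq> S'" "cfun.independent B'" "S' \<subseteq> cfun.span B'"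
      using cfun.maximal_independent_subset[of S'] by metis
    have fB: "finite B" "finite B'" using fin_ind B B' SD(2) SD'(2) by auto
    obtain xs ys where xs: "set xs = B" "distinct xs" and ys: "set ys = B'" "distinct ys"
      using finite_distinct_list fB by metis
    have notz: "0 \<notin> B" "0 \<notin> B'" using cfun.dependent_zero[of B] cfun.dependent_zero[of B'] B(2) B'(2) by metis+
    have disj: "B \<inter> B' = {}"
    proof (rule equals0I)
      fix b assume b: "b \<in> B \<inter> B'"
      then have "b \<in> S \<inter> S'" using B(1) B'(1) by auto
      then have "b = 0" unfolding S'(2) by simp
      then show False using notz b by simp
    qed
    have ind: "cfun.independent (set (xs @ ys))"
    proof (rule cfun.independent_if_scalars_zero)
      fix f x assume z: "(\<Sum>x\<in>set (xs @ ys). fscale (f x) x) = 0" and x: "x \<in> set (xs @ ys)"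
      have "(\<Sum>x\<in>B. fscale (f x) x) + (\<Sum>x\<in>B'. fscale (f x) x) = 0"
        using z disj fB by (simp add: xs ys sum.union_disjoint)
      then have e: "(\<Sum>x\<in>B. fscale (f x) x) = - (\<Sum>x\<in>B'. fscale (f x) x)" by (simp add: eq_neg_iff_add_eq_0)
      have b: "(\<Sum>x\<in>B. fscale (f x) x) \<in> S"
        by (intro cfun.subspace_sum[OF SD(1)] cfun.subspace_scale[OF SD(1)]) (use B in auto)
      have b': "(\<Sum>x\<in>B'. fscale (f x) x) \<in> S'"
        by (intro cfun.subspace_sum[OF SD'(1)] cfun.subspace_scale[OF SD'(1)]) (use B' in auto)
      then have "(\<Sum>x\<in>B. fscale (f x) x) \<in> S'" unfolding e by (rule cfun.subspace_neg[OF SD'(1)])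
      then have "(\<Sum>x\<in>B. fscale (f x) x) = 0" using b S'(2) by blast
      moreover from this have "(\<Sum>x\<in>B'. fscale (f x) x) = 0" using e by simp
      ultimately show "f x = 0"
        using x cfun.independentD[OF B(2) fB(1) order_refl] cfun.independentD[OF B'(2) fB(2) order_refl]
        by (auto simp: xs ys)
    qed simp
    have spn: "fspace n \<subseteq> cfun.span (set (xs @ ys))"
    proof
      fix v assume "v \<in> fspace n"
      then obtain s s' where s: "s \<in> S" "s' \<in> S'" "v = s + s'" using S'(3) by blast
      have "s \<in> cfun.span (set (xs @ ys))" "s' \<in> cfun.span (set (xs @ ys))"
        using s B(3) B'(3) cfun.span_mono[of B "B \<union> B'"] cfun.span_mono[of B' "B \<union> B'"] by (auto simp: xs ys)
      then show "v \<in> cfun.span (set (xs @ ys))" using s(3) cfun.span_add by blast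
    qed
    have bsn: "set (xs @ ys) \<subseteq> fspace n" using B B' SD(2) SD'(2) by (auto simp: xs ys)
    have dist: "distinct (xs @ ys)" using xs ys disj by simp
    let ?bs = "xs @ ys"
    define P where "P = mat n n (\<lambda>(i, j). (?bs ! j) i)"
    obtain Q where len: "length ?bs = n" and Q: "Q \<in> carrier_mat n n" "P * Q = 1\<^sub>m n" "Q * P = 1\<^sub>m n"
      and Qb: "\<And>j. j < n \<Longrightarrow> mapply Q (?bs ! j) = unit_fun j"
      using basis_matrix[OF dist ind bsn spn] unfolding P_def by metis
    have P: "P \<in> carrier_mat n n" by (simp add: P_def)
    define m where "m = length xs"
    define k where "k = length ys"
    have n: "n = m + k" using len by (simp add: m_def k_def)
    have "m \<noteq> 0"
    proof
      assume "m = 0"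
      then have "S \<subseteq> {0}" using B(3) xs(1) by (simp add: m_def)
      then show False using S(2) cfun.subspace_0[OF SD(1)] by blast
    qed
    have "k \<noteq> 0"
    proof
      assume "k = 0"
      then have "S' \<subseteq> {0}" using B'(3) ys(1) by (simp add: k_def)
      then have "fspace n \<subseteq> S" using S'(3) by fastforce
      then show False using S(3) SD(2) by blast
    qed
    have QS: "mapply Q x \<in> fspace m" if "x \<in> S" for x
    proof (rule cfun.lin_on_span[OF mapply_lin cfun.subspace_UNIV subset_UNIV subspace_fspace])
      show "x \<in> cfun.span B" using that B(3) by blast
      show "mapply Q b \<in> fspace m" if bB: "b \<in> B" for b
      proof -
        obtain j where "j < m" "b = xs ! j" using bB xs(1) by (auto simp: in_set_conv_nth m_def)
        then have "j < m" "b = ?bs ! j" by (auto simp: nth_append m_def)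
        then show ?thesis using Qb[of j] n by simp
      qed
    qed
    define T where "T = {f :: nat \<Rightarrow> complex. \<forall>i<m. f i = 0}"
    have QS': "mapply Q x \<in> T" if "x \<in> S'" for x
    proof (rule cfun.lin_on_span[OF mapply_lin cfun.subspace_UNIV subset_UNIV])
      show "x \<in> cfun.span B'" using that B'(3) by blast
      show "cfun.subspace T" by (auto simp: cfun.subspace_def T_def)
      show "mapply Q b \<in> T" if bB: "b \<in> B'" for b
      proof -
        obtain j where j: "j < k" "b = ys ! j" using bB ys(1) by (auto simp: in_set_conv_nth k_def)
        then have "b = ?bs ! (m + j)" by (auto simp: nth_append m_def)
        then show ?thesis using Qb[of "m + j"] n j by (simp add: T_def unit_fun_def)
      qed
    qed
    define M where "M g = Q * \<rho> g * P" for g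
    have Mc: "M g \<in> carrier_mat n n" if "g \<in> carrier G" for g using P Q R(1)[OF that] by (simp add: M_def)
    have Ment: "M g $$ (i, j) = mapply Q (mapply (\<rho> g) (?bs ! j)) i" if g: "g \<in> carrier G" and ij: "i < n" "j < n" for g i j
    proof -
      have "mapply P (unit_fun j) = ?bs ! j"
      proof -
        have b: "?bs ! j \<in> fspace n" using bsn len ij by (metis nth_mem subsetD)
        have "mapply P (unit_fun j) = mapply (P * Q) (?bs ! j)" using Qb[OF ij(2)] by (simp add: mapply_mult[OF P Q(1)])
        then show ?thesis using b by (simp add: Q mapply_one)
      qed
      moreover have "mapply (M g) (unit_fun j) = mapply Q (mapply (\<rho> g) (mapply P (unit_fun j)))"
        unfolding M_def using mapply_mult[OF mult_carrier_mat[OF Q(1) R(1)[OF g]] P] mapply_mult[OF Q(1) R(1)[OF g]] by simp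
      ultimately show ?thesis using fun_cong[OF mapply_unit[OF Mc[OF g] ij(2)], of i] ij by simp
    qed
    \<comment> \<open>Columns before \<open>m\<close> come from basis vectors of \<open>S\<close>,
      the others from \<open>S'\<close>. Both spaces are invariant, and \<open>Q\<close> sends them
      to functions supported below \<open>m\<close> and from \<open>m\<close> on, so the two mixed
      blocks vanish.\<close>
    have M0: "M g $$ (i, j) = 0" if g: "g \<in> carrier G" and ij: "i < n" "j < n" "(i < m) \<noteq> (j < m)" for g i j
    proof (cases "j < m")
      case True
      then have "?bs ! j \<in> S" using B(1) xs(1) by (auto simp: nth_append m_def)
      then have "mapply Q (mapply (\<rho> g) (?bs ! j)) \<in> fspace m" using QS SD(3)[OF g] by blast
      then show ?thesis using Ment[OF g ij(1,2)] ij True by (simp add: fspace_def)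
    next
      case False
      then have "?bs ! j \<in> S'" using B'(1) ys(1) ij n by (auto simp: nth_append m_def k_def)
      then have "mapply Q (mapply (\<rho> g) (?bs ! j)) \<in> T" using QS' SD'(3)[OF g] by blast
      then show ?thesis using Ment[OF g ij(1,2)] ij False by (simp add: T_def)
    qed
    define A where "A g = mat m m (\<lambda>(i, j). M g $$ (i, j))" for g
    define D where "D g = mat k k (\<lambda>(i, j). M g $$ (i + m, j + m))" for g
    have Ac: "A g \<in> carrier_mat m m" and Dc: "D g \<in> carrier_mat k k" for g by (auto simp: A_def D_def)
    have MB: "M g = four_block_mat (A g) (0\<^sub>m m k) (0\<^sub>m k m) (D g)" if g: "g \<in> carrier G" for g
    proof (rule eq_matI)
      fix i j assume "i < dim_row (four_block_mat (A g) (0\<^sub>m m k) (0\<^sub>m k m) (D g))"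
        "j < dim_col (four_block_mat (A g) (0\<^sub>m m k) (0\<^sub>m k m) (D g))"
      then have "i < n" "j < n" using Ac[of g] Dc[of g] n by auto
      then show "M g $$ (i, j) = four_block_mat (A g) (0\<^sub>m m k) (0\<^sub>m k m) (D g) $$ (i, j)"
        using M0[OF g, of i j] n Ac[of g] Dc[of g] by (auto simp: A_def D_def)
    qed (use Mc[OF g] Ac[of g] Dc[of g] n in auto)
    have M_mult: "M (g \<otimes>\<^bsub>G\<^esub> h) = M g * M h" if gh: "g \<in> carrier G" "h \<in> carrier G" for g h
    proof -
      note [simp] = assoc_mult_mat[of _ n n _ n _ n]
      note c = P Q(1) R(1)[OF gh(1)] R(1)[OF gh(2)]
      have "M g * M h = Q * \<rho> g * (P * Q) * (\<rho> h * P)" unfolding M_def using c by simp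
      also have "\<dots> = M (g \<otimes>\<^bsub>G\<^esub> h)" unfolding M_def R(2)[OF gh] Q(2) using c by simp
      finally show ?thesis by simp
    qed
    have M_one: "M \<one>\<^bsub>G\<^esub> = 1\<^sub>m n" unfolding M_def R(3) using P Q by simp
    have AD_mult: "A (g \<otimes>\<^bsub>G\<^esub> h) = A g * A h" "D (g \<otimes>\<^bsub>G\<^esub> h) = D g * D h" if gh: "g \<in> carrier G" "h \<in> carrier G" for g h
    proof -
      have "four_block_mat (A (g \<otimes>\<^bsub>G\<^esub> h)) (0\<^sub>m m k) (0\<^sub>m k m) (D (g \<otimes>\<^bsub>G\<^esub> h))
        = four_block_mat (A g) (0\<^sub>m m k) (0\<^sub>m k m) (D g) * four_block_mat (A h) (0\<^sub>m m k) (0\<^sub>m k m) (D h)"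
        using M_mult[OF gh] MB gh by simp
      also have "\<dots> = four_block_mat (A g * A h) (0\<^sub>m m k) (0\<^sub>m k m) (D g * D h)"
        by (subst mult_four_block_mat[OF Ac _ _ Dc Ac _ _ Dc])
          (use Ac[of g] Ac[of h] Dc[of g] Dc[of h] in \<open>auto simp: right_mult_zero_mat[of _ m m] left_mult_zero_mat[of _ m m]
            right_mult_zero_mat[of _ k k] left_mult_zero_mat[of _ k k]\<close>)
      finally have *: "four_block_mat (A (g \<otimes>\<^bsub>G\<^esub> h)) (0\<^sub>m m k) (0\<^sub>m k m) (D (g \<otimes>\<^bsub>G\<^esub> h))
        = four_block_mat (A g * A h) (0\<^sub>m m k) (0\<^sub>m k m) (D g * D h)" .
      show "A (g \<otimes>\<^bsub>G\<^esub> h) = A g * A h" "D (g \<otimes>\<^bsub>G\<^esub> h) = D g * D h"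
        by (rule four_block_mat_eqD[OF * Ac mult_carrier_mat[OF Ac Ac] Dc mult_carrier_mat[OF Dc Dc]])+
    qed
    have "four_block_mat (A \<one>\<^bsub>G\<^esub>) (0\<^sub>m m k) (0\<^sub>m k m) (D \<one>\<^bsub>G\<^esub>) = four_block_mat (1\<^sub>m m) (0\<^sub>m m k) (0\<^sub>m k m) (1\<^sub>m k)"
      using MB[OF G.one_closed] M_one n by simp
    note one = four_block_mat_eqD[OF this Ac one_carrier_mat Dc one_carrier_mat]
    have repA: "matrix_rep G m A" and repD: "matrix_rep G k D"
      by (rule matrix_repI[OF G]; use Ac Dc AD_mult one in auto)+
    have mk: "m < n" "k < n" using n \<open>m \<noteq> 0\<close> \<open>k \<noteq> 0\<close> by auto
    obtain \<sigma>1 where \<sigma>1: "\<forall>\<sigma>\<in>set \<sigma>1. \<exists>k. irreducible_rep G k \<sigma>"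
        "equivalent_rep G A (\<lambda>g. diag_block_mat (map (\<lambda>\<sigma>. \<sigma> g) \<sigma>1))"
      using less.IH[OF mk(1) repA] by blast
    obtain \<sigma>2 where \<sigma>2: "\<forall>\<sigma>\<in>set \<sigma>2. \<exists>k. irreducible_rep G k \<sigma>"
        "equivalent_rep G D (\<lambda>g. diag_block_mat (map (\<lambda>\<sigma>. \<sigma> g) \<sigma>2))"
      using less.IH[OF mk(2) repD] by blast
    have diag: "diag_block_mat (map (\<lambda>\<sigma>. \<sigma> g) (\<sigma>1 @ \<sigma>2)) = four_block_mat (diag_block_mat (map (\<lambda>\<sigma>. \<sigma> g) \<sigma>1)) (0\<^sub>m m k)
        (0\<^sub>m k m) (diag_block_mat (map (\<lambda>\<sigma>. \<sigma> g) \<sigma>2))" if g: "g \<in> carrier G" for g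
      using equivalent_rep_matrix_dim[OF \<sigma>1(2) g Ac] equivalent_rep_matrix_dim[OF \<sigma>2(2) g Dc]
      by (auto simp: diag_block_mat_append Let_def)
    have "equivalent_rep G M (\<lambda>g. diag_block_mat (map (\<lambda>\<sigma>. \<sigma> g) (\<sigma>1 @ \<sigma>2)))"
      using equivalent_rep_four_block[OF \<sigma>1(2) \<sigma>2(2) Ac Dc] by (simp add: equivalent_rep_def MB diag del: map_append)
    moreover have "equivalent_rep G \<rho> M"
      unfolding equivalent_rep_def
    proof (intro exI ballI)
      fix g assume g: "g \<in> carrier G"
      note [simp] = assoc_mult_mat[of _ n n _ n _ n]
      have "P * M g * Q = (P * Q) * \<rho> g * (P * Q)" unfolding M_def using P Q(1) R(1)[OF g] by simp
      then have "\<rho> g = P * M g * Q" unfolding Q(2) using R(1)[OF g] by simp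
      then show "similar_mat_wit (\<rho> g) (M g) P Q"
        by (intro similar_mat_witI[of _ _ n]) (use P Q R(1)[OF g] Mc[OF g] in auto)
    qed
    ultimately have "equivalent_rep G \<rho> (\<lambda>g. diag_block_mat (map (\<lambda>\<sigma>. \<sigma> g) (\<sigma>1 @ \<sigma>2)))"
      using equivalent_rep_trans by blast
    then show ?thesis using \<sigma>1(1) \<sigma>2(1) by (intro exI[of _ "\<sigma>1 @ \<sigma>2"]) auto
  qed
qed

lemma four_block_mat_empty:
  "A \<in> carrier_mat r c \<Longrightarrow> four_block_mat A (0\<^sub>m r 0) (0\<^sub>m 0 c) (0\<^sub>m 0 0) = A"
  by (rule eq_matI) auto

text \<open>Projections \<open>R i\<close> onto the summands and inclusions \<open>C i\<close> of
  them, with their orthogonality relations; later arguments use only these and never the position of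
  a block in the large matrix.\<close>

lemma diag_block_maps:
  assumes G: "group G" and "\<forall>\<sigma>\<in>set \<sigma>s. \<exists>k. matrix_rep G k \<sigma>"
  shows "\<exists>N ks R C. length ks = length \<sigma>s \<and>
    (\<forall>g\<in>carrier G. diag_block_mat (map (\<lambda>\<sigma>. \<sigma> g) \<sigma>s) \<in> carrier_mat N N) \<and>
    (\<forall>i<length \<sigma>s. matrix_rep G (ks ! i) (\<sigma>s ! i) \<and> R i \<in> carrier_mat (ks ! i) N \<and> C i \<in> carrier_mat N (ks ! i) \<and>
      R i * C i = 1\<^sub>m (ks ! i) \<and> (\<forall>j<length \<sigma>s. j \<noteq> i \<longrightarrow> R i * C j = (0\<^sub>m (ks ! i) (ks ! j) :: complex mat)) \<and>
      (\<forall>g\<in>carrier G. R i * diag_block_mat (map (\<lambda>\<sigma>. \<sigma> g) \<sigma>s) = (\<sigma>s ! i) g * R i))"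
  using assms(2)
proof (induction \<sigma>s)
  case Nil
  show ?case by (intro exI[of _ 0] exI[of _ "[]"]) auto
next
  case (Cons \<sigma> \<sigma>s)
  obtain k where k: "matrix_rep G k \<sigma>" using Cons.prems by auto
  note S = matrix_repD(1)[OF G k]
  let ?D = "\<lambda>g. diag_block_mat (map (\<lambda>\<sigma>. \<sigma> g) \<sigma>s)"
  obtain N ks R C where IH: "length ks = length \<sigma>s" "\<forall>g\<in>carrier G. ?D g \<in> carrier_mat N N"
    "\<forall>i<length \<sigma>s. matrix_rep G (ks ! i) (\<sigma>s ! i) \<and> R i \<in> carrier_mat (ks ! i) N \<and> C i \<in> carrier_mat N (ks ! i) \<and>
      R i * C i = 1\<^sub>m (ks ! i) \<and> (\<forall>j<length \<sigma>s. j \<noteq> i \<longrightarrow> R i * C j = (0\<^sub>m (ks ! i) (ks ! j) :: complex mat)) \<and>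
      (\<forall>g\<in>carrier G. R i * ?D g = (\<sigma>s ! i) g * R i)"
    using Cons.IH Cons.prems by auto
  define ks' where "ks' = k # ks"
  \<comment> \<open>Padding with blocks that have zero rows, or zero columns in the case of
    \<open>C'\<close>, turns every product to be checked into a product of two-by-two block
    matrices.\<close>
  define R' where "R' i = (case i of 0 \<Rightarrow> four_block_mat (1\<^sub>m k) (0\<^sub>m k N) (0\<^sub>m 0 k) (0\<^sub>m 0 N)
      | Suc i \<Rightarrow> four_block_mat (0\<^sub>m (ks ! i) k) (R i) (0\<^sub>m 0 k) (0\<^sub>m 0 N))" for i
  define C' where "C' i = (case i of 0 \<Rightarrow> four_block_mat (1\<^sub>m k) (0\<^sub>m k 0) (0\<^sub>m N k) (0\<^sub>m N 0)
      | Suc i \<Rightarrow> four_block_mat (0\<^sub>m k (ks ! i)) (0\<^sub>m k 0) (C i) (0\<^sub>m N 0))" for i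
  have D': "diag_block_mat (map (\<lambda>\<sigma>. \<sigma> g) (\<sigma> # \<sigma>s)) = four_block_mat (\<sigma> g) (0\<^sub>m k N) (0\<^sub>m N k) (?D g)"
    if g: "g \<in> carrier G" for g
    using S[OF g] IH(2)[rule_format, OF g] by (auto simp: Let_def)
  have Rc: "i < length \<sigma>s \<Longrightarrow> R i \<in> carrier_mat (ks ! i) N" and Cc: "i < length \<sigma>s \<Longrightarrow> C i \<in> carrier_mat N (ks ! i)" for i
    using IH(3) by auto
  have R'c: "R' i \<in> carrier_mat (ks' ! i) (k + N)" and C'c: "C' i \<in> carrier_mat (k + N) (ks' ! i)"
    if i: "i < Suc (length \<sigma>s)" for i
  proof -
    show "R' i \<in> carrier_mat (ks' ! i) (k + N)"
    proof (cases i)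
      case 0
      then show ?thesis by (auto simp: R'_def ks'_def)
    next
      case (Suc i')
      then have "R i' \<in> carrier_mat (ks ! i') N" using Rc i by simp
      then show ?thesis by (auto simp: Suc R'_def ks'_def)
    qed
    show "C' i \<in> carrier_mat (k + N) (ks' ! i)"
    proof (cases i)
      case 0
      then show ?thesis by (auto simp: C'_def ks'_def)
    next
      case (Suc i')
      then have "C i' \<in> carrier_mat N (ks ! i')" using Cc i by simp
      then show ?thesis by (auto simp: Suc C'_def ks'_def)
    qed
  qed
  have RC: "R' i * C' j = (if i = j then 1\<^sub>m (ks' ! i) else 0\<^sub>m (ks' ! i) (ks' ! j))"
    if ij: "i < Suc (length \<sigma>s)" "j < Suc (length \<sigma>s)" for i j
  proof (cases i)
    case 0
    note i0 = this
    show ?thesis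
    proof (cases j)
      case 0
      show ?thesis unfolding i0 0 R'_def C'_def nat.case
        by (subst mult_four_block_mat[of _ k k _ N _ 0 _ _ k _ 0]) (auto simp: ks'_def four_block_mat_empty)
    next
      case (Suc j')
      then have j': "j' < length \<sigma>s" using ij by simp
      show ?thesis unfolding i0 Suc R'_def C'_def nat.case
        by (subst mult_four_block_mat[of _ k k _ N _ 0 _ _ "ks ! j'" _ 0])
          (use Cc[OF j'] in \<open>auto simp: ks'_def four_block_mat_empty\<close>)
    qed
  next
    case (Suc i')
    note iS = this
    have i': "i' < length \<sigma>s" using Suc ij by simp
    show ?thesis
    proof (cases j)
      case 0
      show ?thesis unfolding iS 0 R'_def C'_def nat.case
        by (subst mult_four_block_mat[of _ "ks ! i'" k _ N _ 0 _ _ k _ 0])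
          (use Rc[OF i'] in \<open>auto simp: ks'_def four_block_mat_empty\<close>)
    next
      case (Suc j')
      then have j': "j' < length \<sigma>s" using ij by simp
      have "R i' * C j' = (if i' = j' then 1\<^sub>m (ks ! i') else 0\<^sub>m (ks ! i') (ks ! j'))" using IH(3) i' j' by auto
      then show ?thesis unfolding iS Suc R'_def C'_def nat.case
        by (subst mult_four_block_mat[of _ "ks ! i'" k _ N _ 0 _ _ "ks ! j'" _ 0])
          (use Rc[OF i'] Cc[OF j'] in \<open>auto simp: ks'_def four_block_mat_empty\<close>)
    qed
  qed
  have RD: "R' i * diag_block_mat (map (\<lambda>\<sigma>. \<sigma> g) (\<sigma> # \<sigma>s)) = ((\<sigma> # \<sigma>s) ! i) g * R' i"
    if i: "i < Suc (length \<sigma>s)" and g: "g \<in> carrier G" for i g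
  proof (cases i)
    case 0
    have "R' 0 * four_block_mat (\<sigma> g) (0\<^sub>m k N) (0\<^sub>m N k) (?D g) = four_block_mat (\<sigma> g) (0\<^sub>m k N) (0\<^sub>m 0 k) (0\<^sub>m 0 N)"
      unfolding R'_def nat.case
      by (subst mult_four_block_mat[of _ k k _ N _ 0 _ _ k _ N])
        (use S[OF g] IH(2)[rule_format, OF g] in \<open>auto simp: left_mult_zero_mat[of _ N N]\<close>)
    also have "\<dots> = \<sigma> g * R' 0"
    proof -
      have e: "four_block_mat (\<sigma> g) (0\<^sub>m k 0) (0\<^sub>m 0 k) (0\<^sub>m 0 0) = \<sigma> g" using S[OF g] by (rule four_block_mat_empty)
      have "four_block_mat (\<sigma> g) (0\<^sub>m k 0) (0\<^sub>m 0 k) (0\<^sub>m 0 0) * R' 0 = four_block_mat (\<sigma> g) (0\<^sub>m k N) (0\<^sub>m 0 k) (0\<^sub>m 0 N)"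
        unfolding R'_def nat.case
        by (subst mult_four_block_mat[of _ k k _ 0 _ 0 _ _ k _ N])
          (use S[OF g] in \<open>auto simp: right_mult_zero_mat[of _ k k]\<close>)
      then show ?thesis unfolding e by simp
    qed
    finally show ?thesis unfolding D'[OF g] 0 by simp
  next
    case (Suc i')
    then have i': "i' < length \<sigma>s" using i by simp
    note rep = IH(3)[rule_format, OF i']
    have Sc: "(\<sigma>s ! i') g \<in> carrier_mat (ks ! i') (ks ! i')" using matrix_repD(1)[OF G _ g] rep by blast
    have "R' (Suc i') * four_block_mat (\<sigma> g) (0\<^sub>m k N) (0\<^sub>m N k) (?D g)
        = four_block_mat (0\<^sub>m (ks ! i') k) (R i' * ?D g) (0\<^sub>m 0 k) (0\<^sub>m 0 N)"
      unfolding R'_def nat.case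
      by (subst mult_four_block_mat[of _ "ks ! i'" k _ N _ 0 _ _ k _ N])
        (use S[OF g] IH(2)[rule_format, OF g] Rc[OF i'] in \<open>auto simp: left_mult_zero_mat[of _ k k] left_mult_zero_mat[of _ N N] right_mult_zero_mat[of _ "ks ! i'" N]\<close>)
    also have "R i' * ?D g = (\<sigma>s ! i') g * R i'" using rep g by blast
    also have "four_block_mat (0\<^sub>m (ks ! i') k) ((\<sigma>s ! i') g * R i') (0\<^sub>m 0 k) (0\<^sub>m 0 N) = (\<sigma>s ! i') g * R' (Suc i')"
    proof -
      have e: "four_block_mat ((\<sigma>s ! i') g) (0\<^sub>m (ks ! i') 0) (0\<^sub>m 0 (ks ! i')) (0\<^sub>m 0 0) = (\<sigma>s ! i') g"
        using Sc by (rule four_block_mat_empty)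
      have "four_block_mat ((\<sigma>s ! i') g) (0\<^sub>m (ks ! i') 0) (0\<^sub>m 0 (ks ! i')) (0\<^sub>m 0 0) * R' (Suc i')
          = four_block_mat (0\<^sub>m (ks ! i') k) ((\<sigma>s ! i') g * R i') (0\<^sub>m 0 k) (0\<^sub>m 0 N)"
        unfolding R'_def nat.case
        by (subst mult_four_block_mat[of _ "ks ! i'" "ks ! i'" _ 0 _ 0 _ _ k _ N])
          (use Sc Rc[OF i'] in \<open>auto simp: right_mult_zero_mat[of _ "ks ! i'" "ks ! i'"] left_mult_zero_mat[of _ "ks ! i'" N]\<close>)
      then show ?thesis unfolding e by simp
    qed
    finally show ?thesis unfolding D'[OF g] Suc by simp
  qed
  have "matrix_rep G (ks' ! i) ((\<sigma> # \<sigma>s) ! i)" if "i < Suc (length \<sigma>s)" for i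
    using that k IH(3) by (cases i) (auto simp: ks'_def)
  moreover have "diag_block_mat (map (\<lambda>\<sigma>. \<sigma> g) (\<sigma> # \<sigma>s)) \<in> carrier_mat (k + N) (k + N)" if g: "g \<in> carrier G" for g
    unfolding D'[OF g] using S[OF g] IH(2)[rule_format, OF g] by simp
  moreover have "length ks' = length (\<sigma> # \<sigma>s)" using IH(1) by (simp add: ks'_def)
  ultimately show ?case
    using R'c C'c RC RD by (intro exI[of _ "k + N"] exI[of _ ks'] exI[of _ R'] exI[of _ C']) simp
qed

section \<open>Induced representations\<close>

lemma left_transversal_exists:
  assumes "finite (carrier G)"
  shows "\<exists>ts. left_transversal G H ts"
proof -
  let ?f = "\<lambda>t. t <#\<^bsub>G\<^esub> H"
  obtain S where S: "S \<subseteq> carrier G" "inj_on ?f S" "?f ` carrier G = ?f ` S"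
    using subset_image_inj[of "?f ` carrier G" ?f "carrier G"] by auto
  obtain ts where ts: "set ts = S" "distinct ts"
    using finite_distinct_list finite_subset[OF S(1) assms] by metis
  have "lcosets\<^bsub>G\<^esub> H = ?f ` carrier G" by (auto simp: LCOSETS_def)
  then have "bij_betw ?f (set ts) (lcosets\<^bsub>G\<^esub> H)" using S ts by (simp add: bij_betw_def)
  then show ?thesis using S ts unfolding left_transversal_def by blast
qed

locale induced_setting = group G for G :: "'g monoid" (structure) +
  fixes H :: "'g set" and n :: nat and \<theta> :: "'g \<Rightarrow> complex mat"
  assumes finite_G: "finite (carrier G)" and sub: "subgroup H G" and rep: "matrix_rep (G\<lparr>carrier := H\<rparr>) n \<theta>"
begin

definition ts :: "'g list" where "ts = (SOME ts. left_transversal G H ts)"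

abbreviation ind where "ind \<equiv> induced_rep G H n \<theta>"
abbreviation L where "L \<equiv> length ts"

lemma H_G: "h \<in> H \<Longrightarrow> h \<in> carrier G"
  using subgroup.subset[OF sub] by blast

lemma transversal: "left_transversal G H ts"
  unfolding ts_def using left_transversal_exists[OF finite_G] by (rule someI_ex)

lemma ts_closed: "i < L \<Longrightarrow> ts ! i \<in> carrier G"
  using transversal by (auto simp: left_transversal_def)

lemma theta_rep:
  "h \<in> H \<Longrightarrow> \<theta> h \<in> carrier_mat n n" "h \<in> H \<Longrightarrow> k \<in> H \<Longrightarrow> \<theta> (h \<otimes> k) = \<theta> h * \<theta> k" "\<theta> \<one> = 1\<^sub>m n"
  using matrix_repD[OF subgroup_imp_group[OF sub] rep] by auto

lemma coset_decomposition:
  assumes g: "g \<in> carrier G"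
  obtains i h where "i < L" "h \<in> H" "g = ts ! i \<otimes> h"
proof -
  have "g <# H \<in> (\<lambda>t. t <# H) ` set ts"
    using transversal g by (auto simp: left_transversal_def bij_betw_def LCOSETS_def)
  then obtain t where t: "t \<in> set ts" "g <# H = t <# H" by blast
  have "g \<in> g <# H" using subgroup.one_closed[OF sub] g by (force simp: l_coset_def)
  then have "g \<in> t <# H" using t by simp
  then obtain h where "h \<in> H" "g = t \<otimes> h" by (auto simp: l_coset_def)
  moreover obtain i where "i < L" "t = ts ! i" using t(1) by (auto simp: in_set_conv_nth)
  ultimately show ?thesis using that by blast
qed

lemma coset_unique:
  assumes ij: "i < L" "j < L" and h: "h \<in> H" "inv (ts ! i) \<otimes> ts ! j \<otimes> h \<in> H"
  shows "i = j"
proof -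
  have t: "ts ! i \<in> carrier G" "ts ! j \<in> carrier G" using ts_closed ij by auto
  define k where "k = inv (ts ! i) \<otimes> ts ! j"
  have kc: "k \<in> carrier G" using t by (simp add: k_def)
  have "k \<otimes> h \<otimes> inv h \<in> H" using h subgroup.m_closed[OF sub] subgroup.m_inv_closed[OF sub] by (simp add: k_def)
  then have kH: "k \<in> H" using kc H_G[OF h(1)] by (simp add: m_assoc)
  have tj: "ts ! j = ts ! i \<otimes> k" using t by (simp add: k_def m_assoc[symmetric])
  have "ts ! i \<in> ts ! j <# H"
  proof -
    have "ts ! i = ts ! j \<otimes> inv k" using t kc by (simp add: tj m_assoc)
    then show ?thesis using subgroup.m_inv_closed[OF sub kH] by (auto simp: l_coset_def)
  qed
  then have "ts ! j <# H = ts ! i <# H" using l_repr_independence[OF _ t(2) sub] by metis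
  moreover have "inj_on (\<lambda>t. t <# H) (set ts)" using transversal by (simp add: left_transversal_def bij_betw_def)
  ultimately have "ts ! i = ts ! j" using ij by (metis inj_onD nth_mem)
  then show ?thesis using transversal ij by (simp add: left_transversal_def nth_eq_iff_index_eq)
qed

text \<open>The inclusion of the copy of the representation space that belongs to the
  \<open>j\<close>-th coset. A matrix on the induced space is determined by its products with these
  inclusions, which spares index computations.\<close>

definition block_incl :: "nat \<Rightarrow> complex mat" where
  "block_incl j = mat (L * n) n (\<lambda>(q, r). if q = j * n + r then 1 else 0)"

lemma block_incl_carrier: "block_incl j \<in> carrier_mat (L * n) n"
  by (simp add: block_incl_def)

lemma ind_carrier: "ind g \<in> carrier_mat (L * n) (L * n)"
  by (simp add: induced_rep_def ts_def Let_def)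

lemma block_index: "j < L \<Longrightarrow> r < n \<Longrightarrow> j * n + r < L * n"
  using mult_le_mono1[of "Suc j" L n] by simp

lemma mult_block_incl:
  assumes A: "A \<in> carrier_mat m (L * n)" and j: "j < L" and ij: "i < m" "r < n"
  shows "(A * block_incl j) $$ (i, r) = A $$ (i, j * n + r)"
proof -
  have "(A * block_incl j) $$ (i, r) = (\<Sum>q<L * n. A $$ (i, q) * (if q = j * n + r then 1 else 0))"
    using A ij by (auto simp: block_incl_def scalar_prod_def lessThan_atLeast0)
  also have "\<dots> = (\<Sum>q<L * n. if q = j * n + r then A $$ (i, q) else 0)" by (intro sum.cong) auto
  also have "\<dots> = A $$ (i, j * n + r)" using block_index[OF j ij(2)] by simp
  finally show ?thesis .
qed

lemma block_incl_mult:
  assumes T: "T \<in> carrier_mat n n" and j: "j < L" and qr: "q < L * n" "r < n"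
  shows "(block_incl j * T) $$ (q, r) = (if q div n = j then T $$ (q mod n, r) else 0)"
proof -
  have n0: "0 < n" using qr by simp
  have "(block_incl j * T) $$ (q, r) = (\<Sum>s<n. (if q = j * n + s then 1 else 0) * T $$ (s, r))"
    using T qr by (auto simp: block_incl_def scalar_prod_def lessThan_atLeast0)
  also have "\<dots> = (\<Sum>s<n. if s = q mod n then (if q div n = j then T $$ (q mod n, r) else 0) else 0)"
  proof (rule sum.cong[OF refl])
    fix s assume "s \<in> {..<n}"
    then have "q = j * n + s \<longleftrightarrow> q div n = j \<and> s = q mod n"
      by (metis div_mult_mod_eq div_mult_self3 add.right_neutral div_less lessThan_iff mod_less mod_mult_self3 n0 not_less_zero)
    then show "(if q = j * n + s then 1 else 0) * T $$ (s, r) =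
        (if s = q mod n then (if q div n = j then T $$ (q mod n, r) else 0) else 0)" by auto
  qed
  also have "\<dots> = (if q div n = j then T $$ (q mod n, r) else 0)" using n0 by simp
  finally show ?thesis .
qed

lemma block_incl_ext:
  assumes A: "A \<in> carrier_mat m (L * n)" and B: "B \<in> carrier_mat m (L * n)"
    and eq: "\<And>j. j < L \<Longrightarrow> A * block_incl j = B * block_incl j"
  shows "A = B"
proof (rule eq_matI)
  fix i q assume "i < dim_row B" "q < dim_col B"
  then have iq: "i < m" "q < L * n" using B by auto
  then have n0: "0 < n" by (cases n) auto
  have jr: "q div n < L" "q mod n < n" "q = q div n * n + q mod n"
    using iq n0 by (auto simp: less_mult_imp_div_less)
  have "(A * block_incl (q div n)) $$ (i, q mod n) = (B * block_incl (q div n)) $$ (i, q mod n)" using eq[OF jr(1)] by simp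
  then show "A $$ (i, q) = B $$ (i, q)"
    using mult_block_incl[OF A jr(1) iq(1) jr(2)] mult_block_incl[OF B jr(1) iq(1) jr(2)] jr(3) by simp
qed (use A B in auto)

text \<open>The defining rule of induction: \<open>g\<close> carries the copy at
  \<open>ts ! j\<close> to the copy at \<open>ts ! i\<close> through \<open>\<theta> h\<close>. The
  other blocks of that column vanish because \<open>g \<otimes> ts ! j\<close> lies in only one
  coset.\<close>

lemma ind_block_incl:
  assumes ij: "i < L" "j < L" and h: "h \<in> H" and g: "g \<in> carrier G" "g \<otimes> ts ! j = ts ! i \<otimes> h"
  shows "ind g * block_incl j = block_incl i * \<theta> h"
proof (rule eq_matI)
  have Tc: "\<theta> h \<in> carrier_mat n n" by (rule theta_rep(1)[OF h])
  fix q r assume "q < dim_row (block_incl i * \<theta> h)" "r < dim_col (block_incl i * \<theta> h)"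
  then have qr: "q < L * n" "r < n" using Tc block_incl_carrier[of i] by auto
  then have n0: "0 < n" by simp
  have qL: "q div n < L" using qr by (simp add: less_mult_imp_div_less)
  have t: "ts ! (q div n) \<in> carrier G" "ts ! i \<in> carrier G" "ts ! j \<in> carrier G" using ts_closed qL ij by auto
  have jr: "(j * n + r) div n = j" "(j * n + r) mod n = r" using qr n0 by auto
  let ?h = "inv (ts ! (q div n)) \<otimes> g \<otimes> ts ! j"
  have hh: "?h = inv (ts ! (q div n)) \<otimes> ts ! i \<otimes> h" using t g H_G[OF h] by (simp add: m_assoc)
  have "(ind g * block_incl j) $$ (q, r) = ind g $$ (q, j * n + r)"
    by (rule mult_block_incl[OF ind_carrier ij(2) qr])
  also have "\<dots> = (if ?h \<in> H then \<theta> ?h $$ (q mod n, r) else 0)"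
    using qr block_index[OF ij(2) qr(2)] jr by (simp add: induced_rep_def ts_def[symmetric] Let_def)
  also have "\<dots> = (if q div n = i then \<theta> h $$ (q mod n, r) else 0)"
  proof (cases "q div n = i")
    case True
    then have "?h = h" using t H_G[OF h] unfolding hh by simp
    then show ?thesis using True h by simp
  next
    case False
    then have "?h \<notin> H" using coset_unique[OF qL ij(1) h] unfolding hh by blast
    then show ?thesis using False by simp
  qed
  also have "\<dots> = (block_incl i * \<theta> h) $$ (q, r)" by (rule block_incl_mult[OF Tc ij(1) qr, symmetric])
  finally show "(ind g * block_incl j) $$ (q, r) = (block_incl i * \<theta> h) $$ (q, r)" .
qed (use ind_carrier[of g] block_incl_carrier[of i] block_incl_carrier[of j] theta_rep(1)[OF h] in auto)

lemma matrix_rep_ind: "matrix_rep G (L * n) ind"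
proof (rule matrix_repI[OF group_axioms ind_carrier])
  fix g g' assume g: "g \<in> carrier G" "g' \<in> carrier G"
  show "ind (g \<otimes> g') = ind g * ind g'"
  proof (rule block_incl_ext[OF ind_carrier mult_carrier_mat[OF ind_carrier ind_carrier]])
    fix j assume j: "j < L"
    note t = ts_closed[OF j]
    obtain i h where i: "i < L" "h \<in> H" "g' \<otimes> ts ! j = ts ! i \<otimes> h" using coset_decomposition[of "g' \<otimes> ts ! j"] g t by auto
    obtain i' h' where i': "i' < L" "h' \<in> H" "g \<otimes> ts ! i = ts ! i' \<otimes> h'"
      using coset_decomposition[of "g \<otimes> ts ! i"] g ts_closed[OF i(1)] by auto
    have "g \<otimes> g' \<otimes> ts ! j = g \<otimes> (ts ! i \<otimes> h)" using g t by (simp add: m_assoc i(3))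
    also have "\<dots> = ts ! i' \<otimes> (h' \<otimes> h)"
      using g ts_closed i(1) i'(1) H_G i(2) i'(2) by (simp add: m_assoc[symmetric] i'(3))
    finally have "ind (g \<otimes> g') * block_incl j = block_incl i' * \<theta> (h' \<otimes> h)"
      using ind_block_incl[OF i'(1) j subgroup.m_closed[OF sub i'(2) i(2)]] g by simp
    also have "\<dots> = block_incl i' * \<theta> h' * \<theta> h"
      using theta_rep(2)[OF i'(2) i(2)] assoc_mult_mat[OF block_incl_carrier theta_rep(1)[OF i'(2)] theta_rep(1)[OF i(2)]] by simp
    also have "block_incl i' * \<theta> h' = ind g * block_incl i" using ind_block_incl[OF i'(1) i(1) i'(2) g(1) i'(3)] by simp
    also have "ind g * block_incl i * \<theta> h = ind g * (block_incl i * \<theta> h)"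
      by (rule assoc_mult_mat[OF ind_carrier block_incl_carrier theta_rep(1)[OF i(2)]])
    also have "block_incl i * \<theta> h = ind g' * block_incl j" using ind_block_incl[OF i(1) j i(2) g(2) i(3)] by simp
    also have "ind g * (ind g' * block_incl j) = ind g * ind g' * block_incl j"
      by (rule assoc_mult_mat[OF ind_carrier ind_carrier block_incl_carrier, symmetric])
    finally show "ind (g \<otimes> g') * block_incl j = ind g * ind g' * block_incl j" .
  qed
next
  show "ind \<one> = 1\<^sub>m (L * n)"
  proof (rule block_incl_ext[OF ind_carrier one_carrier_mat])
    fix j assume j: "j < L"
    have "ind \<one> * block_incl j = block_incl j * \<theta> \<one>"
      using ind_block_incl[OF j j subgroup.one_closed[OF sub] one_closed] ts_closed[OF j] by simp
    then show "ind \<one> * block_incl j = 1\<^sub>m (L * n) * block_incl j"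
      using theta_rep(3) block_incl_carrier[of j] by simp
  qed
qed

text \<open>Frobenius reciprocity: an intertwiner out of the induced representation is determined by
  its restriction to the block of the trivial coset.\<close>

lemma frobenius_dependent:
  assumes \<sigma>: "matrix_rep G k \<sigma>"
    and F: "F \<in> carrier_mat k (L * n)" "\<And>g. g \<in> carrier G \<Longrightarrow> F * ind g = \<sigma> g * F"
    and F': "F' \<in> carrier_mat k (L * n)" "\<And>g. g \<in> carrier G \<Longrightarrow> F' * ind g = \<sigma> g * F'"
    and crit: "\<And>E E'. E \<in> carrier_mat k n \<Longrightarrow> E' \<in> carrier_mat k n \<Longrightarrow>
      (\<And>h. h \<in> H \<Longrightarrow> E * \<theta> h = \<sigma> h * E \<and> E' * \<theta> h = \<sigma> h * E') \<Longrightarrow>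
      \<exists>a b. (a \<noteq> 0 \<or> b \<noteq> 0) \<and> a \<cdot>\<^sub>m E + b \<cdot>\<^sub>m E' = 0\<^sub>m k n"
  shows "\<exists>a b. (a \<noteq> 0 \<or> b \<noteq> 0) \<and> a \<cdot>\<^sub>m F + b \<cdot>\<^sub>m F' = 0\<^sub>m k (L * n)"
proof -
  note S = matrix_repD[OF group_axioms \<sigma>]
  \<comment> \<open>The chosen representative of the trivial coset need not be the identity;
    \<open>h0\<close> is its inverse and corrects for this in \<open>E\<close> and in the choice of
    \<open>g\<close> below.\<close>
  obtain i0 h0 where i0: "i0 < L" "h0 \<in> H" "\<one> = ts ! i0 \<otimes> h0" using coset_decomposition[OF one_closed] .
  note t0 = ts_closed[OF i0(1)]
  have h0: "h0 \<in> carrier G" using H_G i0 by blast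
  have h0t: "h0 \<otimes> ts ! i0 = \<one>" using inv_comm[OF _ t0 h0] i0(3) by simp
  have tH: "ts ! i0 \<in> H"
  proof -
    have "ts ! i0 = inv h0" using h0t h0 t0 by (metis inv_equality inv_inv inv_closed)
    then show ?thesis using subgroup.m_inv_closed[OF sub i0(2)] by simp
  qed
  define E where "E X = X * block_incl i0 * \<theta> h0" for X
  have Tc: "\<theta> h0 \<in> carrier_mat n n" by (rule theta_rep(1)[OF i0(2)])
  have Ec: "E X \<in> carrier_mat k n" if "X \<in> carrier_mat k (L * n)" for X
    unfolding E_def using that Tc block_incl_carrier[of i0] by auto
  have Eint: "E X * \<theta> h = \<sigma> h * E X"
    if X: "X \<in> carrier_mat k (L * n)" "\<And>g. g \<in> carrier G \<Longrightarrow> X * ind g = \<sigma> g * X" and h: "h \<in> H" for X h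
  proof -
    have hc: "h \<in> carrier G" using H_G h by blast
    define h' where "h' = h0 \<otimes> h \<otimes> ts ! i0"
    have h': "h' \<in> H" unfolding h'_def using sub i0(2) h tH by (simp add: subgroup.m_closed)
    have hT: "\<theta> h \<in> carrier_mat n n" "\<theta> h' \<in> carrier_mat n n" using theta_rep(1) h h' by auto
    have "h \<otimes> ts ! i0 = ts ! i0 \<otimes> h'"
      using i0(3) hc t0 h0 by (simp add: h'_def m_assoc[symmetric])
    then have ib: "ind h * block_incl i0 = block_incl i0 * \<theta> h'" by (rule ind_block_incl[OF i0(1) i0(1) h' hc])
    have "h0 \<otimes> h = h' \<otimes> h0" using i0(3) hc t0 h0 by (simp add: h'_def m_assoc)
    then have th: "\<theta> h0 * \<theta> h = \<theta> h' * \<theta> h0" using theta_rep(2) i0(2) h h' by metis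
    have "E X * \<theta> h = X * block_incl i0 * (\<theta> h0 * \<theta> h)"
      unfolding E_def by (rule assoc_mult_mat[OF mult_carrier_mat[OF X(1) block_incl_carrier] Tc hT(1)])
    also have "\<dots> = X * (block_incl i0 * \<theta> h') * \<theta> h0"
      unfolding th using assoc_mult_mat[OF mult_carrier_mat[OF X(1) block_incl_carrier] hT(2) Tc]
        assoc_mult_mat[OF X(1) block_incl_carrier hT(2)] by simp
    also have "\<dots> = X * ind h * block_incl i0 * \<theta> h0"
      unfolding ib[symmetric] using assoc_mult_mat[OF X(1) ind_carrier block_incl_carrier] by simp
    also have "\<dots> = \<sigma> h * X * block_incl i0 * \<theta> h0" using X(2)[OF hc] by simp
    also have "\<dots> = \<sigma> h * E X"
      unfolding E_def using assoc_mult_mat[OF S(1)[OF hc] X(1) block_incl_carrier]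
        assoc_mult_mat[OF S(1)[OF hc] mult_carrier_mat[OF X(1) block_incl_carrier] Tc] by simp
    finally show ?thesis .
  qed
  obtain a b where ab: "a \<noteq> 0 \<or> b \<noteq> 0" "a \<cdot>\<^sub>m E F + b \<cdot>\<^sub>m E F' = 0\<^sub>m k n"
    using crit[OF Ec[OF F(1)] Ec[OF F'(1)]] Eint[OF F] Eint[OF F'] by blast
  define Z where "Z = a \<cdot>\<^sub>m F + b \<cdot>\<^sub>m F'"
  have Zc: "Z \<in> carrier_mat k (L * n)" using F F' by (simp add: Z_def)
  have Z_mult: "Z * Y = a \<cdot>\<^sub>m (F * Y) + b \<cdot>\<^sub>m (F' * Y)" if "Y \<in> carrier_mat (L * n) m" for Y m
    unfolding Z_def using F(1) F'(1) that
    by (simp add: add_mult_distrib_mat[of _ k "L * n"] mult_smult_assoc_mat[of _ k "L * n"])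
  have "Z * block_incl i0 = 0\<^sub>m k n"
  proof -
    have "E Z = a \<cdot>\<^sub>m E F + b \<cdot>\<^sub>m E F'"
      unfolding E_def Z_mult[OF block_incl_carrier]
      using mult_carrier_mat[OF F(1) block_incl_carrier[of i0]] mult_carrier_mat[OF F'(1) block_incl_carrier[of i0]] Tc
      by (simp add: add_mult_distrib_mat[of _ k n] mult_smult_assoc_mat[of _ k n])
    then have "E Z = 0\<^sub>m k n" using ab by simp
    then have "Z * block_incl i0 * \<theta> h0 * \<theta> (ts ! i0) = 0\<^sub>m k n * \<theta> (ts ! i0)" by (simp add: E_def)
    also have "\<dots> = 0\<^sub>m k n" using theta_rep(1)[OF tH] by simp
    also have "Z * block_incl i0 * \<theta> h0 * \<theta> (ts ! i0) = Z * block_incl i0 * (\<theta> h0 * \<theta> (ts ! i0))"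
      by (rule assoc_mult_mat[OF mult_carrier_mat[OF Zc block_incl_carrier] Tc theta_rep(1)[OF tH]])
    also have "\<theta> h0 * \<theta> (ts ! i0) = 1\<^sub>m n" using theta_rep(2)[OF i0(2) tH] theta_rep(3) h0t by simp
    finally show ?thesis unfolding right_mult_one_mat[OF mult_carrier_mat[OF Zc block_incl_carrier[of i0]]] .
  qed
  note Z0 = this
  have Z_int: "Z * ind g = \<sigma> g * Z" if g: "g \<in> carrier G" for g
    unfolding Z_mult[OF ind_carrier] F(2)[OF g] F'(2)[OF g] unfolding Z_def using F(1) F'(1) S(1)[OF g]
    by (simp add: mult_add_distrib_mat[of _ k k _ "L * n"] mult_smult_distrib[of _ k k _ "L * n"])
  have "Z = 0\<^sub>m k (L * n)"
  proof (rule block_incl_ext[OF Zc zero_carrier_mat])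
    fix j assume j: "j < L"
    note tj = ts_closed[OF j]
    \<comment> \<open>This element takes the block of the trivial coset identically to block
      \<open>j\<close>, so the vanishing of \<open>Z\<close> on the former spreads to the
      latter.\<close>
    define g where "g = ts ! j \<otimes> h0"
    have g: "g \<in> carrier G" "g \<otimes> ts ! i0 = ts ! j \<otimes> \<one>" using tj h0 t0 h0t by (simp_all add: g_def m_assoc)
    have "block_incl j = ind g * block_incl i0"
      using ind_block_incl[OF j i0(1) subgroup.one_closed[OF sub] g] theta_rep(3) block_incl_carrier[of j] by simp
    then have "Z * block_incl j = Z * ind g * block_incl i0"
      using assoc_mult_mat[OF Zc ind_carrier block_incl_carrier] by simp
    also have "\<dots> = \<sigma> g * (Z * block_incl i0)"
      unfolding Z_int[OF g(1)] by (rule assoc_mult_mat[OF S(1)[OF g(1)] Zc block_incl_carrier])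
    also have "\<dots> = 0\<^sub>m k (L * n) * block_incl j" unfolding Z0 using S(1)[OF g(1)] block_incl_carrier[of j] by simp
    finally show "Z * block_incl j = 0\<^sub>m k (L * n) * block_incl j" .
  qed
  then show ?thesis using ab(1) unfolding Z_def by blast
qed

end

text \<open>Two equivalent summands would give two independent intertwiners from the induced
  representation to one irreducible representation: the projection to the first summand, and the
  projection to the second followed by the equivalence. Frobenius reciprocity and
  \<open>crit\<close> make any two such maps dependent.\<close>

theorem strong_gelfand_criterion:
  fixes G :: "'g monoid" (structure)
  assumes G: "group G" and fin: "finite (carrier G)" and H: "subgroup H G"
    and crit: "\<And>k \<sigma> n \<theta> E E'. irreducible_rep G k \<sigma> \<Longrightarrow> irreducible_rep (G\<lparr>carrier := H\<rparr>) n \<theta> \<Longrightarrow>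
      E \<in> carrier_mat k n \<Longrightarrow> E' \<in> carrier_mat k n \<Longrightarrow>
      (\<And>h. h \<in> H \<Longrightarrow> E * \<theta> h = \<sigma> h * E \<and> E' * \<theta> h = \<sigma> h * E') \<Longrightarrow>
      \<exists>a b. (a \<noteq> 0 \<or> b \<noteq> 0) \<and> a \<cdot>\<^sub>m E + b \<cdot>\<^sub>m E' = 0\<^sub>m k n"
  shows "strong_gelfand_pair G H"
  unfolding strong_gelfand_pair_def
proof (intro conjI allI impI G fin H)
  fix n \<theta> assume \<theta>: "irreducible_rep (G\<lparr>carrier := H\<rparr>) n \<theta>"
  interpret induced_setting G H n \<theta>
    using G fin H \<theta> by (auto simp: induced_setting_def induced_setting_axioms_def irreducible_rep_def)
  let ?N = "length ts * n"
  obtain \<sigma>s where \<sigma>s: "\<forall>\<sigma>\<in>set \<sigma>s. \<exists>k. irreducible_rep G k \<sigma>"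
    "equivalent_rep G ind (\<lambda>g. diag_block_mat (map (\<lambda>\<sigma>. \<sigma> g) \<sigma>s))"
    using completely_reducible[OF G fin matrix_rep_ind] by blast
  have "\<not> equivalent_rep G (\<sigma>s ! i) (\<sigma>s ! j)" if ij: "i < j" "j < length \<sigma>s" for i j
  proof
    assume eq: "equivalent_rep G (\<sigma>s ! i) (\<sigma>s ! j)"
    let ?D = "\<lambda>g. diag_block_mat (map (\<lambda>\<sigma>. \<sigma> g) \<sigma>s)"
    have reps: "\<forall>\<sigma>\<in>set \<sigma>s. \<exists>k. matrix_rep G k \<sigma>" using \<sigma>s(1) by (auto simp: irreducible_rep_def)
    obtain N ks R C where B: "\<forall>g\<in>carrier G. ?D g \<in> carrier_mat N N"
      "\<forall>i<length \<sigma>s. matrix_rep G (ks ! i) (\<sigma>s ! i) \<and> R i \<in> carrier_mat (ks ! i) N \<and> C i \<in> carrier_mat N (ks ! i) \<and>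
      R i * C i = 1\<^sub>m (ks ! i) \<and> (\<forall>j<length \<sigma>s. j \<noteq> i \<longrightarrow> R i * C j = (0\<^sub>m (ks ! i) (ks ! j) :: complex mat)) \<and>
      (\<forall>g\<in>carrier G. R i * ?D g = (\<sigma>s ! i) g * R i)"
      using diag_block_maps[OF G reps] by auto
    have il: "i < length \<sigma>s" using ij by simp
    define k where "k = ks ! i"
    note Bi = B(2)[rule_format, OF il] and Bj = B(2)[rule_format, OF ij(2)]
    obtain k' where k': "irreducible_rep G k' (\<sigma>s ! i)" using \<sigma>s(1) nth_mem[OF il] by blast
    have dims: "(\<sigma>s ! i) \<one> \<in> carrier_mat k k" "(\<sigma>s ! i) \<one> \<in> carrier_mat k' k'" "(\<sigma>s ! j) \<one> \<in> carrier_mat (ks ! j) (ks ! j)"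
      using matrix_repD(1)[OF G _ one_closed] Bi Bj k' by (auto simp: k_def irreducible_rep_def)
    then have "k' = k" by auto
    then have irr: "irreducible_rep G k (\<sigma>s ! i)" using k' by simp
    then have k0: "0 < k" by (simp add: irreducible_rep_def)
    have "(\<sigma>s ! j) \<one> \<in> carrier_mat k k" by (rule equivalent_rep_matrix_dim[OF eq one_closed dims(1)])
    then have kj: "ks ! j = k" using dims(3) by auto
    obtain P Q where PQ: "similar_mat_wit (ind g) (?D g) P Q" if "g \<in> carrier G" for g
      using \<sigma>s(2) unfolding equivalent_rep_def by auto
    note pq1 = similar_mat_witD2[OF ind_carrier PQ[OF one_closed]]
    have Nn: "N = ?N" using pq1(5) B(1)[rule_format, OF one_closed] by auto
    have P: "P \<in> carrier_mat N N" and Q: "Q \<in> carrier_mat N N" and QP: "Q * P = 1\<^sub>m N"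
      using pq1 by (simp_all add: Nn)
    obtain S S' where SS: "similar_mat_wit ((\<sigma>s ! i) g) ((\<sigma>s ! j) g) S S'" if "g \<in> carrier G" for g
      using eq unfolding equivalent_rep_def by auto
    note s1 = similar_mat_witD2[OF dims(1) SS[OF one_closed]]
    have S: "S \<in> carrier_mat k k" and S': "S' \<in> carrier_mat k k" and S'S: "S' * S = 1\<^sub>m k"
      using s1 by simp_all
    have Ri: "R i \<in> carrier_mat k N" "R i * C i = 1\<^sub>m k" "R i * C j = 0\<^sub>m k k" "C i \<in> carrier_mat N k"
      "\<And>g. g \<in> carrier G \<Longrightarrow> R i * ?D g = (\<sigma>s ! i) g * R i"
      using Bi ij kj by (auto simp: k_def)
    have Rj: "R j \<in> carrier_mat k N" "R j * C j = 1\<^sub>m k" "R j * C i = 0\<^sub>m k k" "C j \<in> carrier_mat N k"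
      "\<And>g. g \<in> carrier G \<Longrightarrow> R j * ?D g = (\<sigma>s ! j) g * R j"
      using Bj il ij kj by (auto simp: k_def)
    define F where "F = R i * Q"
    define F' where "F' = S * R j * Q"
    have SRj: "S * R j \<in> carrier_mat k N" using S Rj by simp
    have Fc: "F \<in> carrier_mat k N" and F'c: "F' \<in> carrier_mat k N" using Ri SRj Q by (simp_all add: F_def F'_def)
    have Qind: "Q * ind g = ?D g * Q" if g: "g \<in> carrier G" for g
    proof -
      note pq = similar_mat_witD2[OF ind_carrier PQ[OF g]]
      have D: "?D g \<in> carrier_mat N N" using B(1) g by blast
      note [simp] = assoc_mult_mat[of _ N N _ N _ N]
      have "Q * ind g = (Q * P) * (?D g * Q)" unfolding pq(3) using P Q D by simp
      then show ?thesis using D Q by (simp add: QP)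
    qed
    have Fint: "F * ind g = (\<sigma>s ! i) g * F" "F' * ind g = (\<sigma>s ! i) g * F'" if g: "g \<in> carrier G" for g
    proof -
      have D: "?D g \<in> carrier_mat N N" using B(1) g by blast
      have Ic: "ind g \<in> carrier_mat N N" using ind_carrier by (simp add: Nn)
      have si: "(\<sigma>s ! i) g \<in> carrier_mat k k" and sj: "(\<sigma>s ! j) g \<in> carrier_mat k k"
        using matrix_repD(1)[OF G _ g] Bi Bj kj by (auto simp: k_def)
      have *: "X * Q * ind g = T * (X * Q)" if X: "X \<in> carrier_mat k N" "X * ?D g = T * X" "T \<in> carrier_mat k k" for X T
      proof -
        have "X * Q * ind g = X * (?D g * Q)" using assoc_mult_mat[OF X(1) Q Ic] Qind[OF g] by simp
        also have "\<dots> = T * (X * Q)" using assoc_mult_mat[OF X(1) D Q] assoc_mult_mat[OF X(3,1) Q] X(2) by simp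
        finally show ?thesis .
      qed
      show "F * ind g = (\<sigma>s ! i) g * F" unfolding F_def by (rule *[OF Ri(1) Ri(5)[OF g] si])
      have "S * R j * ?D g = S * (\<sigma>s ! j) g * R j"
        using assoc_mult_mat[OF S Rj(1) D] Rj(5)[OF g] assoc_mult_mat[OF S sj Rj(1)] by simp
      also have "S * (\<sigma>s ! j) g = (\<sigma>s ! i) g * S"
      proof -
        note [simp] = assoc_mult_mat[of _ k k _ k _ k]
        have "(\<sigma>s ! i) g * S = S * (\<sigma>s ! j) g * (S' * S)"
          using similar_mat_witD2(3)[OF si SS[OF g]] S S' sj by simp
        then show ?thesis using S sj by (simp add: S'S)
      qed
      also have "(\<sigma>s ! i) g * S * R j = (\<sigma>s ! i) g * (S * R j)" by (rule assoc_mult_mat[OF si S Rj(1)])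
      finally show "F' * ind g = (\<sigma>s ! i) g * F'" unfolding F'_def by (rule *[OF SRj _ si])
    qed
    have rep_i: "matrix_rep G k (\<sigma>s ! i)" using irr by (simp add: irreducible_rep_def)
    obtain a b where ab: "a \<noteq> 0 \<or> b \<noteq> 0" "a \<cdot>\<^sub>m F + b \<cdot>\<^sub>m F' = 0\<^sub>m k N"
      using frobenius_dependent[OF rep_i Fc[unfolded Nn] Fint(1) F'c[unfolded Nn] Fint(2) crit[OF irr \<theta>]]
      unfolding Nn by blast
    have lin: "a \<cdot>\<^sub>m (F * Y) + b \<cdot>\<^sub>m (F' * Y) = 0\<^sub>m k m" if Y: "Y \<in> carrier_mat N m" for Y m
    proof -
      have "(a \<cdot>\<^sub>m F + b \<cdot>\<^sub>m F') * Y = a \<cdot>\<^sub>m (F * Y) + b \<cdot>\<^sub>m (F' * Y)"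
        using Fc F'c Y by (simp add: add_mult_distrib_mat[of _ k N] mult_smult_assoc_mat[of _ k N])
      then show ?thesis using ab(2) Y by simp
    qed
    \<comment> \<open>Testing the relation on the inclusion \<open>C i\<close>, moved to the
      coordinates of the induced representation by \<open>P\<close>, isolates \<open>a\<close>;
      testing it on \<open>C j\<close> isolates \<open>b\<close>.\<close>
    have FP: "F * (P * Y) = R i * Y" "F' * (P * Y) = S * (R j * Y)" if Y: "Y \<in> carrier_mat N m" for Y m
    proof -
      have *: "X * Q * (P * Y) = X * Y" if X: "X \<in> carrier_mat k N" for X
      proof -
        have "X * Q * (P * Y) = X * (Q * P * Y)"
          using assoc_mult_mat[OF X Q mult_carrier_mat[OF P Y]] assoc_mult_mat[OF Q P Y] by simp
        then show ?thesis using Y by (simp add: QP)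
      qed
      show "F * (P * Y) = R i * Y" unfolding F_def by (rule *[OF Ri(1)])
      show "F' * (P * Y) = S * (R j * Y)" unfolding F'_def using *[OF SRj] assoc_mult_mat[OF S Rj(1) Y] by simp
    qed
    have "a \<cdot>\<^sub>m 1\<^sub>m k + b \<cdot>\<^sub>m (S * 0\<^sub>m k k) = (0\<^sub>m k k :: complex mat)"
      using lin[OF mult_carrier_mat[OF P Ri(4)]] FP[OF Ri(4)] Ri(2) Rj(3) by simp
    then have "(a \<cdot>\<^sub>m 1\<^sub>m k + b \<cdot>\<^sub>m (S * 0\<^sub>m k k)) $$ (0, 0) = (0 :: complex)" using k0 by simp
    then have a0: "a = 0" using S k0 by simp
    have "a \<cdot>\<^sub>m 0\<^sub>m k k + b \<cdot>\<^sub>m S = (0\<^sub>m k k :: complex mat)"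
      using lin[OF mult_carrier_mat[OF P Rj(4)]] FP[OF Rj(4)] Ri(3) Rj(2) S by simp
    then have "b \<cdot>\<^sub>m S = 0\<^sub>m k k" using S a0 by (simp add: left_add_zero_mat[of _ k k])
    then have "S' * (b \<cdot>\<^sub>m S) = 0\<^sub>m k k" using S' by simp
    then have "b \<cdot>\<^sub>m 1\<^sub>m k = (0\<^sub>m k k :: complex mat)" using mult_smult_distrib[OF S' S] S'S by simp
    then have "(b \<cdot>\<^sub>m 1\<^sub>m k) $$ (0, 0) = (0 :: complex)" using k0 by simp
    then have "b = 0" using k0 by simp
    then show False using a0 ab(1) by simp
  qed
  then show "multiplicity_free G ind" using \<sigma>s unfolding multiplicity_free_def by blast
qed

theorem (in finite_chain_ring) strong_gelfand_GL2_Borel: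
  "strong_gelfand_pair (GL2 R) (upper_triangular_GL2 R)"
proof (rule strong_gelfand_criterion[OF group_GL2 finite_GL2[OF finite_carrier]])
  show sg: "subgroup Borel GL"
  proof (rule subgroup.intro[OF Borel_subset])
    show "\<one>\<^bsub>GL\<^esub> \<in> Borel" using GL.one_closed unfolding one_GL2 by (simp add: mem_Borel)
    obtain m where m: "P m = {\<zero>}" using P_eq_zero by blast
    \<comment> \<open>The closure properties are inherited from the groups
      \<open>congr_lower s\<close>, among which the Borel subgroup is the one at the nilpotency
      index.\<close>
    have BI: "Borel = congr_lower m" by (auto simp: upper_triangular_GL2_def congr_lower_def m)
    fix x y assume "x \<in> Borel" "y \<in> Borel"
    then show "x \<otimes>\<^bsub>GL\<^esub> y \<in> Borel" "inv\<^bsub>GL\<^esub> x \<in> Borel"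
      unfolding BI using congr_lower_subgroup[of m] by (auto intro: subgroup.m_closed subgroup.m_inv_closed)
  qed
  fix k \<sigma> n \<theta> E E'
  assume \<sigma>: "irreducible_rep GL k \<sigma>" and \<theta>: "irreducible_rep (GL\<lparr>carrier := Borel\<rparr>) n \<theta>"
    and E: "E \<in> carrier_mat k n" and E': "E' \<in> carrier_mat k n"
    and int: "\<And>h. h \<in> Borel \<Longrightarrow> E * \<theta> h = \<sigma> h * E \<and> E' * \<theta> h = \<sigma> h * E'"
  have gB: "group (GL\<lparr>carrier := Borel\<rparr>)" by (rule GL.subgroup_imp_group[OF sg])
  have r\<sigma>: "matrix_rep GL k \<sigma>" and r\<theta>: "matrix_rep (GL\<lparr>carrier := Borel\<rparr>) n \<theta>"
    using \<sigma> \<theta> by (auto simp: irreducible_rep_def)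
  interpret V: lin_rep fscale GL "fspace k" "\<lambda>g. mapply (\<sigma> g)" by (rule lin_rep_matrix[OF group_GL2 r\<sigma>])
  interpret W: lin_rep fscale "GL\<lparr>carrier := Borel\<rparr>" "fspace n" "\<lambda>g. mapply (\<theta> g)" by (rule lin_rep_matrix[OF gB r\<theta>])
  interpret pair: borel_pair R p fscale "fspace k" "\<lambda>g. mapply (\<sigma> g)" "fspace n" "\<lambda>g. mapply (\<theta> g)" "mapply E" "mapply E'"
  proof unfold_locales
    show "V.irreducible" using \<sigma> irreducible_rep_iff[OF group_GL2 r\<sigma>] by simp
    show "W.irreducible" using \<theta> irreducible_rep_iff[OF gB r\<theta>] by simp
    show "mapply E w \<in> fspace k" "mapply E' w \<in> fspace k" for w using mapply_in E E' by auto
    show "cfun.lin_on (fspace n) (mapply E)" "cfun.lin_on (fspace n) (mapply E')" by (rule mapply_lin)+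
    fix h w assume h: "h \<in> Borel" and w: "w \<in> fspace n"
    have c: "\<theta> h \<in> carrier_mat n n" "\<sigma> h \<in> carrier_mat k k"
      using matrix_repD(1)[OF gB r\<theta>] matrix_repD(1)[OF group_GL2 r\<sigma>] h Borel_subset by auto
    show "mapply E (mapply (\<theta> h) w) = mapply (\<sigma> h) (mapply E w)" "mapply E' (mapply (\<theta> h) w) = mapply (\<sigma> h) (mapply E' w)"
      using int[OF h] by (simp_all add: mapply_mult[OF E c(1), symmetric] mapply_mult[OF E' c(1), symmetric]
        mapply_mult[OF c(2) E, symmetric] mapply_mult[OF c(2) E', symmetric])
  qed
  obtain a b where ab: "a \<noteq> 0 \<or> b \<noteq> 0" "\<forall>w\<in>fspace n. fscale a (mapply E w) + fscale b (mapply E' w) = 0"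
    using pair.dependent unfolding pair.dependent_maps_def by blast
  have "a \<cdot>\<^sub>m E + b \<cdot>\<^sub>m E' = 0\<^sub>m k n"
  proof (rule eq_matI)
    fix i j assume "i < dim_row (0\<^sub>m k n :: complex mat)" "j < dim_col (0\<^sub>m k n :: complex mat)"
    then have ij: "i < k" "j < n" by auto
    have "(fscale a (mapply E (unit_fun j)) + fscale b (mapply E' (unit_fun j))) i = 0" using ab(2) ij by simp
    then show "(a \<cdot>\<^sub>m E + b \<cdot>\<^sub>m E') $$ (i, j) = 0\<^sub>m k n $$ (i, j)"
      using E E' ij by (simp add: mapply_unit[of _ k n])
  qed (use E E' in auto)
  then show "\<exists>a b. (a \<noteq> 0 \<or> b \<noteq> 0) \<and> a \<cdot>\<^sub>m E + b \<cdot>\<^sub>m E' = 0\<^sub>m k n" using ab(1) by blast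
qed

section \<open>Truncations of the ring of integers\<close>

context nonarch_local_field
begin

abbreviation val_ring where "val_ring \<equiv> integer_ring K v"
text \<open>These turn out to be the powers of the maximal ideal; describing them by the valuation
  replaces computations with ideal products.\<close>

definition VG :: "nat \<Rightarrow> 'a set" where "VG m = val_ge K v (int m)"

lemma val_ring_simps [simp]:
  "carrier val_ring = VG 0" "x \<otimes>\<^bsub>val_ring\<^esub> y = x \<otimes> y" "x \<oplus>\<^bsub>val_ring\<^esub> y = x \<oplus> y"
  "\<one>\<^bsub>val_ring\<^esub> = \<one>" "\<zero>\<^bsub>val_ring\<^esub> = \<zero>"
  by (simp_all add: integer_ring_def VG_def)

lemma mem_VG: "x \<in> VG m \<longleftrightarrow> x \<in> carrier K \<and> (x = \<zero> \<or> int m \<le> v x)"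
  by (simp add: val_ge_def VG_def)

lemma val_one: "v \<one> = 0"
  using val_mult[of \<one> \<one>] by simp

lemma val_neg: "x \<in> carrier K - {\<zero>} \<Longrightarrow> v (\<ominus> x) = v x"
proof -
  assume x: "x \<in> carrier K - {\<zero>}"
  have m: "\<ominus> \<one> \<in> carrier K - {\<zero>}" using one_not_zero by (metis Diff_iff a_inv_closed minus_minus minus_zero one_closed singletonD)
  have "\<ominus> \<one> \<otimes> \<ominus> \<one> = \<one>" by (simp add: l_minus r_minus)
  then have "v (\<ominus> \<one>) + v (\<ominus> \<one>) = 0" using val_mult[OF m m] val_one by simp
  then have "v (\<ominus> \<one> \<otimes> x) = v x" using val_mult[OF m x] by simp
  then show ?thesis using x by (simp add: l_minus)
qed

lemma VG_closed: "x \<in> VG m \<Longrightarrow> x \<in> carrier K" by (simp add: mem_VG)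

lemma VG_zero: "\<zero> \<in> VG m" by (simp add: mem_VG)

lemma VG_one: "\<one> \<in> VG 0" by (simp add: mem_VG val_one)

lemma VG_mono: "m \<le> n \<Longrightarrow> x \<in> VG n \<Longrightarrow> x \<in> VG m" by (auto simp: mem_VG)

lemma VG_mult: "x \<in> VG m \<Longrightarrow> y \<in> VG n \<Longrightarrow> x \<otimes> y \<in> VG (m + n)"
  using val_mult[of x y] by (cases "x = \<zero> \<or> y = \<zero>") (auto simp: mem_VG)

lemma VG_add: "x \<in> VG m \<Longrightarrow> y \<in> VG m \<Longrightarrow> x \<oplus> y \<in> VG m"
  using val_add[of x y] by (cases "x = \<zero> \<or> y = \<zero> \<or> x \<oplus> y = \<zero>") (auto simp: mem_VG)

lemma VG_neg: "x \<in> VG m \<Longrightarrow> \<ominus> x \<in> VG m"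
  using val_neg[of x] by (cases "x = \<zero>") (auto simp: mem_VG)

lemma VG_diff: "x \<in> VG m \<Longrightarrow> y \<in> VG m \<Longrightarrow> x \<ominus> y \<in> VG m"
  by (simp add: a_minus_def VG_add VG_neg)

lemma val_ring_cring: "cring val_ring"
proof -
  have s: "VG 0 \<subseteq> carrier K" using VG_closed by blast
  have "subring (VG 0) K"
    by (rule subringI[OF s VG_one]) (use VG_neg VG_mult[of _ 0 _ 0] VG_add in auto)
  then have "cring (K\<lparr>carrier := VG 0\<rparr>)" using subcring_iff[OF s] subcringI' by blast
  then show ?thesis by (simp add: integer_ring_def VG_def)
qed

sublocale O: cring val_ring by (rule val_ring_cring)

lemma val_ring_minus:
  assumes "x \<in> VG 0" "y \<in> VG 0"
  shows "x \<ominus>\<^bsub>val_ring\<^esub> y = x \<ominus> y"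
proof -
  have "(x \<ominus>\<^bsub>val_ring\<^esub> y) \<oplus> y = x"
    using O.add.m_assoc[of x "\<ominus>\<^bsub>val_ring\<^esub> y" y] O.a_inv_closed[of y] O.l_neg[of y] O.r_zero[of x] assms
    by (simp add: a_minus_def)
  moreover have c: "x \<ominus>\<^bsub>val_ring\<^esub> y \<in> carrier K" "x \<in> carrier K" "y \<in> carrier K"
    using O.minus_closed[of x y] assms VG_closed by auto
  ultimately show ?thesis by (metis a_minus_def add.inv_solve_right)
qed

definition unif :: 'a where "unif = (SOME x. x \<in> carrier K \<and> x \<noteq> \<zero> \<and> v x = 1)"

lemma unif: "unif \<in> carrier K" "unif \<noteq> \<zero>" "v unif = 1"
proof -
  have "1 \<in> v ` (carrier K - {\<zero>})" using val_surj by simp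
  then have "\<exists>x. x \<in> carrier K \<and> x \<noteq> \<zero> \<and> v x = 1" by auto
  from someI_ex[OF this] show "unif \<in> carrier K" "unif \<noteq> \<zero>" "v unif = 1" unfolding unif_def by auto
qed

lemma unif_pow: "unif [^] (i::nat) \<in> carrier K - {\<zero>}" "v (unif [^] i) = int i"
proof -
  have "unif [^] i \<in> carrier K - {\<zero>} \<and> v (unif [^] i) = int i"
  proof (induction i)
    case 0
    then show ?case by (simp add: val_one)
  next
    case (Suc i)
    then have "unif [^] Suc i \<in> carrier K - {\<zero>}" using unif by (auto simp: integral_iff)
    then show ?case using Suc val_mult[of "unif [^] i" unif] unif by simp
  qed
  then show "unif [^] i \<in> carrier K - {\<zero>}" "v (unif [^] i) = int i" by auto
qed

lemma unif_pow_VG: "unif [^] (i::nat) \<in> VG i"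
  using unif_pow[of i] by (simp add: mem_VG)

lemma divide_unif_pow:
  assumes x: "x \<in> VG m"
  obtains y where "y \<in> VG 0" "x = y \<otimes> unif [^] m" "x \<noteq> \<zero> \<Longrightarrow> v x = int m \<Longrightarrow> y \<noteq> \<zero> \<and> v y = 0"
proof -
  let ?q = "unif [^] m"
  note q = unif_pow[of m]
  have qU: "?q \<in> Units K" using q by (simp add: field_Units)
  define y where "y = x \<otimes> inv ?q"
  have xc: "x \<in> carrier K" using x VG_closed by blast
  have yc: "y \<in> carrier K" using xc qU by (simp add: y_def)
  have xy: "x = y \<otimes> ?q" using xc qU q by (simp add: y_def m_assoc)
  have vy: "v x = v y + int m \<and> y \<noteq> \<zero>" if "x \<noteq> \<zero>"
  proof -
    have "y \<noteq> \<zero>" using that xy q by auto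
    then show ?thesis using val_mult[of y ?q] xy yc q by auto
  qed
  then have "y \<in> VG 0" using x yc by (cases "x = \<zero>") (auto simp: mem_VG y_def qU)
  then show ?thesis using that[OF _ xy] vy by auto
qed

lemma VG_principal: "VG m = PIdl\<^bsub>val_ring\<^esub> (unif [^] m)"
proof
  show "VG m \<subseteq> PIdl\<^bsub>val_ring\<^esub> (unif [^] m)"
  proof
    fix x assume "x \<in> VG m"
    then obtain y where "y \<in> VG 0" "x = y \<otimes> unif [^] m" using divide_unif_pow by metis
    then show "x \<in> PIdl\<^bsub>val_ring\<^esub> (unif [^] m)" by (auto simp: cgenideal_def)
  qed
  show "PIdl\<^bsub>val_ring\<^esub> (unif [^] m) \<subseteq> VG m"
    using VG_mult[OF _ unif_pow_VG[of m], of _ 0] by (auto simp: cgenideal_def)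
qed

lemma VG_ideal: "ideal (VG m) val_ring"
  unfolding VG_principal using VG_mono[OF le0 unif_pow_VG] by (intro O.cgenideal_ideal) simp

text \<open>One inclusion is additivity of the valuation. For the other, the uniformizer splits each
  element of level \<open>m + n\<close> into a single product, so no sums have to be formed.\<close>

lemma ideal_prod_VG: "VG m \<cdot>\<^bsub>val_ring\<^esub> VG n = VG (m + n)"
proof
  show "VG m \<cdot>\<^bsub>val_ring\<^esub> VG n \<subseteq> VG (m + n)"
  proof
    fix x assume "x \<in> VG m \<cdot>\<^bsub>val_ring\<^esub> VG n"
    then show "x \<in> VG (m + n)"
      by (induction rule: ideal_prod.induct) (simp_all add: VG_mult VG_add del: of_nat_add)
  qed
  show "VG (m + n) \<subseteq> VG m \<cdot>\<^bsub>val_ring\<^esub> VG n"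
  proof
    fix x assume "x \<in> VG (m + n)"
    then obtain y where y: "y \<in> VG 0" "x = y \<otimes> unif [^] (m + n)" using divide_unif_pow by metis
    have "x = (y \<otimes> unif [^] m) \<otimes>\<^bsub>val_ring\<^esub> unif [^] n"
      using y VG_closed[OF y(1)] unif by (simp add: m_assoc nat_pow_mult)
    moreover have "y \<otimes> unif [^] m \<in> VG m" using VG_mult[OF y(1) unif_pow_VG[of m]] by simp
    ultimately show "x \<in> VG m \<cdot>\<^bsub>val_ring\<^esub> VG n" using ideal_prod.prod[OF _ unif_pow_VG[of n]] by metis
  qed
qed

lemma max_ideal_pow: "max_ideal K v [^]\<^bsub>ideals_set val_ring\<^esub> (l::nat) = VG l"
proof (induction l)
  case 0
  then show ?case by (simp add: nat_pow_def ideals_set_def)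
next
  case (Suc l)
  have "max_ideal K v [^]\<^bsub>ideals_set val_ring\<^esub> Suc l = (max_ideal K v [^]\<^bsub>ideals_set val_ring\<^esub> l) \<cdot>\<^bsub>val_ring\<^esub> max_ideal K v"
    by (simp add: nat_pow_def ideals_set_def)
  then show ?case using Suc ideal_prod_VG[of l 1] by (simp add: max_ideal_def VG_def add.commute)
qed

lemma trunc_ring_eq: "trunc_ring K v l = val_ring Quot VG l"
  by (simp add: trunc_ring_def max_ideal_pow)

lemma coset_eq_iff:
  assumes "x \<in> VG 0" "y \<in> VG 0"
  shows "VG l +>\<^bsub>val_ring\<^esub> x = VG l +>\<^bsub>val_ring\<^esub> y \<longleftrightarrow> x \<ominus> y \<in> VG l"
  using O.quotient_eq_iff_same_a_r_cos[OF VG_ideal[of l], of x y] val_ring_minus[OF assms] assms by simp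

lemma carrier_quot: "carrier (val_ring Quot VG l) = (\<lambda>x. VG l +>\<^bsub>val_ring\<^esub> x) ` VG 0"
  by (auto simp: FactRing_def A_RCOSETS_def')

text \<open>Expansion in powers of the uniformizer: representatives for level \<open>Suc l\<close>
  are \<open>s \<oplus> unif \<otimes> t\<close> with a residue digit \<open>s\<close> and a
  representative \<open>t\<close> for level \<open>l\<close>, so finiteness of the residue field
  propagates.\<close>

lemma finite_representatives: "\<exists>T. finite T \<and> T \<subseteq> VG 0 \<and> (\<forall>x\<in>VG 0. \<exists>t\<in>T. x \<ominus> t \<in> VG l)"
proof (induction l)
  case 0
  show ?case by (rule exI[of _ "{\<zero>}"]) (auto intro!: VG_diff VG_zero)
next
  case (Suc l)
  then obtain T where T: "finite T" "T \<subseteq> VG 0" "\<forall>x\<in>VG 0. \<exists>t\<in>T. x \<ominus> t \<in> VG l" by blast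
  have "carrier (residue_field K v) = (\<lambda>x. VG 1 +>\<^bsub>val_ring\<^esub> x) ` VG 0"
    using carrier_quot[of 1] by (simp add: residue_field_def max_ideal_def VG_def)
  then have "finite ((\<lambda>x. VG 1 +>\<^bsub>val_ring\<^esub> x) ` VG 0)" using finite_residue_field by simp
  then obtain S where S: "S \<subseteq> VG 0" "finite S" "(\<lambda>x. VG 1 +>\<^bsub>val_ring\<^esub> x) ` VG 0 = (\<lambda>x. VG 1 +>\<^bsub>val_ring\<^esub> x) ` S"
    using finite_subset_image[OF _ order_refl] by metis
  let ?T = "(\<lambda>(s, t). s \<oplus> unif \<otimes> t) ` (S \<times> T)"
  have uV: "unif \<in> VG 1" using unif_pow_VG[of 1] unif by simp
  have "?T \<subseteq> VG 0"
    using S(1) T(2) VG_mult[OF VG_mono[OF _ uV], of 0 _ 0] by (auto intro!: VG_add)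
  moreover have "\<exists>t\<in>?T. x \<ominus> t \<in> VG (Suc l)" if x: "x \<in> VG 0" for x
  proof -
    obtain s where s: "s \<in> S" "VG 1 +>\<^bsub>val_ring\<^esub> x = VG 1 +>\<^bsub>val_ring\<^esub> s" using S(3) x by blast
    then have "x \<ominus> s \<in> VG 1" using coset_eq_iff[OF x, of s 1] S(1) by auto
    then obtain y where y: "y \<in> VG 0" "x \<ominus> s = y \<otimes> unif" using divide_unif_pow[of "x \<ominus> s" 1] unif by auto
    obtain t where t: "t \<in> T" "y \<ominus> t \<in> VG l" using T(3) y(1) by blast
    have c: "x \<in> carrier K" "s \<in> carrier K" "y \<in> carrier K" "t \<in> carrier K"
      using x s y t S(1) T(2) VG_closed by auto
    have "x \<ominus> (s \<oplus> unif \<otimes> t) = (x \<ominus> s) \<ominus> unif \<otimes> t" using c unif(1) by algebra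
    also have "\<dots> = unif \<otimes> (y \<ominus> t)" unfolding y(2) using c unif(1) by algebra
    also have "\<dots> \<in> VG (Suc l)" using VG_mult[OF uV t(2)] by simp
    finally show ?thesis using s(1) t(1) by (intro bexI[of _ "s \<oplus> unif \<otimes> t"]) auto
  qed
  ultimately show ?case using S(2) T(1) by (intro exI[of _ ?T]) auto
qed

theorem trunc_ring_finite_chain_ring:
  assumes l: "1 \<le> l"
  shows "finite_chain_ring (trunc_ring K v l) (VG l +>\<^bsub>val_ring\<^esub> unif)"
  unfolding trunc_ring_eq
proof -
  let ?Q = "val_ring Quot VG l"
  let ?c = "\<lambda>x. VG l +>\<^bsub>val_ring\<^esub> x"
  interpret I: ideal "VG l" val_ring by (rule VG_ideal)
  interpret Q: cring ?Q by (rule I.quotient_is_cring[OF val_ring_cring])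
  have one: "\<one>\<^bsub>?Q\<^esub> = ?c \<one>" and zero: "\<zero>\<^bsub>?Q\<^esub> = VG l" by (simp_all add: FactRing_def)
  have mult: "?c x \<otimes>\<^bsub>?Q\<^esub> ?c y = ?c (x \<otimes> y)" if "x \<in> VG 0" "y \<in> VG 0" for x y
    using I.rcoset_mult_add[of x y] that by (simp add: FactRing_def)
  have czero: "?c x = \<zero>\<^bsub>?Q\<^esub>" if "x \<in> VG l" for x
    unfolding zero using O.a_coset_join2[of x "VG l"] VG_mono[OF le0 that] that I.a_subgroup by simp
  have zero': "\<zero>\<^bsub>?Q\<^esub> = ?c \<zero>" using czero[OF VG_zero] by simp
  have uV: "unif \<in> VG 0" using VG_mono[OF le0 unif_pow_VG[of 1]] unif by simp
  have pow: "?c unif [^]\<^bsub>?Q\<^esub> (i::nat) = ?c (unif [^] i)" for i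
  proof (induction i)
    case (Suc i)
    then show ?case using mult[OF VG_mono[OF le0 unif_pow_VG[of i]] uV] by simp
  qed (simp add: one)
  show "finite_chain_ring ?Q (?c unif)"
  proof (intro finite_chain_ring.intro finite_chain_ring_axioms.intro Q.cring_axioms)
    obtain T where T: "finite T" "T \<subseteq> VG 0" "\<forall>x\<in>VG 0. \<exists>t\<in>T. x \<ominus> t \<in> VG l" using finite_representatives by blast
    have "carrier ?Q \<subseteq> ?c ` T"
    proof
      fix X assume "X \<in> carrier ?Q"
      then obtain x where x: "x \<in> VG 0" "X = ?c x" unfolding carrier_quot by blast
      obtain t where t: "t \<in> T" "x \<ominus> t \<in> VG l" using T(3) x by blast
      then have "?c x = ?c t" using coset_eq_iff[OF x(1), of t] T(2) by auto
      then show "X \<in> ?c ` T" using x t by blast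
    qed
    then show "finite (carrier ?Q)" using T(1) finite_surj by blast
    show "?c unif \<in> carrier ?Q" using uV unfolding carrier_quot by blast
    show "\<one>\<^bsub>?Q\<^esub> \<noteq> \<zero>\<^bsub>?Q\<^esub>"
    proof
      assume "\<one>\<^bsub>?Q\<^esub> = \<zero>\<^bsub>?Q\<^esub>"
      then have "\<one> \<ominus> \<zero> \<in> VG l" using coset_eq_iff[OF VG_one VG_zero] unfolding one zero' by simp
      then show False using l val_one one_not_zero by (simp add: mem_VG a_minus_def)
    qed
    show "\<exists>m::nat. ?c unif [^]\<^bsub>?Q\<^esub> m = \<zero>\<^bsub>?Q\<^esub>"
      using pow[of l] czero[OF unif_pow_VG] by auto
    fix X assume "X \<in> carrier ?Q"
    then obtain x where x: "x \<in> VG 0" "X = ?c x" unfolding carrier_quot by blast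
    show "\<exists>u\<in>Units ?Q. \<exists>i::nat. X = u \<otimes>\<^bsub>?Q\<^esub> ?c unif [^]\<^bsub>?Q\<^esub> i"
    proof (cases "x = \<zero>")
      case True
      \<comment> \<open>The value of \<open>v\<close> at zero carries no information; zero is
        instead written as one times the \<open>l\<close>-th power of the uniformizer, which
        vanishes in the quotient.\<close>
      then have "X = \<one>\<^bsub>?Q\<^esub> \<otimes>\<^bsub>?Q\<^esub> ?c unif [^]\<^bsub>?Q\<^esub> l" using x(2) pow[of l] czero[OF unif_pow_VG] czero[OF VG_zero] by simp
      then show ?thesis using Q.Units_one_closed by blast
    next
      case False
      then obtain i where i: "v x = int i" using x(1) zero_le_imp_eq_int[of "v x"] by (auto simp: mem_VG)
      then have "x \<in> VG i" using x VG_closed by (simp add: mem_VG)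
      then obtain y where y: "y \<in> VG 0" "x = y \<otimes> unif [^] i" "y \<noteq> \<zero>" "v y = 0"
        using divide_unif_pow[of x i] False i by metis
      have yc: "y \<in> carrier K - {\<zero>}" using y VG_closed by blast
      then have yU: "y \<in> Units K" by (simp add: field_Units)
      have "inv y \<in> carrier K - {\<zero>}" using Units_inv_Units[OF yU] by (simp add: field_Units)
      moreover from this have "v y + v (inv y) = 0" using val_mult[OF yc, of "inv y"] yU val_one by simp
      \<comment> \<open>With \<open>y\<close> its inverse has valuation zero and is therefore
        integral, so the class of \<open>y\<close> is a unit of the quotient.\<close>
      ultimately have iy: "inv y \<in> VG 0" using y(4) by (simp add: mem_VG)
      have cy: "?c y \<in> carrier ?Q" "?c (inv y) \<in> carrier ?Q" using y iy unfolding carrier_quot by blast+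
      have "?c y \<otimes>\<^bsub>?Q\<^esub> ?c (inv y) = \<one>\<^bsub>?Q\<^esub>" "?c (inv y) \<otimes>\<^bsub>?Q\<^esub> ?c y = \<one>\<^bsub>?Q\<^esub>"
        using mult[OF y(1) iy] mult[OF iy y(1)] yU by (simp_all add: one)
      then have "?c y \<in> Units ?Q" using cy unfolding Units_def by blast
      moreover have "X = ?c y \<otimes>\<^bsub>?Q\<^esub> ?c unif [^]\<^bsub>?Q\<^esub> i"
        using x(2) y(2) mult[OF y(1) VG_mono[OF le0 unif_pow_VG[of i]]] pow[of i] by simp
      ultimately show ?thesis by blast
    qed
  qed
qed

end

theorem theorem1p1:
  fixes K :: "('a, 'b) ring_scheme" and v :: "'a \<Rightarrow> int" and l :: nat
  assumes "nonarch_local_field K v"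
    and "odd (ring_char (residue_field K v))"
    and "1 \<le> l"
  shows "strong_gelfand_pair (GL2 (trunc_ring K v l)) (upper_triangular_GL2 (trunc_ring K v l))"
  by (rule finite_chain_ring.strong_gelfand_GL2_Borel[OF
        nonarch_local_field.trunc_ring_finite_chain_ring[OF assms(1,3)]])

end
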